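(* (Glivenko-Cantelli.) Let $\mathbf{Z}^{(n)}_1,\ldots,\mathbf{Z}^{(n)}_n$ be i.i.d. with distribution $\mathrm{P}^{\mathbf{Z}}\in\mathfrak{P}_d$ over $\mathcal{S}^{d-1}$, with directional distribution function $\mathbf{F}$ and empirical directional distribution function $\mathbf{F}^{(n)}$ based on an $n$-point grid $\mathfrak{G}^{(n)}=\{\mathfrak{g}^{(n)}_1,\ldots,\mathfrak{g}^{(n)}_n\}\subset\mathcal{S}^{d-1}$. Then, provided that the sequence of uniform discrete distributions over the $n$ gridpoints of $\mathfrak{G}^{(n)}$ converges weakly, as $n\to\infty$, to the uniform distribution $\mathrm{P}^{\mathbf{U}}$ over $\mathcal{S}^{d-1}$, $$\max_{1\le i\le n}\big\|\mathbf{F}^{(n)}(\mathbf{Z}^{(n)}_i)-\mathbf{F}(\mathbf{Z}^{(n)}_i)\big\|\longrightarrow 0\qquad\text{almost surely as } n\to\infty.$$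
   Context: Let $d\ge 2$ and $\mathcal{S}^{d-1}=\{\mathbf{x}\in\mathbb{R}^d:\|\mathbf{x}\|=1\}$, with surface area measure $\lambda^{d-1}$. Let $c(\mathbf{y},\mathbf{z})=\tfrac12 d(\mathbf{y},\mathbf{z})^2$ with $d(\mathbf{y},\mathbf{z})=\arccos(\mathbf{y}^\top\mathbf{z})$. $\mathfrak{P}_d$ is the family of probability measures on $\mathcal{S}^{d-1}$ that are absolutely continuous with respect to $\lambda^{d-1}$ with densities bounded away from zero and infinity. For $\mathrm{P}^{\mathbf{Z}}\in\mathfrak{P}_d$, the directional distribution function $\mathbf{F}$ is the $\mathrm{P}^{\mathbf{Z}}$-a.s. unique minimizer of $\int c(\mathbf{z},\mathbf{S}(\mathbf{z}))\,\mathrm{d}\mathrm{P}^{\mathbf{Z}}(\mathbf{z})$ among measurable $\mathbf{S}:\mathcal{S}^{d-1}\to\mathcal{S}^{d-1}$ pushing $\mathrm{P}^{\mathbf{Z}}$ forward to $\mathrm{P}^{\mathbf{U}}$ (taken in its continuous version, which is a homeomorphism). The empirical directional distribution function $\mathbf{F}^{(n)}$ is the map $(\mathbf{Z}^{(n)}_1,\ldots,\mathbf{Z}^{(n)}_n)\mapsto(\mathbf{F}^{(n)}(\mathbf{Z}^{(n)}_1),\ldots,\mathbf{F}^{(n)}(\mathbf{Z}^{(n)}_n))$, where $\mathbf{F}^{(n)}$ is a bijection from the sample to the grid satisfying $$\sum_{i=1}^n c\big(\mathbf{Z}^{(n)}_i,\mathbf{F}^{(n)}(\mathbf{Z}^{(n)}_i)\big)=\min_{T}\sum_{i=1}^n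 c\big(\mathbf{Z}^{(n)}_i,\mathfrak{g}^{(n)}_{T(i)}\big),$$ the minimum being over all permutations $T$ of $\{1,\ldots,n\}$. *)

theory Defs
  imports "HOL-Probability.Probability" "HOL-Combinatorics.Permutations"
begin

abbreviation unit_sphere :: "(real ^ 'd) set"
  where "unit_sphere \<equiv> sphere 0 1"

definition sphere_borel :: "(real ^ 'd) measure"
  where "sphere_borel = restrict_space borel unit_sphere"

text \<open>
  Surface area is given by the polar-coordinate formula: the area of \<open>A\<close> is \<open>d\<close> times the
  Lebesgue measure of the (open, punctured) cone \<open>{r x | 0 < r < 1, x \<in> A}\<close> over \<open>A\<close>. As a measure,
  this is \<open>d\<close> times the image of Lebesgue measure on the punctured ball under \<open>x \<mapsto> x / \<parallel>x\<parallel>\<close>.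
\<close>

definition surface_measure :: "(real ^ 'd) measure"
  where "surface_measure =
    scale_measure (of_nat CARD('d))
      (distr (restrict_space lborel (ball 0 1 - {0})) sphere_borel (\<lambda>x. x /\<^sub>R norm x))"

lemma sets_sphere_borel: "A \<in> sets sphere_borel \<longleftrightarrow> A \<in> sets borel \<and> A \<subseteq> unit_sphere"
  by (auto simp: sphere_borel_def sets_restrict_space_iff)

lemma emeasure_surface_measure:
  fixes A :: "(real ^ 'd) set"
  assumes "A \<in> sets borel" "A \<subseteq> unit_sphere"
  shows "emeasure surface_measure A =
    of_nat CARD('d) * emeasure lborel {r *\<^sub>R x | r x. 0 < r \<and> r < 1 \<and> x \<in> A}"
proof -
  let ?B = "ball 0 1 - {0 :: real ^ 'd}"
  have m: "(\<lambda>x. x /\<^sub>R norm x) \<in> measurable (restrict_space lborel ?B) sphere_borel"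
    unfolding sphere_borel_def
    by (rule measurable_restrict_space2)
      (auto simp: space_restrict_space intro!: measurable_restrict_space1)
  have eq: "(\<lambda>x. x /\<^sub>R norm x) -` A \<inter> ?B = {r *\<^sub>R x | r x. 0 < r \<and> r < 1 \<and> x \<in> A}"
    (is "?L = ?R")
  proof (intro set_eqI iffI)
    fix x assume "x \<in> ?L"
    then have "x = norm x *\<^sub>R (x /\<^sub>R norm x)" "0 < norm x" "norm x < 1" "x /\<^sub>R norm x \<in> A"
      by auto
    then show "x \<in> ?R" by blast
  next
    fix x assume "x \<in> ?R"
    then obtain r y where "x = r *\<^sub>R y" "0 < r" "r < 1" "y \<in> A" by blast
    moreover from this have "norm y = 1" using assms(2) by auto
    ultimately show "x \<in> ?L" by (auto simp: divide_simps)
  qed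
  have "emeasure surface_measure A = of_nat CARD('d) *
      emeasure (restrict_space lborel ?B) ((\<lambda>x. x /\<^sub>R norm x) -` A \<inter> ?B)"
    using assms m
    by (simp add: surface_measure_def emeasure_distr sets_sphere_borel space_restrict_space)
  also have "emeasure (restrict_space lborel ?B) ((\<lambda>x. x /\<^sub>R norm x) -` A \<inter> ?B)
      = emeasure lborel ((\<lambda>x. x /\<^sub>R norm x) -` A \<inter> ?B)"
    by (rule emeasure_restrict_space) auto
  finally show ?thesis by (simp only: eq)
qed

definition uniform_sphere :: "(real ^ 'd) measure"
  where "uniform_sphere = uniform_measure surface_measure unit_sphere"

definition bounded_density_laws :: "(real ^ 'd) measure set"
  where "bounded_density_laws = {P. prob_space P \<and>
    (\<exists>f \<in> borel_measurable surface_measure. \<exists>a b :: real. 0 < a \<and>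
      (\<forall>x \<in> unit_sphere. a \<le> f x \<and> f x \<le> b) \<and>
      P = density surface_measure (\<lambda>x. ennreal (f x)))}"

definition geodesic_dist :: "real ^ 'd \<Rightarrow> real ^ 'd \<Rightarrow> real"
  where "geodesic_dist y z = arccos (y \<bullet> z)"

definition cost :: "real ^ 'd \<Rightarrow> real ^ 'd \<Rightarrow> real"
  where "cost y z = 1 / 2 * (geodesic_dist y z)\<^sup>2"

definition transport_maps ::
    "(real ^ 'd) measure \<Rightarrow> (real ^ 'd) measure \<Rightarrow> (real ^ 'd \<Rightarrow> real ^ 'd) set"
  where "transport_maps P Q =
    {S \<in> measurable sphere_borel sphere_borel. distr P sphere_borel S = Q}"

definition optimal_transport_map ::
    "(real ^ 'd) measure \<Rightarrow> (real ^ 'd) measure \<Rightarrow> (real ^ 'd \<Rightarrow> real ^ 'd) \<Rightarrow> bool"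
  where "optimal_transport_map P Q F \<longleftrightarrow>
    F \<in> transport_maps P Q \<and>
    (\<forall>S \<in> transport_maps P Q. (LINT z|P. cost z (F z)) \<le> (LINT z|P. cost z (S z)))"

text \<open>
  The minimizer is unique up to \<open>P\<close>-null sets when \<open>P\<close> is in \<^const>\<open>bounded_density_laws\<close>, so
  continuity determines it on the whole sphere; it is then a homeomorphism of the sphere.
  Uniqueness and the homeomorphism property are thus consequences and are not imposed here.
  Values of \<open>F\<close> off the sphere are arbitrary.
\<close>

definition directional_df :: "(real ^ 'd) measure \<Rightarrow> (real ^ 'd \<Rightarrow> real ^ 'd) \<Rightarrow> bool"
  where "directional_df P F \<longleftrightarrow>
    optimal_transport_map P uniform_sphere F \<and> continuous_on unit_sphere F"

text \<open>
  The bijection condition forces the sample points \<open>z 1, \<dots>, z n\<close> to be as many as the grid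
  points. Where the optimal assignment is not unique, any choice is admitted.
\<close>

definition empirical_directional_df ::
    "nat \<Rightarrow> (nat \<Rightarrow> real ^ 'd) \<Rightarrow> (nat \<Rightarrow> real ^ 'd) \<Rightarrow> (real ^ 'd \<Rightarrow> real ^ 'd) \<Rightarrow> bool"
  where "empirical_directional_df n g z Fn \<longleftrightarrow>
    bij_betw Fn (z ` {1..n}) (g ` {1..n}) \<and>
    (\<Sum>i = 1..n. cost (z i) (Fn (z i))) =
      (MIN T \<in> {T. T permutes {1..n}}. \<Sum>i = 1..n. cost (z i) (g (T i)))"

definition discrete_uniform :: "(real ^ 'd) set \<Rightarrow> (real ^ 'd) measure"
  where "discrete_uniform G = distr (uniform_count_measure G) sphere_borel (\<lambda>x. x)"

text \<open>The library's \<^const>\<open>weak_conv_m\<close> covers only measures on the real line.\<close>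

definition weakly_converges_sphere ::
    "(nat \<Rightarrow> (real ^ 'd) measure) \<Rightarrow> (real ^ 'd) measure \<Rightarrow> bool"
  where "weakly_converges_sphere \<mu> \<nu> \<longleftrightarrow>
    (\<forall>f :: real ^ 'd \<Rightarrow> real. continuous_on unit_sphere f \<and> bounded (f ` unit_sphere) \<longrightarrow>
      (\<lambda>n. LINT x|\<mu> n. f x) \<longlonglongrightarrow> (LINT x|\<nu>. f x))"

end

theory Submission
  imports Defs "HOL-Combinatorics.Cycles"
begin

text \<open>
  The argument is the stability of optimal transport under weak convergence, sharpened to single
  points by the geometry of the squared geodesic distance.

  Almost surely, the frequencies of the cells of countably many fine partitions of the sphere
  converge in the rows of the sample (\<open>rowwise_iid_frequency_limit\<close>). Fix such an outcome and suppose
  that for infinitely many \<open>n\<close> some sample point is matched to a grid point far from its image under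
  \<open>F\<close>. Along an ultrafilter on these \<open>n\<close> every bounded quantity converges; let \<open>(z0, y0)\<close> be the limit of
  the bad pairs.

  An optimal assignment has dual potentials (\<open>optimal_assignment_potentials\<close>), which extend to
  functions on the sphere with a modulus of continuity given by the cost alone
  (\<open>cost_potentials_on_sphere\<close>). Their limits \<open>u\<close>, \<open>v\<close> satisfy \<open>u z + v y \<le> cost z y\<close>, with equality at
  \<open>(z0, y0)\<close>, and the sum of their integrals is the limit of the average assignment costs. On the other
  hand, the limit of the assignments is a transport plan, and since \<open>P\<close> has no atoms a plan can be
  approximated by maps (\<open>transport_with_cell_densities\<close>, \<open>map_cost_le_limit_assignment_cost\<close>). So the
  optimal map \<open>F\<close> costs no more than that limit. Hence \<open>u z + v (F z) = cost z (F z)\<close> for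
  almost every \<open>z\<close>, and for every \<open>z\<close> by continuity.

  The graph of \<open>F\<close> together with \<open>(z0, y0)\<close> is therefore monotone with respect to the cost. If \<open>F z0\<close> is
  not the antipode of \<open>z0\<close>, a first variation of the cost along geodesics issuing from \<open>z0\<close> gives
  \<open>y0 = F z0\<close> (\<open>monotone_partner_unique\<close>). If it is the antipode, monotonicity forces \<open>F\<close> to be constant
  (\<open>monotone_antipode_constant\<close>), which is impossible because the uniform law has no atoms.
\<close>

section \<open>Limits along ultrafilters\<close>

text \<open>
  Ultrafilters are kept as filters, so that limits along them are ordinary limits. They replace
  repeated extraction of subsequences: one choice makes every bounded sequence converge.
\<close>

definition ultra :: "'a filter \<Rightarrow> bool"
  where "ultra F \<longleftrightarrow> F \<noteq> bot \<and> (\<forall>P. eventually P F \<or> eventually (\<lambda>x. \<not> P x) F)"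

lemma ultra_refinement:
  assumes "G \<noteq> bot"
  obtains F where "F \<le> G" "ultra F"
proof -
  define A where "A = {F. F \<le> G \<and> F \<noteq> bot}"
  \<comment> \<open>An ultrafilter is a minimal proper filter; a chain of proper filters has a proper infimum.\<close>
  have "\<exists>m\<in>A. \<forall>a\<in>A. a \<le> m \<longrightarrow> a = m"
  proof (rule predicate_Zorn[where P = "\<lambda>x y. y \<le> x" and A = A])
    show "partial_order_on A (relation_of (\<lambda>x y. y \<le> x) A)"
      by (rule partial_order_on_relation_ofI) auto
  next
    fix C assume C: "C \<in> Chains (relation_of (\<lambda>x y. y \<le> x) A)"
    have sub: "C \<subseteq> A" using C by (rule Chains_relation_of)
    have ch: "a \<le> b \<or> b \<le> a" if "a \<in> C" "b \<in> C" for a b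
      using C that unfolding Chains_def relation_of_def by auto
    show "\<exists>u\<in>A. \<forall>a\<in>C. u \<le> a"
    proof (cases "C = {}")
      case True
      then show ?thesis using assms unfolding A_def by auto
    next
      case False
      have "eventually P (Inf C) \<longleftrightarrow> (\<exists>b\<in>C. eventually P b)" for P
      proof (rule eventually_Inf_base[OF False])
        fix x y assume "x \<in> C" "y \<in> C"
        then show "\<exists>z\<in>C. z \<le> inf x y"
          using ch[of x y] by (metis inf.absorb1 inf.absorb2 order_refl)
      qed
      then have "Inf C \<noteq> bot"
        using sub unfolding A_def trivial_limit_def by auto
      moreover have "Inf C \<le> G"
        using False sub unfolding A_def by (auto intro: Inf_lower2)
      ultimately show ?thesis unfolding A_def by (auto intro: Inf_lower)
    qed
  qed
  then obtain m where m: "m \<in> A" "\<And>a. a \<in> A \<Longrightarrow> a \<le> m \<Longrightarrow> a = m" by blast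
  have "eventually P m \<or> eventually (\<lambda>x. \<not> P x) m" for P
  proof (rule disjCI)
    assume n: "\<not> eventually (\<lambda>x. \<not> P x) m"
    let ?k = "inf m (principal {x. P x})"
    have "?k \<noteq> bot"
      using n by (simp add: trivial_limit_def eventually_inf_principal)
    then have "?k \<in> A" using m(1) by (auto simp: A_def intro: le_infI1)
    then have "?k = m" using m(2) by simp
    moreover have "eventually P ?k" by (simp add: eventually_inf_principal)
    ultimately show "eventually P m" by simp
  qed
  then show ?thesis using that[of m] m(1) unfolding A_def ultra_def by auto
qed

lemma ultra_compact_limit:
  fixes f :: "'a \<Rightarrow> 'b :: topological_space"
  assumes "ultra F" "compact K" "eventually (\<lambda>x. f x \<in> K) F"
  obtains l where "l \<in> K" "(f \<longlongrightarrow> l) F"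
proof -
  have "filtermap f F \<noteq> bot" using assms(1) by (simp add: ultra_def filtermap_bot_iff)
  then obtain l where l: "l \<in> K" "inf (nhds l) (filtermap f F) \<noteq> bot"
    using compact_filter[of K] assms(2,3) by (auto simp: eventually_filtermap)
  have "eventually (\<lambda>x. f x \<in> S) F" if S: "open S" "l \<in> S" for S
  proof (rule ccontr)
    assume "\<not> ?thesis"
    then have "eventually (\<lambda>x. f x \<notin> S) F" using assms(1) unfolding ultra_def by blast
    then have "eventually (\<lambda>y. y \<notin> S) (filtermap f F)" by (simp add: eventually_filtermap)
    moreover have "eventually (\<lambda>y. y \<in> S) (nhds l)" using S by (rule eventually_nhds_in_open)
    ultimately have "eventually (\<lambda>y. False) (inf (nhds l) (filtermap f F))"
      unfolding eventually_inf by blast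
    then show False using l(2) by (simp add: trivial_limit_def)
  qed
  then show ?thesis using that l(1) by (auto intro!: topological_tendstoI)
qed

lemma ultra_bounded_limit:
  fixes f :: "'a \<Rightarrow> real"
  assumes "ultra F" "eventually (\<lambda>x. \<bar>f x\<bar> \<le> B) F"
  obtains l where "\<bar>l\<bar> \<le> B" "(f \<longlongrightarrow> l) F"
proof -
  have "eventually (\<lambda>x. f x \<in> {-B..B}) F"
    using assms(2) by eventually_elim auto
  then obtain l where "l \<in> {-B..B}" "(f \<longlongrightarrow> l) F"
    by (rule ultra_compact_limit[OF assms(1) compact_Icc])
  then show ?thesis using that[of l] by (auto simp: abs_le_iff)
qed

section \<open>Duality for the assignment problem\<close>

text \<open>
  A path is listed from its end back to its start: the head is the vertex reached last, and
  \<open>w b a\<close> is the weight of the step from \<open>b\<close> to \<open>a\<close>. Extending a path is then \<open>Cons\<close>.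
\<close>

fun path_weight :: "('a \<Rightarrow> 'a \<Rightarrow> real) \<Rightarrow> 'a list \<Rightarrow> real"
  where
    "path_weight w (a # b # xs) = w b a + path_weight w (b # xs)"
  | "path_weight w xs = 0"

lemma path_weight_split:
  "path_weight w (ys @ k # zs) = path_weight w (ys @ [k]) + path_weight w (k # zs)"
proof (induction w ys rule: path_weight.induct)
  case ("2_2" w v)
  then show ?case by (cases zs) auto
qed auto

lemma path_weight_nth:
  "path_weight w cs = (\<Sum>i<length cs - 1. w (cs ! Suc i) (cs ! i))"
proof (induction w cs rule: path_weight.induct)
  case (1 w a b xs)
  then show ?case by (simp add: sum.lessThan_Suc_shift del: sum.lessThan_Suc)
qed auto

text \<open>
  A path without repetition, closed up by one more step, is a cyclic permutation of its vertices.
\<close>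

lemma closed_path_weight:
  assumes cs: "distinct cs" "cs \<noteq> []"
  shows "path_weight w cs + w (hd cs) (last cs) = (\<Sum>x\<in>set cs. w (cycle_of_list cs x) x)"
proof -
  obtain m where m: "length cs = Suc m" using cs(2) by (cases cs) auto
  have rot: "cycle_of_list cs (cs ! i) = rotate1 cs ! i" if "i < length cs" for i
    using arg_cong[OF cyclic_rotation[OF cs(1), of 1], of "\<lambda>xs. xs ! i"] that
    by (simp del: cycle_of_list.simps)
  have "(\<Sum>x\<in>set cs. w (cycle_of_list cs x) x) = (\<Sum>i<length cs. w (cycle_of_list cs (cs ! i)) (cs ! i))"
    using sum.reindex_bij_betw[OF bij_betw_nth[OF cs(1) refl refl], of "\<lambda>x. w (cycle_of_list cs x) x"]
    by simp
  also have "\<dots> = (\<Sum>i<length cs. w (cs ! (Suc i mod length cs)) (cs ! i))"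
    by (intro sum.cong refl) (simp add: rot nth_rotate1)
  also have "\<dots> = (\<Sum>i<m. w (cs ! (Suc i)) (cs ! i)) + w (cs ! 0) (cs ! m)"
    by (simp add: m)
  also have "\<dots> = path_weight w cs + w (hd cs) (last cs)"
    using cs(2) by (simp add: path_weight_nth m hd_conv_nth last_conv_nth)
  finally show ?thesis by simp
qed

text \<open>
  Duality for the assignment problem. Re-assigning row \<open>i\<close> to the partner of \<open>j\<close> changes the cost by
  \<open>c i j - c j j\<close>, taken as the weight of a step from \<open>j\<close> to \<open>i\<close>. Optimality against cyclic
  permutations says that no simple cycle has negative weight, so shortest distances over
  repetition-free paths satisfy the triangle inequality, and they are the row potentials.
\<close>

lemma optimal_assignment_potentials:
  fixes c :: "'a \<Rightarrow> 'a \<Rightarrow> real"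
  assumes fin: "finite A"
    and opt: "\<And>p. p permutes A \<Longrightarrow> (\<Sum>i\<in>A. c i i) \<le> (\<Sum>i\<in>A. c i (p i))"
  obtains u v :: "'a \<Rightarrow> real"
  where "\<And>i j. i \<in> A \<Longrightarrow> j \<in> A \<Longrightarrow> u i + v j \<le> c i j"
    and "\<And>i. i \<in> A \<Longrightarrow> u i + v i = c i i"
proof -
  define w where "w j i = c i j - c j j" for i j
  define L where "L k = {xs. distinct xs \<and> set xs \<subseteq> A \<and> xs \<noteq> [] \<and> hd xs = k}" for k
  define u where "u k = Min (path_weight w ` L k)" for k
  have finL: "finite (path_weight w ` L k)" for k
  proof -
    have "L k \<subseteq> {xs. set xs \<subseteq> A \<and> length xs \<le> card A}"
      using fin by (auto simp: L_def distinct_card[symmetric] intro: card_mono)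
    then show ?thesis using finite_lists_length_le[OF fin] by (meson finite_imageI finite_subset)
  qed
  have cyc: "path_weight w cs + w (hd cs) (last cs) \<ge> 0"
    if cs: "distinct cs" "cs \<noteq> []" "set cs \<subseteq> A" for cs
  proof -
    let ?p = "cycle_of_list cs"
    have pA: "?p permutes A" using cycle_permutes cs(3) by (rule permutes_subset)
    have "(\<Sum>x\<in>set cs. w (?p x) x) = (\<Sum>x\<in>A. c x (?p x) - c (?p x) (?p x))"
      unfolding w_def
      by (rule sum.mono_neutral_left[OF fin cs(3)]) (auto simp: id_outside_supp)
    also have "\<dots> = (\<Sum>x\<in>A. c x (?p x)) - (\<Sum>x\<in>A. c (?p x) (?p x))"
      by (rule sum_subtractf)
    also have "(\<Sum>x\<in>A. c (?p x) (?p x)) = (\<Sum>x\<in>A. c x x)"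
      using sum.permute[OF pA, of "\<lambda>x. c x x"] by (simp add: comp_def)
    finally show ?thesis using opt[OF pA] closed_path_weight[OF cs(1,2), of w] by simp
  qed
  have tri: "u k \<le> u j + w j k" if jk: "j \<in> A" "k \<in> A" for j k
  proof -
    have "[j] \<in> L j" using jk by (simp add: L_def)
    then have "u j \<in> path_weight w ` L j" unfolding u_def using finL by (intro Min_in) auto
    then obtain xs where xs: "u j = path_weight w xs" "xs \<in> L j" by auto
    show ?thesis
    \<comment> \<open>A path that already visits \<open>k\<close> is cut there; the part cut off closes to a cycle of nonnegative weight.\<close>
    proof (cases "k \<in> set xs")
      case False
      then have "k # xs \<in> L k" using xs(2) jk by (auto simp: L_def)
      then have "u k \<le> path_weight w (k # xs)" unfolding u_def using finL by (intro Min_le) auto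
      also have "\<dots> = w j k + path_weight w xs"
        using xs(2) by (cases xs) (auto simp: L_def)
      finally show ?thesis using xs(1) by simp
    next
      case True
      then obtain ys zs where s: "xs = ys @ k # zs" by (meson split_list)
      have "k # zs \<in> L k" using xs(2) s by (auto simp: L_def)
      then have 1: "u k \<le> path_weight w (k # zs)" unfolding u_def using finL by (intro Min_le) auto
      have "path_weight w (ys @ [k]) + w (hd (ys @ [k])) (last (ys @ [k])) \<ge> 0"
        using xs(2) s by (intro cyc) (auto simp: L_def)
      moreover have "hd (ys @ [k]) = j" using xs(2) s by (cases ys) (auto simp: L_def)
      ultimately show ?thesis using 1 xs(1) s path_weight_split[of w ys k zs] by simp
    qed
  qed
  show ?thesis
  proof (rule that[of u "\<lambda>j. c j j - u j"])
    fix i j assume "i \<in> A" "j \<in> A"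
    then show "u i + (c j j - u j) \<le> c i j" using tri[of j i] by (simp add: w_def)
  qed simp
qed

section \<open>Transport from atomless measures\<close>

text \<open>
  A ternary expansion with digits 0 and 1 only has no ambiguous representation: after multiplication
  by a power of 3 the fractional part is at most \<open>1 / 2\<close>, so the digits can be read off with floors.
\<close>

lemma ternary_digit:
  fixes b :: "nat \<Rightarrow> bool"
  shows "\<lfloor>(\<Sum>j. of_bool (b j) / 3 ^ Suc j) * 3 ^ Suc k :: real\<rfloor> mod 3 = of_bool (b k)"
proof -
  define s where "s k = (\<Sum>i. of_bool (b (i + k)) / 3 ^ Suc i :: real)" for k
  have g: "(\<lambda>i. 1 / 3 ^ Suc i :: real) sums (1 / 2)"
    using sums_mult[OF geometric_sums[of "1/3::real"], of "1/3"] by (simp add: power_divide)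
  have sm: "summable (\<lambda>i. of_bool (b (i + k)) / 3 ^ Suc i :: real)" for k
    by (rule summable_comparison_test[OF _ sums_summable[OF g]]) auto
  have s0: "0 \<le> s k" and s1: "s k \<le> 1 / 2" for k
  proof -
    show "0 \<le> s k" unfolding s_def by (rule suminf_nonneg[OF sm]) auto
    have "s k \<le> (\<Sum>i. 1 / 3 ^ Suc i)"
      unfolding s_def by (rule suminf_le[OF _ sm sums_summable[OF g]]) (auto simp: divide_right_mono)
    then show "s k \<le> 1 / 2" using g by (simp add: sums_iff)
  qed
  have step: "3 * s k = of_bool (b k) + s (Suc k)" for k
  proof -
    have "s k = of_bool (b k) / 3 + (\<Sum>i. of_bool (b (Suc i + k)) / 3 ^ Suc (Suc i))"
      unfolding s_def using suminf_split_head[OF sm[of k]] by simp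
    also have "(\<Sum>i. of_bool (b (Suc i + k)) / 3 ^ Suc (Suc i)) = (\<Sum>i. of_bool (b (i + Suc k)) / 3 ^ Suc i / 3 :: real)"
      by (simp add: field_simps)
    also have "\<dots> = s (Suc k) / 3"
      unfolding s_def by (rule suminf_divide[OF sm])
    finally show ?thesis by simp
  qed
  have "\<exists>N::int. s 0 * 3 ^ k = real_of_int N + s k" for k
  proof (induction k)
    case 0
    show ?case by (rule exI[of _ 0]) simp
  next
    case (Suc k)
    then obtain N :: int where "s 0 * 3 ^ k = real_of_int N + s k" by blast
    then have "s 0 * 3 ^ Suc k = real_of_int (3 * N + of_bool (b k)) + s (Suc k)"
      using step[of k] by simp
    then show ?case by blast
  qed
  then obtain N :: int where "s 0 * 3 ^ k = real_of_int N + s k" by blast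
  then have "s 0 * 3 ^ Suc k = real_of_int (3 * N + of_bool (b k)) + s (Suc k)"
    using step[of k] by simp
  then have "\<lfloor>s 0 * 3 ^ Suc k\<rfloor> = 3 * N + of_bool (b k)"
    using s0[of "Suc k"] s1[of "Suc k"] by (intro floor_unique) auto
  then show ?thesis by (simp add: s_def)
qed

text \<open>
  Each point is coded by the answers to the countably many questions ``is coordinate \<open>i\<close> larger than
  \<open>q\<close>?'' with \<open>q\<close> rational, written as ternary digits. Decoding takes suprema of rationals; the bound
  \<open>-2 \<le> q \<le> 2\<close> and the default \<open>-2\<close> keep these suprema finite for arbitrary arguments.
\<close>

lemma sphere_measurable_encoding:
  obtains e :: "real ^ 'd \<Rightarrow> real" and r :: "real \<Rightarrow> real ^ 'd"
  where "e \<in> borel_measurable borel" "r \<in> borel_measurable borel"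
    "\<And>x. x \<in> unit_sphere \<Longrightarrow> r (e x) = x"
proof -
  define I where "I = (UNIV :: ('d \<times> rat) set)"
  have cI: "countable I" unfolding I_def by simp
  define B where "B k x \<longleftrightarrow> x $ fst (from_nat_into I k) > real_of_rat (snd (from_nat_into I k))"
    for k and x :: "real ^ 'd"
  define e where "e x = (\<Sum>k. of_bool (B k x) / 3 ^ Suc k :: real)" for x
  define D where "D k t \<longleftrightarrow> \<lfloor>t * 3 ^ Suc k :: real\<rfloor> mod 3 = 1" for k and t
  define Q where "Q = {q :: rat. - 2 \<le> q \<and> q \<le> 2}"
  define g where "g i q t = (if D (to_nat_on I (i, q)) t then real_of_rat q else - 2)"
    for i :: 'd and q t
  define r where "r t = (\<chi> i. SUP q\<in>Q. g i q t)" for t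
  have Q: "countable Q" "Q \<noteq> {}" unfolding Q_def by (auto intro: exI[of _ 0])
  have bdd: "bdd_above ((\<lambda>q. g i q t) ` Q)" for i t
  proof (rule bdd_aboveI2[where M = 2])
    fix q assume "q \<in> Q"
    then have "real_of_rat q \<le> real_of_rat 2" unfolding of_rat_less_eq by (simp add: Q_def)
    then show "g i q t \<le> 2" by (simp add: g_def)
  qed
  have comp[measurable]: "(\<lambda>x::real^'d. x $ i) \<in> borel_measurable borel" for i
    by (intro borel_measurable_continuous_onI continuous_intros)
  have me: "e \<in> borel_measurable borel"
    unfolding e_def[abs_def] B_def of_bool_def by measurable
  have mg: "(\<lambda>t. g i q t) \<in> borel_measurable borel" for i q
    unfolding g_def D_def by measurable
  have mr: "r \<in> borel_measurable borel"
  proof -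
    have "(\<lambda>t. SUP q\<in>Q. g i q t) \<in> borel_measurable borel" for i
      by (rule borel_measurable_cSUP[OF Q(1) mg bdd])
    then have "(\<lambda>t. r t \<bullet> b) \<in> borel_measurable borel" if "b \<in> Basis" for b :: "real ^ 'd"
      using that by (auto simp: Basis_vec_def r_def inner_axis)
    then show ?thesis unfolding borel_measurable_euclidean_space[where f = r] by blast
  qed
  have "r (e x) = x" if x: "x \<in> unit_sphere" for x
  proof -
    have "(SUP q\<in>Q. g i q (e x)) = x $ i" for i
    proof -
      have xi: "\<bar>x $ i\<bar> \<le> 1" using component_le_norm_cart[of x i] x by simp
      have geq: "g i q (e x) = (if x $ i > real_of_rat q then real_of_rat q else - 2)" for q
      proof -
        have "from_nat_into I (to_nat_on I (i, q)) = (i, q)"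
          using cI by (intro from_nat_into_to_nat_on) (auto simp: I_def)
        then show ?thesis
          using ternary_digit[of "\<lambda>k. B k x" "to_nat_on I (i, q)"]
          unfolding g_def D_def e_def by (auto simp: B_def)
      qed
      show ?thesis
      proof (rule antisym)
        show "(SUP q\<in>Q. g i q (e x)) \<le> x $ i"
          using xi by (intro cSUP_least[OF Q(2)]) (auto simp: geq)
        show "x $ i \<le> (SUP q\<in>Q. g i q (e x))"
        proof (rule dense_le)
          fix y assume "y < x $ i"
          then have "max y (- 2) < x $ i" using xi by auto
          then obtain q where q: "max y (- 2) < real_of_rat q" "real_of_rat q < x $ i"
            using of_rat_dense by blast
          then have "real_of_rat (- 2) \<le> real_of_rat q" "real_of_rat q \<le> real_of_rat 2"
            using xi by auto
          then have "q \<in> Q" unfolding of_rat_less_eq by (simp add: Q_def)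
          then have "g i q (e x) \<le> (SUP q\<in>Q. g i q (e x))" by (rule cSUP_upper[OF _ bdd])
          then show "y \<le> (SUP q\<in>Q. g i q (e x))" using q by (simp add: geq)
        qed
      qed
    qed
    then show ?thesis by (simp add: r_def vec_eq_iff)
  qed
  then show ?thesis using that me mr by blast
qed

text \<open>
  The distribution function of \<open>X\<close> is continuous, so it turns \<open>X\<close> into a uniform variable. The
  quantile function of the encoded measure turns this into the encoded measure, and decoding gives
  \<open>\<nu>\<close>.
\<close>

lemma atomless_transport:
  fixes \<nu> :: "(real ^ 'd) measure" and X :: "'a \<Rightarrow> real"
  assumes "prob_space \<mu>" and X: "X \<in> borel_measurable \<mu>"
    and atomless: "\<And>t. measure \<mu> {x \<in> space \<mu>. X x = t} = 0"
    and "prob_space \<nu>" and sets_\<nu>: "sets \<nu> = sets sphere_borel"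
  obtains T where "T \<in> measurable \<mu> sphere_borel" "distr \<mu> sphere_borel T = \<nu>"
proof -
  interpret mu: prob_space \<mu> by fact
  interpret nu: prob_space \<nu> by fact
  have space_\<nu>: "space \<nu> = unit_sphere"
    using sets_eq_imp_space_eq[OF sets_\<nu>] by (simp add: sphere_borel_def space_restrict_space)
  obtain e :: "real ^ 'd \<Rightarrow> real" and r where er: "e \<in> borel_measurable borel" "r \<in> borel_measurable borel"
    "\<And>x. x \<in> unit_sphere \<Longrightarrow> r (e x) = x"
    by (rule sphere_measurable_encoding) blast
  note er(2)[measurable] X[measurable]
  have id\<nu>: "(\<lambda>x. x) \<in> borel_measurable \<nu>"
    unfolding measurable_cong_sets[OF sets_\<nu> refl] sphere_borel_def
    by (intro measurable_restrict_space1) simp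
  have e\<nu>[measurable]: "e \<in> borel_measurable \<nu>"
    using measurable_compose[OF id\<nu> er(1)] .
  define \<Omega> where "\<Omega> = (restrict_space lborel {0<..<1} :: real measure)"
  have s\<Omega>: "sets \<Omega> = sets (restrict_space borel {0<..<1})" "space \<Omega> = {0<..<1}"
    unfolding \<Omega>_def by (auto simp: sets_restrict_space space_restrict_space)
  interpret A: cdf_distribution "distr \<mu> borel X"
    unfolding cdf_distribution_def by (rule mu.real_distribution_distr) (rule X)
  interpret B: cdf_distribution "distr \<nu> borel e"
    unfolding cdf_distribution_def by (rule nu.real_distribution_distr) (rule e\<nu>)
  define G where "G = cdf (distr \<mu> borel X)"
  \<comment> \<open>The quantile function is used on the open unit interval only; the value 0 elsewhere has probability 0.\<close>
  define J where "J t = (if t \<in> {0<..<1} then B.I t else 0)" for t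
  have mG[measurable]: "G \<in> borel_measurable borel" unfolding G_def by (rule A.measurable_C)
  have mJ[measurable]: "J \<in> borel_measurable borel"
  proof -
    have "{t \<in> space borel. t \<in> {0<..<1::real}} = {0<..<1}" by auto
    then show ?thesis
      unfolding J_def[abs_def]
      by (subst measurable_If_restrict_space_iff) (use B.measurable_CI in \<open>auto simp del: greaterThanLessThan_iff\<close>)
  qed
  have mAI: "A.I \<in> borel_measurable \<Omega>"
    unfolding measurable_cong_sets[OF s\<Omega>(1) refl] by (rule A.measurable_CI)
  have contG: "isCont G x" for x
    unfolding G_def A.isCont_cdf using atomless[of x]
    by (simp add: measure_distr vimage_def Int_def conj_commute)
  \<comment> \<open>Continuity of the distribution function makes the quantile function a true right inverse.\<close>
  have GI: "G (A.I t) = t" if t: "t \<in> {0<..<1}" for t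
  proof (rule antisym)
    show "t \<le> G (A.I t)" using A.pseudoinverse[of t "A.I t"] t by (simp add: G_def)
    have "(G \<longlongrightarrow> G (A.I t)) (at_left (A.I t))"
      using contG by (simp add: continuous_at_imp_continuous_within continuous_within[symmetric])
    then show "G (A.I t) \<le> t"
    proof (rule tendsto_upperbound)
      have "\<forall>\<^sub>F x in at_left (A.I t). x < A.I t" by (simp add: eventually_at_filter)
      then show "\<forall>\<^sub>F x in at_left (A.I t). G x \<le> t"
      proof eventually_elim
        case (elim x)
        then show ?case using A.pseudoinverse[of t x] t by (simp add: G_def)
      qed
    qed simp
  qed
  have "distr (distr \<mu> borel X) borel G = distr (distr \<Omega> borel A.I) borel G"
    using A.distr_I_eq_M by (simp add: \<Omega>_def)
  also have "\<dots> = distr \<Omega> borel (G \<circ> A.I)"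
    by (rule distr_distr[OF mG mAI])
  also have "\<dots> = distr \<Omega> borel (\<lambda>t. t)"
    by (rule distr_cong) (auto simp: s\<Omega> GI)
  finally have dG: "distr (distr \<mu> borel X) borel G = distr \<Omega> borel (\<lambda>t. t)" .
  have id\<Omega>: "(\<lambda>t. t) \<in> borel_measurable \<Omega>"
    unfolding measurable_cong_sets[OF s\<Omega>(1) refl] by (intro measurable_restrict_space1) simp
  define T0 where "T0 x = r (J (G (X x)))" for x
  have mT0[measurable]: "T0 \<in> borel_measurable \<mu>" unfolding T0_def[abs_def] by measurable
  have "distr \<mu> borel T0 = distr (distr (distr (distr \<mu> borel X) borel G) borel J) borel r"
    by (subst distr_distr; (measurable)?)+ (simp add: T0_def[abs_def] comp_def)
  also have "\<dots> = distr (distr \<Omega> borel J) borel r"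
    unfolding dG by (subst distr_distr[OF mJ id\<Omega>]) (simp add: comp_def)
  also have "distr \<Omega> borel J = distr \<Omega> borel B.I"
    by (rule distr_cong) (auto simp: s\<Omega> J_def)
  also have "\<dots> = distr \<nu> borel e"
    using B.distr_I_eq_M by (simp add: \<Omega>_def)
  also have "distr (distr \<nu> borel e) borel r = distr \<nu> borel (\<lambda>x. x)"
    by (subst distr_distr) (auto intro!: distr_cong simp: space_\<nu> er(3))
  finally have dT0: "distr \<mu> borel T0 = distr \<nu> borel (\<lambda>x. x)" .
  have em: "emeasure \<mu> {x \<in> space \<mu>. T0 x \<in> A} = emeasure \<nu> A" if "A \<in> sets sphere_borel" for A
  proof -
    have A: "A \<in> sets borel" "A \<subseteq> unit_sphere" using that by (auto simp: sets_sphere_borel)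
    have "emeasure \<mu> {x \<in> space \<mu>. T0 x \<in> A} = emeasure (distr \<mu> borel T0) A"
      using A by (simp add: emeasure_distr vimage_def Int_def conj_commute)
    also have "\<dots> = emeasure \<nu> A"
      unfolding dT0 using A id\<nu> by (simp add: emeasure_distr space_\<nu> vimage_def Int_absorb2)
    finally show ?thesis .
  qed
  obtain p where p: "p \<in> (unit_sphere :: (real ^ 'd) set)"
    using nu.not_empty space_\<nu> by blast
  \<comment> \<open>The decoded value lies on the sphere almost surely; \<open>p\<close> repairs the exceptional null set.\<close>
  define T where "T x = (if T0 x \<in> unit_sphere then T0 x else p)" for x
  have SB[measurable]: "unit_sphere \<in> sets (borel :: (real ^ 'd) measure)" by simp
  have US: "unit_sphere \<in> sets (sphere_borel :: (real ^ 'd) measure)"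
    by (simp add: sets_sphere_borel)
  have mT: "T \<in> measurable \<mu> sphere_borel"
    unfolding sphere_borel_def
  proof (rule measurable_restrict_space2)
    show "T \<in> space \<mu> \<rightarrow> unit_sphere" using p by (auto simp: T_def)
    show "T \<in> borel_measurable \<mu>" unfolding T_def[abs_def] by measurable
  qed
  have ae: "AE x in \<mu>. T0 x \<in> unit_sphere"
  proof (rule mu.AE_I_eq_1)
    show "emeasure \<mu> {x \<in> space \<mu>. T0 x \<in> unit_sphere} = 1"
      using em[OF US] nu.emeasure_space_1 space_\<nu> by simp
  qed measurable
  have "distr \<mu> sphere_borel T = \<nu>"
  proof (rule measure_eqI)
    fix A assume "A \<in> sets (distr \<mu> sphere_borel T)"
    then have A: "A \<in> sets sphere_borel" by simp
    then have A': "A \<in> sets borel" by (simp add: sets_sphere_borel)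
    have "emeasure (distr \<mu> sphere_borel T) A = emeasure \<mu> {x \<in> space \<mu>. T x \<in> A}"
      using A mT by (simp add: emeasure_distr vimage_def Int_def conj_commute)
    also have "\<dots> = emeasure \<mu> {x \<in> space \<mu>. T0 x \<in> A}"
    proof (rule emeasure_eq_AE)
      show "AE x in \<mu>. x \<in> {x \<in> space \<mu>. T x \<in> A} \<longleftrightarrow> x \<in> {x \<in> space \<mu>. T0 x \<in> A}"
        using ae by eventually_elim (auto simp: T_def)
      show "{x \<in> space \<mu>. T x \<in> A} \<in> sets \<mu>"
        using measurable_sets[OF mT A] by (simp add: vimage_def Int_def conj_commute)
      show "{x \<in> space \<mu>. T0 x \<in> A} \<in> sets \<mu>" using A' by measurable
    qed
    finally show "emeasure (distr \<mu> sphere_borel T) A = emeasure \<nu> A" using em[OF A] by simp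
  qed (simp add: sets_\<nu>)
  then show ?thesis using that mT by blast
qed

text \<open>
  A transport plan that moves the cell \<open>j\<close> to the measure with density \<open>h j\<close> is realised exactly by a
  map, one cell at a time. This is how a limit of assignments, which is only a plan, becomes
  comparable with the optimal map.
\<close>

lemma transport_with_cell_densities:
  fixes P U :: "(real ^ 'd) measure" and X :: "real ^ 'd \<Rightarrow> real"
    and cell :: "real ^ 'd \<Rightarrow> nat" and h :: "nat \<Rightarrow> real ^ 'd \<Rightarrow> real"
  assumes "prob_space P" and sP: "sets P = sets sphere_borel"
    and "prob_space U" and sU: "sets U = sets sphere_borel"
    and X: "X \<in> borel_measurable P"
    and atomless: "\<And>t. measure P {x \<in> space P. X x = t} = 0"
    and cell: "cell \<in> measurable P (count_space UNIV)" and cellJ: "\<And>z. z \<in> space P \<Longrightarrow> cell z < J"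
    and h: "\<And>j. h j \<in> borel_measurable U" and h0: "\<And>j y. y \<in> space U \<Longrightarrow> 0 \<le> h j y"
    and mass: "\<And>j. j < J \<Longrightarrow> (\<integral>\<^sup>+y. h j y \<partial>U) = emeasure P {z \<in> space P. cell z = j}"
    and total: "AE y in U. (\<Sum>j<J. h j y) = 1"
  shows "\<exists>T \<in> transport_maps P U. \<forall>j<J.
      distr (density P (indicator {z \<in> space P. cell z = j})) sphere_borel T
        = density U (\<lambda>y. ennreal (h j y))"
proof -
  interpret P: prob_space P by fact
  interpret U: prob_space U by fact
  have spP: "space P = unit_sphere" and spU: "space U = unit_sphere"
    using sets_eq_imp_space_eq[OF sP] sets_eq_imp_space_eq[OF sU]
    by (simp_all add: sphere_borel_def space_restrict_space)
  note h[measurable] cell[measurable]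
  define Q where "Q j = {z \<in> space P. cell z = j}" for j
  have Q[measurable]: "Q j \<in> sets P" for j unfolding Q_def by measurable
  define good where "good j T \<longleftrightarrow> T \<in> measurable P sphere_borel \<and>
      (\<forall>B \<in> sets sphere_borel.
        emeasure P (Q j \<inter> {z \<in> space P. T z \<in> B}) = (\<integral>\<^sup>+y. ennreal (h j y) * indicator B y \<partial>U))"
    for j and T :: "real ^ 'd \<Rightarrow> real ^ 'd"
  have "\<exists>T. good j T"
    if j: "j < J" for j
  proof (cases "emeasure P (Q j) = 0")
    case True
    obtain p where p: "p \<in> (unit_sphere :: (real ^ 'd) set)" using P.not_empty spP by blast
    have "(\<integral>\<^sup>+y. ennreal (h j y) * indicator B y \<partial>U) \<le> (\<integral>\<^sup>+y. h j y \<partial>U)" for B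
      by (intro nn_integral_mono) (auto split: split_indicator)
    then have "(\<integral>\<^sup>+y. ennreal (h j y) * indicator B y \<partial>U) = 0" for B
      using mass[OF j] True by (simp add: Q_def)
    moreover have "emeasure P (Q j \<inter> B) = 0" for B
      using emeasure_mono[of "Q j \<inter> B" "Q j" P] True Q by simp
    ultimately show ?thesis
      unfolding good_def using p by (intro exI[of _ "\<lambda>_. p"]) (auto simp: sphere_borel_def space_restrict_space)
  next
    case False
    define m where "m = emeasure P (Q j)"
    have m: "m \<noteq> 0" "m \<noteq> \<infinity>" using False by (auto simp: m_def)
    have "prob_space (uniform_measure P (Q j))"
      using m by (intro prob_space_uniform_measure) (auto simp: m_def)
    moreover have "X \<in> borel_measurable (uniform_measure P (Q j))"
      using X by simp
    moreover have "measure (uniform_measure P (Q j)) {x \<in> space (uniform_measure P (Q j)). X x = t} = 0" for t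
    proof -
      have "{x \<in> space P. X x = t} \<in> null_sets P"
        using atomless[of t] X by (auto simp: P.emeasure_eq_measure)
      then have "emeasure P (Q j \<inter> {x \<in> space P. X x = t}) = 0"
        by (intro null_setsD1 null_set_Int1 null_set_Int2 Q)
      then show ?thesis using X by (simp add: measure_def)
    qed
    moreover have "prob_space (density U (\<lambda>y. ennreal (h j y) / m))"
    proof
      have "(\<integral>\<^sup>+y. ennreal (h j y) / m * indicator (space U) y \<partial>U) = (\<integral>\<^sup>+y. ennreal (h j y) / m \<partial>U)"
        by (intro nn_integral_cong) simp
      also have "\<dots> = m / m"
        using mass[OF j] by (simp add: nn_integral_divide m_def Q_def)
      finally have "(\<integral>\<^sup>+y. ennreal (h j y) / m * indicator (space U) y \<partial>U) = m / m" .
      then show "emeasure (density U (\<lambda>y. ennreal (h j y) / m)) (space (density U (\<lambda>y. ennreal (h j y) / m))) = 1"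
        using m by (simp add: emeasure_density ennreal_divide_self less_top)
    qed
    ultimately obtain T where T: "T \<in> measurable (uniform_measure P (Q j)) sphere_borel"
        "distr (uniform_measure P (Q j)) sphere_borel T = density U (\<lambda>y. ennreal (h j y) / m)"
      by (rule atomless_transport) (simp add: sU)
    have mT: "T \<in> measurable P sphere_borel" using T(1) by simp
    have "emeasure P (Q j \<inter> {z \<in> space P. T z \<in> B}) = (\<integral>\<^sup>+y. ennreal (h j y) * indicator B y \<partial>U)"
      if B: "B \<in> sets sphere_borel" for B
    proof -
      have BU[measurable]: "B \<in> sets U" using B sU by simp
      have TB: "T -` B \<inter> space P = {z \<in> space P. T z \<in> B}" by auto
      have TBs: "{z \<in> space P. T z \<in> B} \<in> sets P" using measurable_sets[OF mT B] TB by simp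
      have "emeasure P (Q j \<inter> {z \<in> space P. T z \<in> B}) / m
          = emeasure (distr (uniform_measure P (Q j)) sphere_borel T) B"
        using T(1) B TBs by (simp add: emeasure_distr TB m_def)
      also have "\<dots> = (\<integral>\<^sup>+y. ennreal (h j y) / m * indicator B y \<partial>U)"
        unfolding T(2) using B sU by (simp add: emeasure_density)
      also have "\<dots> = (\<integral>\<^sup>+y. ennreal (h j y) * indicator B y / m \<partial>U)"
        by (intro nn_integral_cong) (auto split: split_indicator)
      also have "\<dots> = (\<integral>\<^sup>+y. ennreal (h j y) * indicator B y \<partial>U) / m"
        by (rule nn_integral_divide) measurable
      finally have "emeasure P (Q j \<inter> {z \<in> space P. T z \<in> B}) / m * m
          = (\<integral>\<^sup>+y. ennreal (h j y) * indicator B y \<partial>U) / m * m" by simp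
      then show ?thesis using m by (simp add: ennreal_divide_times ennreal_divide_self less_top)
    qed
    then show ?thesis using mT unfolding good_def by blast
  qed
  then have "\<forall>j. \<exists>T. j < J \<longrightarrow> good j T" by blast
  then obtain T where "\<And>j. j < J \<Longrightarrow> good j (T j)" by metis
  then have T: "\<And>j. j < J \<Longrightarrow> T j \<in> measurable P sphere_borel"
    "\<And>j B. j < J \<Longrightarrow> B \<in> sets sphere_borel \<Longrightarrow>
      emeasure P (Q j \<inter> {z \<in> space P. T j z \<in> B}) = (\<integral>\<^sup>+y. ennreal (h j y) * indicator B y \<partial>U)"
    unfolding good_def by blast+
  obtain p where p: "p \<in> (unit_sphere :: (real ^ 'd) set)" using P.not_empty spP by blast
  define S where "S z = (if cell z < J then T (cell z) z else p)" for z
  have mS: "S \<in> measurable P sphere_borel"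
  proof -
    have "(\<lambda>z. (\<lambda>j z. if j < J then T j z else p) (cell z) z) \<in> measurable P sphere_borel"
    proof (rule measurable_compose_countable[OF _ cell])
      fix j show "(\<lambda>z. if j < J then T j z else p) \<in> measurable P sphere_borel"
        using T(1) p by (cases "j < J") (auto simp: sphere_borel_def space_restrict_space)
    qed
    then show ?thesis by (simp add: S_def[abs_def])
  qed
  have eq: "distr (density P (indicator (Q j))) sphere_borel S = density U (\<lambda>y. ennreal (h j y))"
    if j: "j < J" for j
  proof (rule measure_eqI)
    fix B assume "B \<in> sets (distr (density P (indicator (Q j))) sphere_borel S)"
    then have B: "B \<in> sets sphere_borel" by simp
    have SB: "{z \<in> space P. S z \<in> B} \<in> sets P"
      using measurable_sets[OF mS B] by (simp add: vimage_def Int_def conj_commute)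
    have "emeasure (distr (density P (indicator (Q j))) sphere_borel S) B
        = emeasure (density P (indicator (Q j))) {z \<in> space P. S z \<in> B}"
      using B mS by (simp add: emeasure_distr vimage_def Int_def conj_commute)
    also have "\<dots> = emeasure P (Q j \<inter> {z \<in> space P. S z \<in> B})"
      using SB by (simp add: emeasure_density indicator_inter_arith[symmetric])
    also have "Q j \<inter> {z \<in> space P. S z \<in> B} = Q j \<inter> {z \<in> space P. T j z \<in> B}"
      using j by (auto simp: Q_def S_def)
    also have "emeasure P \<dots> = emeasure (density U (\<lambda>y. ennreal (h j y))) B"
      using T(2)[OF j B] B sU by (simp add: emeasure_density)
    finally show "emeasure (distr (density P (indicator (Q j))) sphere_borel S) B
        = emeasure (density U (\<lambda>y. ennreal (h j y))) B" .
  qed (simp add: sU)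
  have "distr P sphere_borel S = U"
  proof (rule measure_eqI)
    fix B assume "B \<in> sets (distr P sphere_borel S)"
    then have B: "B \<in> sets sphere_borel" by simp
    then have BU[measurable]: "B \<in> sets U" by (simp add: sU)
    have SB: "{z \<in> space P. S z \<in> B} \<in> sets P"
      using measurable_sets[OF mS B] by (simp add: vimage_def Int_def conj_commute)
    have "emeasure (distr P sphere_borel S) B = emeasure P {z \<in> space P. S z \<in> B}"
      using B mS by (simp add: emeasure_distr vimage_def Int_def conj_commute)
    also have "{z \<in> space P. S z \<in> B} = (\<Union>j\<in>{..<J}. Q j \<inter> {z \<in> space P. T j z \<in> B})"
      using cellJ by (auto simp: Q_def S_def)
    also have "emeasure P \<dots> = (\<Sum>j<J. emeasure P (Q j \<inter> {z \<in> space P. T j z \<in> B}))"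
    proof (rule sum_emeasure[symmetric])
      show "(\<lambda>j. Q j \<inter> {z \<in> space P. T j z \<in> B}) ` {..<J} \<subseteq> sets P"
        using measurable_sets[OF T(1) B] by (auto simp: vimage_def Int_def conj_commute intro!: sets.Int)
      show "disjoint_family_on (\<lambda>j. Q j \<inter> {z \<in> space P. T j z \<in> B}) {..<J}"
        by (auto simp: disjoint_family_on_def Q_def)
    qed simp
    also have "\<dots> = (\<Sum>j<J. \<integral>\<^sup>+y. ennreal (h j y) * indicator B y \<partial>U)"
      using T(2) B by (intro sum.cong) auto
    also have "\<dots> = (\<integral>\<^sup>+y. (\<Sum>j<J. ennreal (h j y) * indicator B y) \<partial>U)"
      by (rule nn_integral_sum[symmetric]) measurable
    also have "\<dots> = (\<integral>\<^sup>+y. indicator B y \<partial>U)"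
    proof (rule nn_integral_cong_AE)
      show "AE y in U. (\<Sum>j<J. ennreal (h j y) * indicator B y) = indicator B y"
        using total AE_space
      proof eventually_elim
        case (elim y)
        then have "(\<Sum>j<J. ennreal (h j y)) = 1" using h0 by (simp add: sum_ennreal)
        then show ?case by (simp add: sum_distrib_right[symmetric])
      qed
    qed
    finally show "emeasure (distr P sphere_borel S) B = emeasure U B" by simp
  qed (simp add: sU)
  then have "S \<in> transport_maps P U"
    using mS by (simp add: transport_maps_def measurable_cong_sets[OF sP refl])
  then show ?thesis using eq unfolding Q_def by blast
qed

section \<open>Monotone pairs for the squared geodesic distance\<close>

lemma inner_sphere_bounds:
  fixes x y :: "'a :: real_inner"
  assumes "x \<in> sphere 0 1" "y \<in> sphere 0 1"
  shows "- 1 \<le> x \<bullet> y" "x \<bullet> y \<le> 1"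
  using Cauchy_Schwarz_ineq2[of x y] assms by auto

lemma sphere_inner_self: "x \<in> sphere 0 1 \<Longrightarrow> x \<bullet> x = (1 :: real)"
  by (simp add: dot_square_norm)

lemma inner_eq_1_sphere:
  fixes x y :: "'a :: real_inner"
  assumes "x \<in> sphere 0 1" "y \<in> sphere 0 1" "x \<bullet> y = 1"
  shows "x = y"
proof -
  have "(x - y) \<bullet> (x - y) = 0"
    using assms by (simp add: inner_diff inner_commute sphere_inner_self)
  then show ?thesis by simp
qed

lemma inner_eq_m1_sphere:
  fixes x y :: "'a :: real_inner"
  assumes "x \<in> sphere 0 1" "y \<in> sphere 0 1" "x \<bullet> y = - 1"
  shows "y = - x"
  using inner_eq_1_sphere[of x "- y"] assms by auto

lemma norm_tangential_part:
  fixes z x :: "'a :: real_inner"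
  assumes "z \<in> sphere 0 1" "x \<in> sphere 0 1"
  shows "norm (x - (z \<bullet> x) *\<^sub>R z) = sqrt (1 - (z \<bullet> x)\<^sup>2)"
proof -
  have "(x - (z \<bullet> x) *\<^sub>R z) \<bullet> (x - (z \<bullet> x) *\<^sub>R z) = 1 - (z \<bullet> x)\<^sup>2"
    using assms by (simp add: inner_diff sphere_inner_self inner_commute power2_eq_square algebra_simps)
  then show ?thesis by (simp add: norm_eq_sqrt_inner)
qed

text \<open>
  The angle addition formula and the Cauchy-Schwarz inequality for the components orthogonal to \<open>z\<close>.
\<close>

lemma arccos_inner_triangle:
  fixes x y z :: "'a :: real_inner"
  assumes "x \<in> sphere 0 1" "y \<in> sphere 0 1" "z \<in> sphere 0 1"
  shows "\<bar>arccos (z \<bullet> y) - arccos (z \<bullet> x)\<bar> \<le> arccos (x \<bullet> y)"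
proof -
  define p q where "p = z \<bullet> x" and "q = z \<bullet> y"
  have pq: "-1 \<le> p" "p \<le> 1" "-1 \<le> q" "q \<le> 1"
    using inner_sphere_bounds assms unfolding p_def q_def by auto
  have "x \<bullet> y - p * q = (x - p *\<^sub>R z) \<bullet> (y - q *\<^sub>R z)"
    using assms by (simp add: inner_diff sphere_inner_self inner_commute p_def q_def algebra_simps)
  also have "\<dots> \<le> norm (x - p *\<^sub>R z) * norm (y - q *\<^sub>R z)" by (rule norm_cauchy_schwarz)
  also have "\<dots> = sqrt (1 - p\<^sup>2) * sqrt (1 - q\<^sup>2)"
    unfolding p_def q_def using assms by (simp add: norm_tangential_part)
  finally have "x \<bullet> y \<le> cos (arccos q - arccos p)"
    using pq by (simp add: cos_diff sin_arccos mult.commute)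
  then have "x \<bullet> y \<le> cos \<bar>arccos q - arccos p\<bar>" by simp
  moreover have r: "\<bar>arccos q - arccos p\<bar> \<le> pi"
    using pq arccos_lbound[of p] arccos_ubound[of p] arccos_lbound[of q] arccos_ubound[of q]
    by (auto simp: abs_le_iff)
  ultimately have "arccos (cos \<bar>arccos q - arccos p\<bar>) \<le> arccos (x \<bullet> y)"
    using inner_sphere_bounds[OF assms(1,2)] by (intro arccos_le_arccos) auto
  moreover have "arccos (cos \<bar>arccos q - arccos p\<bar>) = \<bar>arccos q - arccos p\<bar>"
    using r by (intro arccos_cos) auto
  ultimately show ?thesis unfolding p_def q_def by metis
qed

lemma cost_commute: "cost x y = cost y x"
  by (simp add: cost_def geodesic_dist_def inner_commute)

text \<open>
  Let \<open>\<theta>\<close> be the distance of \<open>z\<close> and \<open>z0\<close>, and \<open>a\<close> that of \<open>z0\<close> and \<open>y\<close>. Passing from \<open>z0\<close> to \<open>z\<close>, the cost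
  to the antipode changes by \<open>\<theta>\<^sup>2 / 2 - pi * \<theta>\<close>, and the cost to \<open>y\<close> by at least \<open>\<theta>\<^sup>2 / 2 - a * \<theta>\<close>.
  Monotonicity then gives \<open>pi \<le> a\<close>. So a monotone map that sends one point to its antipode sends
  every point there.
\<close>

lemma monotone_antipode_constant:
  fixes z z0 y :: "real ^ 'd"
  assumes S: "z0 \<in> unit_sphere" "z \<in> unit_sphere" "y \<in> unit_sphere" and ne: "z \<noteq> z0"
    and mono: "cost z y + cost z0 (- z0) \<le> cost z (- z0) + cost z0 y"
  shows "y = - z0"
proof -
  define \<theta> a b where "\<theta> = arccos (z0 \<bullet> z)" and "a = arccos (z0 \<bullet> y)" and "b = arccos (z \<bullet> y)"
  note B = inner_sphere_bounds[OF S(1,2)] inner_sphere_bounds[OF S(1,3)]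
  have "z0 \<bullet> z \<noteq> 1" using inner_eq_1_sphere[OF S(1,2)] ne by auto
  then have th: "\<theta> > 0" using arccos_less_arccos[of "z0 \<bullet> z" 1] B by (simp add: \<theta>_def)
  have "\<bar>a - \<theta>\<bar> \<le> b" unfolding a_def b_def \<theta>_def by (rule arccos_inner_triangle[OF S(2,3,1)])
  then have "(a - \<theta>)\<^sup>2 \<le> b\<^sup>2" by (metis abs_ge_zero power2_abs power_mono)
  moreover have "b\<^sup>2 + pi\<^sup>2 \<le> (pi - \<theta>)\<^sup>2 + a\<^sup>2"
    using mono B S(1) unfolding cost_def geodesic_dist_def
    by (simp add: a_def b_def \<theta>_def arccos_minus inner_commute sphere_inner_self)
  ultimately have "pi * \<theta> \<le> a * \<theta>" by (simp add: power2_eq_square algebra_simps)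
  then have "pi \<le> a" using th by simp
  then have "a = pi" using arccos_ubound[of "z0 \<bullet> y"] B by (simp add: a_def)
  then have "z0 \<bullet> y = - 1" using B cos_arccos[of "z0 \<bullet> y"] by (simp add: a_def)
  then show ?thesis by (rule inner_eq_m1_sphere[OF S(1,3)])
qed

text \<open>
  The derivative of \<open>(arccos s)\<^sup>2 / 2\<close> is the negative reciprocal of this function at \<open>arccos s\<close>; in
  this form it is continuous up to \<open>s = 1\<close>, where the two points of the sphere coincide.
\<close>

definition sin_quotient :: "real \<Rightarrow> real"
  where "sin_quotient x = (if x = 0 then 1 else sin x / x)"

lemma isCont_sin_quotient: "isCont sin_quotient x"
  using isCont_sinc[of x] by (simp add: sin_quotient_def[abs_def])

lemma half_arccos_squared_mvt:
  assumes "-1 \<le> a" "a \<le> 1" "-1 \<le> b" "b \<le> (1::real)"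
  shows "\<exists>\<xi>. \<xi> \<in> {-1..1} \<and> \<bar>\<xi> - a\<bar> \<le> \<bar>b - a\<bar> \<and>
    1/2 * (arccos a)\<^sup>2 - 1/2 * (arccos b)\<^sup>2 = (b - a) / sin_quotient (arccos \<xi>)"
proof -
  define h where "h s = 1/2 * (arccos s)\<^sup>2" for s
  have main: "\<exists>\<xi>. p < \<xi> \<and> \<xi> < q \<and> h p - h q = (q - p) / sin_quotient (arccos \<xi>)"
    if "-1 \<le> p" "p < q" "q \<le> 1" for p q
  proof -
    have cont: "continuous_on {p..q} h"
      unfolding h_def using that
      by (intro continuous_intros continuous_on_subset[OF continuous_on_arccos']) auto
    have der: "(h has_real_derivative - (1 / sin_quotient (arccos \<xi>))) (at \<xi>)" if x: "p < \<xi>" "\<xi> < q" for \<xi>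
    proof -
      have x1: "-1 < \<xi>" "\<xi> < 1" using x \<open>-1 \<le> p\<close> \<open>q \<le> 1\<close> by auto
      then have "0 < arccos \<xi>" using arccos_less_arccos[of \<xi> 1] by simp
      then have s: "1 / sin_quotient (arccos \<xi>) = arccos \<xi> / sqrt (1 - \<xi>\<^sup>2)"
        using x1 by (simp add: sin_quotient_def sin_arccos)
      have "((\<lambda>s. arccos s * arccos s) has_real_derivative
          inverse (- sqrt (1 - \<xi>\<^sup>2)) * arccos \<xi> + inverse (- sqrt (1 - \<xi>\<^sup>2)) * arccos \<xi>) (at \<xi>)"
        by (intro DERIV_mult DERIV_arccos x1)
      then have "((\<lambda>s. 1/2 * (arccos s * arccos s)) has_real_derivative
          1/2 * (inverse (- sqrt (1 - \<xi>\<^sup>2)) * arccos \<xi> + inverse (- sqrt (1 - \<xi>\<^sup>2)) * arccos \<xi>)) (at \<xi>)"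
        by (rule DERIV_cmult)
      moreover have "h = (\<lambda>s. 1/2 * (arccos s * arccos s))"
        by (simp add: h_def fun_eq_iff power2_eq_square)
      moreover have "1/2 * (inverse (- sqrt (1 - \<xi>\<^sup>2)) * arccos \<xi> + inverse (- sqrt (1 - \<xi>\<^sup>2)) * arccos \<xi>)
          = - (1 / sin_quotient (arccos \<xi>))"
        unfolding s inverse_minus_eq divide_inverse[of "arccos \<xi>"] by simp
      ultimately show ?thesis by (simp only:)
    qed
    have "\<exists>l \<xi>. p < \<xi> \<and> \<xi> < q \<and> (h has_real_derivative l) (at \<xi>) \<and> h q - h p = (q - p) * l"
    proof (rule MVT[OF that(2) cont])
      show "h differentiable at \<xi>" if "p < \<xi>" "\<xi> < q" for \<xi>
        unfolding real_differentiable_def by (rule exI, rule der[OF that])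
    qed
    then obtain l \<xi> where x: "p < \<xi>" "\<xi> < q" "(h has_real_derivative l) (at \<xi>)" "h q - h p = (q - p) * l"
      by blast
    have "l = - (1 / sin_quotient (arccos \<xi>))" using DERIV_unique[OF x(3) der[OF x(1,2)]] .
    then have "h p - h q = (q - p) / sin_quotient (arccos \<xi>)" using x(4) by simp
    then show ?thesis using x(1,2) by blast
  qed
  consider "a = b" | "a < b" | "b < a" by linarith
  then show ?thesis
  proof cases
    case 1
    then show ?thesis using assms by (intro exI[of _ a]) auto
  next
    case 2
    with main[of a b] assms obtain \<xi> where "a < \<xi>" "\<xi> < b" "h a - h b = (b - a) / sin_quotient (arccos \<xi>)" by auto
    then show ?thesis using assms by (intro exI[of _ \<xi>]) (auto simp: h_def)
  next
    case 3
    with main[of b a] assms obtain \<xi> where "b < \<xi>" "\<xi> < a" "h b - h a = (a - b) / sin_quotient (arccos \<xi>)" by auto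
    moreover have "(b - a) / sin_quotient (arccos \<xi>) = - ((a - b) / sin_quotient (arccos \<xi>))"
      unfolding minus_divide_left by simp
    ultimately show ?thesis using assms unfolding h_def by (intro exI[of _ \<xi>]) auto
  qed
qed

abbreviation geodesic :: "real ^ 'd \<Rightarrow> real ^ 'd \<Rightarrow> real \<Rightarrow> real ^ 'd"
  where "geodesic z w t \<equiv> cos t *\<^sub>R z + sin t *\<^sub>R w"

lemma geodesic_on_sphere:
  assumes "z \<in> unit_sphere" "w \<in> unit_sphere" "z \<bullet> w = 0"
  shows "geodesic z w t \<in> unit_sphere"
proof -
  have "geodesic z w t \<bullet> geodesic z w t = (cos t)\<^sup>2 + (sin t)\<^sup>2"
    using assms
    by (simp add: inner_add_left inner_add_right sphere_inner_self inner_commute power2_eq_square)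
  then show ?thesis by (simp add: norm_eq_sqrt_inner)
qed

text \<open>
  The target may move with \<open>t\<close>: the mean value theorem moves the dependence on \<open>t\<close> into an
  intermediate point, which converges because \<open>y t\<close> does. Only the antipode of \<open>z\<close>, where the
  derivative blows up, is excluded as a limit.
\<close>

lemma cost_first_variation:
  fixes z w y1 :: "real ^ 'd" and y :: "real \<Rightarrow> real ^ 'd"
  assumes S: "z \<in> unit_sphere" "w \<in> unit_sphere" "y1 \<in> unit_sphere"
    and orth: "z \<bullet> w = 0" and y: "\<And>t. y t \<in> unit_sphere"
    and lim: "(y \<longlongrightarrow> y1) (at_right 0)" and na: "y1 \<noteq> - z"
  shows "((\<lambda>t. (cost z (y t) - cost (geodesic z w t) (y t)) / t) \<longlongrightarrow>
    (w \<bullet> y1) / sin_quotient (arccos (z \<bullet> y1))) (at_right 0)"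
proof -
  let ?F = "at_right (0::real)"
  have "\<exists>\<xi>. \<xi> \<in> {-1..1} \<and> \<bar>\<xi> - z \<bullet> y t\<bar> \<le> \<bar>geodesic z w t \<bullet> y t - z \<bullet> y t\<bar> \<and>
      cost z (y t) - cost (geodesic z w t) (y t)
        = (geodesic z w t \<bullet> y t - z \<bullet> y t) / sin_quotient (arccos \<xi>)" for t
    unfolding cost_def geodesic_dist_def
    by (rule half_arccos_squared_mvt)
      (use inner_sphere_bounds[OF S(1) y] inner_sphere_bounds[OF geodesic_on_sphere[OF S(1,2) orth] y]
        in auto)
  then obtain \<xi> where \<xi>: "\<And>t. \<xi> t \<in> {-1..1}"
    "\<And>t. \<bar>\<xi> t - z \<bullet> y t\<bar> \<le> \<bar>geodesic z w t \<bullet> y t - z \<bullet> y t\<bar>"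
    "\<And>t. cost z (y t) - cost (geodesic z w t) (y t)
        = (geodesic z w t \<bullet> y t - z \<bullet> y t) / sin_quotient (arccos (\<xi> t))"
    by metis
  have zy: "((\<lambda>t. z \<bullet> y t) \<longlongrightarrow> z \<bullet> y1) ?F" and wy: "((\<lambda>t. w \<bullet> y t) \<longlongrightarrow> w \<bullet> y1) ?F"
    by (rule tendsto_inner[OF tendsto_const lim])+
  have "((\<lambda>t. geodesic z w t \<bullet> y t - z \<bullet> y t) \<longlongrightarrow> geodesic z w 0 \<bullet> y1 - z \<bullet> y1) ?F"
    by (intro tendsto_intros) (rule lim)+
  then have "((\<lambda>t. geodesic z w t \<bullet> y t - z \<bullet> y t) \<longlongrightarrow> 0) ?F" by simp
  then have "((\<lambda>t. \<xi> t - z \<bullet> y t) \<longlongrightarrow> 0) ?F"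
    by (rule Lim_null_comparison[rotated, OF tendsto_rabs_zero]) (use \<xi>(2) in auto)
  from tendsto_add[OF this zy] have x: "(\<xi> \<longlongrightarrow> z \<bullet> y1) ?F" by simp
  have zy1: "z \<bullet> y1 \<in> {-1..1}" using inner_sphere_bounds[OF S(1,3)] by auto
  have "z \<bullet> y1 \<noteq> -1" using inner_eq_m1_sphere[OF S(1,3)] na by auto
  then have al: "arccos (z \<bullet> y1) < pi" "0 \<le> arccos (z \<bullet> y1)"
    using arccos_less_arccos[of "-1" "z \<bullet> y1"] zy1 by (auto intro: arccos_lbound)
  have nz: "sin_quotient (arccos (z \<bullet> y1)) \<noteq> 0"
    using al sin_gt_zero[of "arccos (z \<bullet> y1)"] by (auto simp: sin_quotient_def)
  have "((\<lambda>t. arccos (\<xi> t)) \<longlongrightarrow> arccos (z \<bullet> y1)) ?F"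
    by (rule continuous_on_tendsto_compose[OF continuous_on_arccos' x zy1]) (use \<xi>(1) in auto)
  then have sn: "((\<lambda>t. sin_quotient (arccos (\<xi> t))) \<longlongrightarrow> sin_quotient (arccos (z \<bullet> y1))) ?F"
    by (rule isCont_tendsto_compose[OF isCont_sin_quotient])
  have "((\<lambda>t. (cos t - 1) / t * (z \<bullet> y t) + sin t / t * (w \<bullet> y t)) \<longlongrightarrow> 0 * (z \<bullet> y1) + 1 * (w \<bullet> y1)) ?F"
  proof (intro tendsto_add tendsto_mult zy wy)
    have "(cos has_real_derivative - sin 0) (at 0)" by (rule DERIV_cos)
    then show "((\<lambda>t::real. (cos t - 1) / t) \<longlongrightarrow> 0) ?F"
      unfolding has_field_derivative_iff by (auto intro: filterlim_at_split[THEN iffD1, THEN conjunct2])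
    have "(sin has_real_derivative cos 0) (at 0)" by (rule DERIV_sin)
    then show "((\<lambda>t::real. sin t / t) \<longlongrightarrow> 1) ?F"
      unfolding has_field_derivative_iff by (auto intro: filterlim_at_split[THEN iffD1, THEN conjunct2])
  qed
  then have "((\<lambda>t. ((cos t - 1) / t * (z \<bullet> y t) + sin t / t * (w \<bullet> y t)) / sin_quotient (arccos (\<xi> t)))
      \<longlongrightarrow> (0 * (z \<bullet> y1) + 1 * (w \<bullet> y1)) / sin_quotient (arccos (z \<bullet> y1))) ?F"
    by (rule tendsto_divide[OF _ sn nz])
  moreover have "((cos t - 1) / t * (z \<bullet> y t) + sin t / t * (w \<bullet> y t)) / sin_quotient (arccos (\<xi> t))
      = (cost z (y t) - cost (geodesic z w t) (y t)) / t" for t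
    unfolding \<xi>(3) by (simp add: inner_add_left field_simps add_divide_distrib diff_divide_distrib)
  ultimately show ?thesis by simp
qed

text \<open>
  Leaving \<open>z0\<close> along a geodesic with direction \<open>w\<close> and comparing first variations, monotonicity gives
  \<open>w \<bullet> v y0 \<le> w \<bullet> v y1\<close> for every tangent direction, where \<open>v y\<close> is the initial velocity of the unit-time
  geodesic from \<open>z0\<close> to \<open>y\<close> and \<open>y1 = F z0\<close> is the limit of the values of \<open>F\<close>. Hence the two velocities
  agree, and so do the endpoints. If \<open>y0\<close> is the antipode of \<open>z0\<close>, the cost to
  \<open>y0\<close> decreases at rate \<open>pi\<close> in every direction, which exceeds the length of \<open>v y1\<close>.
\<close>

lemma monotone_partner_unique:
  fixes z0 y0 :: "real ^ 'd" and F :: "real ^ 'd \<Rightarrow> real ^ 'd"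
  assumes dim: "CARD('d) \<ge> 2"
    and cont: "continuous_on unit_sphere F" and F: "\<And>z. z \<in> unit_sphere \<Longrightarrow> F z \<in> unit_sphere"
    and z0: "z0 \<in> unit_sphere" and y0: "y0 \<in> unit_sphere"
    and mono: "\<And>z. z \<in> unit_sphere \<Longrightarrow>
      cost z (F z) + cost z0 y0 \<le> cost z y0 + cost z0 (F z)"
    and na: "F z0 \<noteq> - z0"
  shows "y0 = F z0"
proof -
  define y1 where "y1 = F z0"
  have y1: "y1 \<in> unit_sphere" using F z0 by (simp add: y1_def)
  define v where "v y = (y - (z0 \<bullet> y) *\<^sub>R z0) /\<^sub>R sin_quotient (arccos (z0 \<bullet> y))" for y
  have nv: "norm (v y) = arccos (z0 \<bullet> y)" "sin_quotient (arccos (z0 \<bullet> y)) > 0" "arccos (z0 \<bullet> y) < pi"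
    if y: "y \<in> unit_sphere" "y \<noteq> - z0" for y
  proof -
    note B = inner_sphere_bounds[OF z0 y(1)]
    have "z0 \<bullet> y \<noteq> -1" using inner_eq_m1_sphere[OF z0 y(1)] y(2) by auto
    then show al: "arccos (z0 \<bullet> y) < pi"
      using arccos_less_arccos[of "-1" "z0 \<bullet> y"] B by auto
    have al0: "0 \<le> arccos (z0 \<bullet> y)" using B by (auto intro: arccos_lbound)
    show sp: "sin_quotient (arccos (z0 \<bullet> y)) > 0"
      using al al0 sin_gt_zero[of "arccos (z0 \<bullet> y)"] by (auto simp: sin_quotient_def)
    have "norm (v y) = sqrt (1 - (z0 \<bullet> y)\<^sup>2) / sin_quotient (arccos (z0 \<bullet> y))"
      using sp norm_tangential_part[OF z0 y(1)] by (simp add: v_def divide_inverse)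
    also have "sqrt (1 - (z0 \<bullet> y)\<^sup>2) = sin (arccos (z0 \<bullet> y))"
      using B by (simp add: sin_arccos)
    also have "\<dots> / sin_quotient (arccos (z0 \<bullet> y)) = arccos (z0 \<bullet> y)"
      using sp by (auto simp: sin_quotient_def divide_simps)
    finally show "norm (v y) = arccos (z0 \<bullet> y)" .
  qed
  have vw: "w \<bullet> v y = (w \<bullet> y) / sin_quotient (arccos (z0 \<bullet> y))" if "z0 \<bullet> w = 0" for w y
    using that by (simp add: v_def inner_diff inner_commute divide_inverse)
  have key: "l \<le> w \<bullet> v y1"
    if w: "w \<in> unit_sphere" "z0 \<bullet> w = 0"
      and l: "((\<lambda>t. (cost z0 y0 - cost (geodesic z0 w t) y0) / t) \<longlongrightarrow> l) (at_right 0)" for w l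
  proof -
    have gS: "geodesic z0 w t \<in> unit_sphere" for t by (rule geodesic_on_sphere[OF z0 w])
    have "((\<lambda>t. geodesic z0 w t) \<longlongrightarrow> geodesic z0 w 0) (at_right 0)" by (intro tendsto_intros)
    then have "((\<lambda>t. geodesic z0 w t) \<longlongrightarrow> z0) (at_right 0)" by simp
    then have "((\<lambda>t. F (geodesic z0 w t)) \<longlongrightarrow> y1) (at_right 0)"
      unfolding y1_def
      by (rule continuous_on_tendsto_compose[OF cont _ z0]) (use gS in auto)
    then have r: "((\<lambda>t. (cost z0 (F (geodesic z0 w t)) - cost (geodesic z0 w t) (F (geodesic z0 w t))) / t)
       \<longlongrightarrow> w \<bullet> v y1) (at_right 0)"
      unfolding vw[OF w(2)]
      by (intro cost_first_variation z0 w y1 F gS) (use na in \<open>auto simp: y1_def\<close>)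
    show "l \<le> w \<bullet> v y1"
    proof (rule tendsto_le[OF _ r l])
      show "\<forall>\<^sub>F t in at_right 0. (cost z0 y0 - cost (geodesic z0 w t) y0) / t
          \<le> (cost z0 (F (geodesic z0 w t)) - cost (geodesic z0 w t) (F (geodesic z0 w t))) / t"
        using eventually_at_right_less
      proof eventually_elim
        case (elim t)
        then show ?case using mono[OF gS[of t]] by (intro divide_right_mono) auto
      qed
    qed simp
  qed
  show ?thesis
  proof (cases "y0 = - z0")
    case True
    obtain w0 where w0: "w0 \<noteq> 0" "z0 \<bullet> w0 = 0"
      using orthogonal_to_vector_exists[of z0] dim by (auto simp: orthogonal_def)
    define w where "w = w0 /\<^sub>R norm w0"
    have w: "w \<in> unit_sphere" "z0 \<bullet> w = 0" using w0 by (auto simp: w_def)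
    have e: "cost z0 y0 - cost (geodesic z0 w t) y0 = pi * t - t\<^sup>2 / 2" if "0 < t" "t < pi" for t
    proof -
      have "geodesic z0 w t \<bullet> y0 = - cos t"
        using w z0 by (simp add: True inner_add_left inner_add_right sphere_inner_self inner_commute)
      then have "geodesic_dist (geodesic z0 w t) y0 = pi - t"
        using that by (simp add: geodesic_dist_def arccos_minus arccos_cos)
      moreover have "geodesic_dist z0 y0 = pi"
        using z0 by (simp add: True geodesic_dist_def sphere_inner_self)
      ultimately show ?thesis
        unfolding cost_def by (simp only: power2_eq_square) (simp add: field_simps)
    qed
    have "((\<lambda>t::real. pi - t / 2) \<longlongrightarrow> pi - 0 / 2) (at_right 0)" by (intro tendsto_intros) auto
    moreover have "\<forall>\<^sub>F t in at_right 0. pi - t / 2 = (cost z0 y0 - cost (geodesic z0 w t) y0) / t"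
      using eventually_at_right_real[OF pi_gt_zero]
      by eventually_elim (use e in \<open>simp add: power2_eq_square diff_divide_distrib\<close>)
    ultimately have "((\<lambda>t. (cost z0 y0 - cost (geodesic z0 w t) y0) / t) \<longlongrightarrow> pi - 0 / 2) (at_right 0)"
      by (rule Lim_transform_eventually)
    then have "((\<lambda>t. (cost z0 y0 - cost (geodesic z0 w t) y0) / t) \<longlongrightarrow> pi) (at_right 0)" by simp
    then have "pi \<le> w \<bullet> v y1" using key[OF w] by blast
    also have "\<dots> \<le> norm w * norm (v y1)" by (rule norm_cauchy_schwarz)
    also have "\<dots> < pi" using w nv(1,3)[OF y1] na by (simp add: y1_def)
    finally show ?thesis by simp
  next
    case False
    have "v y0 = v y1"
    proof (rule ccontr)
      assume ne: "v y0 \<noteq> v y1"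
      define w where "w = (v y0 - v y1) /\<^sub>R norm (v y0 - v y1)"
      have "z0 \<bullet> v y = 0" for y
        using z0 by (simp add: v_def inner_diff inner_commute sphere_inner_self)
      then have w: "w \<in> unit_sphere" "z0 \<bullet> w = 0" using ne by (auto simp: w_def inner_diff)
      have "((\<lambda>t. (cost z0 y0 - cost (geodesic z0 w t) y0) / t) \<longlongrightarrow> w \<bullet> v y0) (at_right 0)"
        unfolding vw[OF w(2)] by (intro cost_first_variation z0 w y0 False) auto
      then have "w \<bullet> v y0 \<le> w \<bullet> v y1" using key[OF w] by blast
      then have "w \<bullet> (v y0 - v y1) \<le> 0" by (simp add: inner_diff)
      moreover have "w \<bullet> (v y0 - v y1) = norm (v y0 - v y1)"
        using ne by (simp add: w_def dot_square_norm power2_eq_square)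
      ultimately show False using ne by simp
    qed
    moreover have na': "y1 \<noteq> - z0" using na by (simp add: y1_def)
    ultimately have "arccos (z0 \<bullet> y0) = arccos (z0 \<bullet> y1)"
      using nv(1)[OF y0 False] nv(1)[OF y1 na'] by simp
    then have s: "z0 \<bullet> y0 = z0 \<bullet> y1"
      using cos_arccos inner_sphere_bounds[OF z0 y0] inner_sphere_bounds[OF z0 y1] by metis
    then show ?thesis using \<open>v y0 = v y1\<close> nv(2)[OF y1 na'] by (simp add: v_def y1_def)
  qed
qed

section \<open>Potentials on the sphere\<close>

lemma cost_bounds:
  fixes x y :: "real ^ 'd"
  assumes "x \<in> unit_sphere" "y \<in> unit_sphere"
  shows "0 \<le> cost x y" "cost x y \<le> pi\<^sup>2 / 2"
proof -
  note B = inner_sphere_bounds[OF assms]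
  show "0 \<le> cost x y" by (simp add: cost_def)
  have "(arccos (x \<bullet> y))\<^sup>2 \<le> pi\<^sup>2"
    using B by (intro power_mono arccos_ubound arccos_lbound)
  then show "cost x y \<le> pi\<^sup>2 / 2" by (simp add: cost_def geodesic_dist_def)
qed

lemma continuous_on_cost:
  fixes f g :: "'a :: topological_space \<Rightarrow> real ^ 'd"
  assumes "continuous_on A f" "continuous_on A g" "f ` A \<subseteq> unit_sphere" "g ` A \<subseteq> unit_sphere"
  shows "continuous_on A (\<lambda>a. cost (f a) (g a))"
  unfolding cost_def geodesic_dist_def
  by (intro continuous_intros continuous_on_arccos assms)
    (use inner_sphere_bounds assms(3,4) in blast)

lemma cost_uniformly_continuous:
  assumes "0 < e"
  obtains d where "0 < d"
    "\<And>x x' y y' :: real ^ 'd. \<lbrakk>x \<in> unit_sphere; x' \<in> unit_sphere; y \<in> unit_sphere; y' \<in> unit_sphere;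
      dist x x' < d; dist y y' < d\<rbrakk> \<Longrightarrow> \<bar>cost x y - cost x' y'\<bar> < e"
proof -
  let ?S = "unit_sphere \<times> unit_sphere :: ((real ^ 'd) \<times> (real ^ 'd)) set"
  have "continuous_on ?S (\<lambda>p. cost (fst p) (snd p))"
    by (intro continuous_on_cost continuous_intros) auto
  then have "uniformly_continuous_on ?S (\<lambda>p. cost (fst p) (snd p))"
    by (rule compact_uniformly_continuous) (intro compact_Times compact_sphere)
  then obtain d where d: "0 < d" "\<And>p p'. p \<in> ?S \<Longrightarrow> p' \<in> ?S \<Longrightarrow> dist p' p < d \<Longrightarrow>
      dist (cost (fst p') (snd p')) (cost (fst p) (snd p)) < e"
    using assms unfolding uniformly_continuous_on_def by metis
  show ?thesis
  proof (rule that[of "d / 2"])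
    fix x x' y y' :: "real ^ 'd"
    assume a: "x \<in> unit_sphere" "x' \<in> unit_sphere" "y \<in> unit_sphere" "y' \<in> unit_sphere"
      "dist x x' < d / 2" "dist y y' < d / 2"
    have "dist (x, y) (x', y') \<le> dist x x' + dist y y'"
      unfolding dist_Pair_Pair by (rule sqrt_sum_squares_le_sum) auto
    then have "dist (x, y) (x', y') < d" using a by simp
    then show "\<bar>cost x y - cost x' y'\<bar> < e"
      using d(2)[of "(x', y')" "(x, y)"] a by (simp add: dist_real_def)
  qed (use d in simp)
qed

text \<open>
  The cost transform of a weight on an indexed family of points. Indexing covers both uses: the
  finitely many (possibly coinciding) targets of an assignment and the sphere itself.
\<close>

definition cost_transform :: "'i set \<Rightarrow> ('i \<Rightarrow> real ^ 'd) \<Rightarrow> ('i \<Rightarrow> real) \<Rightarrow> real ^ 'd \<Rightarrow> real"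
  where "cost_transform I Y w z = (INF i\<in>I. cost z (Y i) - w i)"

lemma cost_transform_ge:
  assumes "I \<noteq> {}" "\<And>i. i \<in> I \<Longrightarrow> a \<le> cost z (Y i) - w i"
  shows "a \<le> cost_transform I Y w z"
  unfolding cost_transform_def by (rule cINF_greatest[OF assms])

context
  fixes I :: "'i set" and Y :: "'i \<Rightarrow> real ^ 'd" and w :: "'i \<Rightarrow> real" and K :: real
  assumes I: "I \<noteq> {}" and Y: "\<And>i. i \<in> I \<Longrightarrow> Y i \<in> unit_sphere" and w: "\<And>i. i \<in> I \<Longrightarrow> w i \<le> K"
begin

lemma cost_transform_le:
  assumes "z \<in> unit_sphere" "i \<in> I"
  shows "cost_transform I Y w z \<le> cost z (Y i) - w i"
  unfolding cost_transform_def
proof (rule cINF_lower[OF _ assms(2)])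
  show "bdd_below ((\<lambda>i. cost z (Y i) - w i) ` I)"
    using cost_bounds(1)[OF assms(1) Y] w by (intro bdd_belowI2[of _ "- K"]) (fastforce simp: algebra_simps)
qed

lemma cost_transform_modulus:
  assumes z: "z \<in> unit_sphere" "z' \<in> unit_sphere"
    and e: "\<And>y. y \<in> unit_sphere \<Longrightarrow> \<bar>cost z y - cost z' y\<bar> \<le> e"
  shows "\<bar>cost_transform I Y w z - cost_transform I Y w z'\<bar> \<le> e"
proof -
  have "cost_transform I Y w z - e \<le> cost_transform I Y w z'"
    using cost_transform_le[OF z(1)] e[OF Y] by (intro cost_transform_ge[OF I]) fastforce
  moreover have "cost_transform I Y w z' - e \<le> cost_transform I Y w z"
    using cost_transform_le[OF z(2)] e[OF Y] by (intro cost_transform_ge[OF I]) fastforce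
  ultimately show ?thesis by linarith
qed

end

text \<open>
  Every cost transform inherits the modulus of continuity of the cost, whatever the weights are. This
  is what makes the potentials of all sample sizes equicontinuous.
\<close>

definition cost_equicontinuous :: "(real ^ 'd \<Rightarrow> real) \<Rightarrow> bool"
  where "cost_equicontinuous u \<longleftrightarrow>
    (\<forall>z\<in>unit_sphere. \<forall>z'\<in>unit_sphere. \<forall>e.
      (\<forall>y\<in>unit_sphere. \<bar>cost z y - cost z' y\<bar> \<le> e) \<longrightarrow> \<bar>u z - u z'\<bar> \<le> e)"

text \<open>
  Two successive cost transforms extend the finite potentials to the sphere without changing the
  contact at the matched pairs. Potentials are determined up to a constant; subtracting \<open>u0 1\<close> makes
  \<open>u\<close> vanish at the first point, and the oscillation of the cost then bounds \<open>u\<close> and \<open>v\<close>.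
\<close>

lemma cost_potentials_on_sphere:
  fixes z y :: "nat \<Rightarrow> real ^ 'd"
  assumes n: "1 \<le> n"
    and z: "\<And>i. i \<in> {1..n} \<Longrightarrow> z i \<in> unit_sphere" and y: "\<And>i. i \<in> {1..n} \<Longrightarrow> y i \<in> unit_sphere"
    and opt: "\<And>p. p permutes {1..n} \<Longrightarrow> (\<Sum>i=1..n. cost (z i) (y i)) \<le> (\<Sum>i=1..n. cost (z i) (y (p i)))"
  obtains u v where "cost_equicontinuous u" "cost_equicontinuous v"
    "\<And>x. x \<in> unit_sphere \<Longrightarrow> \<bar>u x\<bar> \<le> pi\<^sup>2 / 2" "\<And>x. x \<in> unit_sphere \<Longrightarrow> \<bar>v x\<bar> \<le> pi\<^sup>2 / 2"
    "\<And>a b. a \<in> unit_sphere \<Longrightarrow> b \<in> unit_sphere \<Longrightarrow> u a + v b \<le> cost a b"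
    "\<And>i. i \<in> {1..n} \<Longrightarrow> u (z i) + v (y i) = cost (z i) (y i)"
proof -
  let ?I = "{1..n}"
  obtain u0 v0 where uv0: "\<And>i j. i \<in> ?I \<Longrightarrow> j \<in> ?I \<Longrightarrow> u0 i + v0 j \<le> cost (z i) (y j)"
    "\<And>i. i \<in> ?I \<Longrightarrow> u0 i + v0 i = cost (z i) (y i)"
    using optimal_assignment_potentials[of ?I "\<lambda>i j. cost (z i) (y j)"] opt by auto
  define w where "w i = v0 i + u0 1" for i
  define K where "K = Max (w ` ?I)"
  define u where "u = cost_transform ?I y w"
  define v where "v = cost_transform unit_sphere (\<lambda>x. x) u"
  have 1: "1 \<in> ?I" using n by simp
  have I: "?I \<noteq> {}" using n by auto
  have wK: "w i \<le> K" if "i \<in> ?I" for i using that by (simp add: K_def)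
  have uz: "u (z i) = u0 i - u0 1" if i: "i \<in> ?I" for i
  proof (rule antisym)
    show "u (z i) \<le> u0 i - u0 1"
      using cost_transform_le[where I = ?I and Y = y and w = w and K = K, OF I y wK z[OF i] i] uv0(2)[OF i] by (simp add: u_def w_def)
    show "u0 i - u0 1 \<le> u (z i)"
      unfolding u_def using uv0(1)[OF i]
      by (intro cost_transform_ge[OF I]) (fastforce simp: w_def algebra_simps)
  qed
  have eu: "cost_equicontinuous u"
    unfolding cost_equicontinuous_def u_def
    using cost_transform_modulus[where I = ?I and Y = y and w = w and K = K, OF I y wK] by blast
  have osc: "\<bar>cost a x - cost b x\<bar> \<le> pi\<^sup>2 / 2" if "a \<in> unit_sphere" "b \<in> unit_sphere" "x \<in> unit_sphere"
    for a b x :: "real ^ 'd"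
    using cost_bounds[OF that(1,3)] cost_bounds[OF that(2,3)] by linarith
  have ub: "\<bar>u x\<bar> \<le> pi\<^sup>2 / 2" if x: "x \<in> unit_sphere" for x
  proof -
    have "\<bar>u x - u (z 1)\<bar> \<le> pi\<^sup>2 / 2"
      using eu osc x z[OF 1] unfolding cost_equicontinuous_def by blast
    then show ?thesis using uz[OF 1] by simp
  qed
  have uK: "u x \<le> pi\<^sup>2 / 2" if "x \<in> unit_sphere" for x using ub[OF that] by simp
  have S: "unit_sphere \<noteq> ({} :: (real ^ 'd) set)" using z[OF 1] by blast
  have ev: "cost_equicontinuous v"
    unfolding cost_equicontinuous_def v_def
    using cost_transform_modulus[where I = unit_sphere and Y = "\<lambda>x. x" and w = u and K = "pi\<^sup>2 / 2", OF S _ uK] by blast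
  have uv: "u a + v b \<le> cost a b" if "a \<in> unit_sphere" "b \<in> unit_sphere" for a b
    using cost_transform_le[where I = unit_sphere and Y = "\<lambda>x. x" and w = u and K = "pi\<^sup>2 / 2", OF S _ uK that(2,1)] by (simp add: v_def cost_commute)
  have vb: "\<bar>v x\<bar> \<le> pi\<^sup>2 / 2" if x: "x \<in> unit_sphere" for x
  proof -
    have "v x \<le> pi\<^sup>2 / 2" using uv[OF z[OF 1] x] uz[OF 1] cost_bounds(2)[OF z[OF 1] x] by simp
    moreover have "- (pi\<^sup>2 / 2) \<le> v x"
      unfolding v_def using uK cost_bounds(1)[OF x] by (intro cost_transform_ge[OF S]) (fastforce+)
    ultimately show ?thesis by simp
  qed
  have "u (z i) + v (y i) = cost (z i) (y i)" if i: "i \<in> ?I" for i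
  proof (rule antisym)
    show "u (z i) + v (y i) \<le> cost (z i) (y i)" by (rule uv[OF z[OF i] y[OF i]])
    have "w i \<le> v (y i)"
      unfolding v_def
    proof (rule cost_transform_ge[OF S])
      fix x :: "real ^ 'd" assume "x \<in> unit_sphere"
      then show "w i \<le> cost (y i) x - u x"
        using cost_transform_le[where I = ?I and Y = y and w = w and K = K, OF I y wK _ i] by (fastforce simp: u_def cost_commute)
    qed
    then show "cost (z i) (y i) \<le> u (z i) + v (y i)"
      using uv0(2)[OF i] uz[OF i] by (simp add: w_def)
  qed
  then show ?thesis using that eu ev ub vb uv by blast
qed

section \<open>Surface measure\<close>

lemma space_sphere_borel [simp]: "space sphere_borel = unit_sphere"
  by (simp add: sphere_borel_def space_restrict_space)

lemma sets_surface_measure [simp]: "sets surface_measure = sets sphere_borel"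
  by (simp add: surface_measure_def)

lemma space_surface_measure [simp]: "space surface_measure = unit_sphere"
  using sets_eq_imp_space_eq[OF sets_surface_measure] by simp

lemma sets_uniform_sphere [simp]: "sets uniform_sphere = sets sphere_borel"
  by (simp add: uniform_sphere_def)

lemma space_uniform_sphere [simp]: "space uniform_sphere = unit_sphere"
  by (simp add: uniform_sphere_def)

lemma borel_measurable_sphereI:
  fixes f :: "real ^ 'd \<Rightarrow> 'b :: topological_space"
  assumes "continuous_on unit_sphere f" "sets M = sets sphere_borel"
  shows "f \<in> borel_measurable M"
  unfolding measurable_cong_sets[OF assms(2) refl] sphere_borel_def
  by (rule borel_measurable_continuous_on_restrict[OF assms(1)])

lemma surface_measure_cap_pos:
  fixes x :: "real ^ 'd"
  assumes x: "x \<in> unit_sphere" and e: "0 < e"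
  shows "0 < emeasure surface_measure (unit_sphere \<inter> ball x e)"
proof -
  let ?C = "{r *\<^sub>R y | r y. 0 < r \<and> r < 1 \<and> y \<in> unit_sphere \<inter> ball x e}"
  have "?C = (ball 0 1 - {0}) \<inter> (\<lambda>v. v /\<^sub>R norm v) -` ball x e" (is "_ = ?R")
  proof (intro set_eqI iffI)
    fix v assume "v \<in> ?R"
    then have "v = norm v *\<^sub>R (v /\<^sub>R norm v)" "0 < norm v" "norm v < 1"
      "v /\<^sub>R norm v \<in> unit_sphere \<inter> ball x e" by auto
    then show "v \<in> ?C" by blast
  qed auto
  moreover have "open ?R"
    by (intro continuous_open_preimage continuous_intros) auto
  ultimately have "open ?C" by simp
  moreover have "(1/2) *\<^sub>R x \<in> ?C" using x e by (intro CollectI exI[of _ "1/2"] exI[of _ x]) auto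
  ultimately have nn: "\<not> negligible ?C" by (intro open_not_negligible) auto
  have "emeasure lborel ?C \<noteq> 0"
  proof
    assume "emeasure lborel ?C = 0"
    then have "?C \<in> null_sets lborel" using \<open>open ?C\<close> by auto
    then have "?C \<in> null_sets lebesgue" by (rule null_sets_completionI)
    then show False using nn negligible_iff_null_sets by blast
  qed
  then show ?thesis
    by (subst emeasure_surface_measure) (auto simp: zero_less_iff_neq_zero)
qed

lemma emeasure_surface_sphere_finite:
  "emeasure surface_measure (unit_sphere :: (real ^ 'd) set) < \<infinity>"
proof -
  let ?C = "{r *\<^sub>R x | r x. 0 < r \<and> r < 1 \<and> x \<in> (unit_sphere :: (real ^ 'd) set)}"
  have "emeasure lborel ?C \<le> emeasure lborel (ball 0 1 :: (real ^ 'd) set)"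
    by (rule emeasure_mono) auto
  also have "\<dots> < \<infinity>" by (rule emeasure_lborel_ball_finite)
  finally show ?thesis
    by (subst emeasure_surface_measure) (auto simp: ennreal_mult_less_top of_nat_less_top)
qed

lemma prob_space_uniform_sphere: "prob_space (uniform_sphere :: (real ^ 'd) measure)"
proof -
  obtain x :: "real ^ 'd" where x: "x \<in> unit_sphere"
    using vector_choose_size[of 1] by auto
  have "0 < emeasure surface_measure (unit_sphere \<inter> ball x 1)"
    by (rule surface_measure_cap_pos[OF x]) simp
  also have "\<dots> \<le> emeasure surface_measure (unit_sphere :: (real ^ 'd) set)"
    by (rule emeasure_mono) (auto simp: sets_sphere_borel)
  finally show ?thesis
    unfolding uniform_sphere_def
    by (intro prob_space_uniform_measure) (use emeasure_surface_sphere_finite[where 'd = 'd] in auto)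
qed

lemma two_coordinates:
  assumes "CARD('d :: finite) \<ge> 2"
  shows "\<exists>i j :: 'd. i \<noteq> j"
  using assms by (metis UNIV_I card_2_iff' card_le_Suc0_iff_eq finite not_less_eq_eq numeral_2_eq_2)

text \<open>
  The cone over such a level set lies in the union of two hyperplanes. Hence a quotient of two
  coordinates is a variable without atoms, and single points are null sets.
\<close>

lemma surface_measure_ratio_level:
  fixes i j :: "'d :: finite"
  assumes "i \<noteq> j"
  shows "{x \<in> unit_sphere. x $ i / x $ j = t} \<in> null_sets surface_measure"
proof -
  let ?A = "{x \<in> unit_sphere. x $ i / x $ j = t} :: (real ^ 'd) set"
  have comp[measurable]: "(\<lambda>x::real^'d. x $ i) \<in> borel_measurable borel" for i
    by (intro borel_measurable_continuous_onI continuous_intros)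
  have A: "?A \<in> sets borel"
  proof -
    have "?A = unit_sphere \<inter> {x \<in> space borel. x $ i / x $ j = t}" by auto
    also have "\<dots> \<in> sets borel"
    proof (rule sets.Int)
      show "{x \<in> space borel. (x :: real ^ 'd) $ i / x $ j = t} \<in> sets borel" by measurable
    qed (simp add: borel_closed)
    finally show ?thesis .
  qed
  let ?C = "{r *\<^sub>R x | r x. 0 < r \<and> r < 1 \<and> x \<in> ?A}"
  let ?H = "{x. (axis i 1 - t *\<^sub>R axis j 1) \<bullet> x = 0} \<union> {x. axis j 1 \<bullet> x = 0} :: (real ^ 'd) set"
  have "negligible ?H"
  proof (intro negligible_Un negligible_hyperplane disjI1)
    have "(axis i 1 - t *\<^sub>R axis j 1 :: real ^ 'd) $ i = 1" using assms by (simp add: axis_def)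
    then show "(axis i 1 - t *\<^sub>R axis j 1 :: real ^ 'd) \<noteq> 0" by (metis zero_index zero_neq_one)
  qed simp
  moreover have "closed ?H" by (intro closed_Un closed_hyperplane)
  ultimately have H: "?H \<in> null_sets lborel"
    by (simp add: negligible_iff_null_sets null_sets_completion_iff)
  have "?C \<subseteq> ?H"
  proof
    fix v assume "v \<in> ?C"
    then obtain r x where v: "v = r *\<^sub>R x" "x \<in> ?A" by blast
    then show "v \<in> ?H"
      by (cases "x $ j = 0") (auto simp: inner_diff_left inner_axis' divide_simps algebra_simps)
  qed
  then have "emeasure lborel ?C \<le> emeasure lborel ?H"
    using H by (intro emeasure_mono) auto
  then have "emeasure lborel ?C = 0" using H by (simp add: null_setsD1)
  then have "emeasure surface_measure ?A = 0"
    by (subst emeasure_surface_measure[OF A]) auto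
  then show ?thesis using A by (intro null_setsI) (auto simp: sets_sphere_borel)
qed

lemma surface_null_imp_uniform_null:
  assumes "A \<in> null_sets surface_measure"
  shows "A \<in> null_sets uniform_sphere"
proof (rule null_setsI)
  have A: "A \<in> sets sphere_borel" using assms by auto
  have "emeasure surface_measure (unit_sphere \<inter> A) \<le> emeasure surface_measure A"
    using assms by (intro emeasure_mono) auto
  then have "emeasure surface_measure (unit_sphere \<inter> A) = 0" using assms by (auto dest: null_setsD1)
  then show "emeasure uniform_sphere A = 0"
    using A unfolding uniform_sphere_def by (subst emeasure_uniform_measure) (simp_all add: sets_sphere_borel)
qed (use assms in auto)

lemma bounded_density_lawsD:
  fixes P :: "(real ^ 'd) measure"
  assumes "P \<in> bounded_density_laws"
  shows "prob_space P" "sets P = sets sphere_borel" "space P = unit_sphere"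
    and "A \<in> null_sets surface_measure \<Longrightarrow> A \<in> null_sets P"
    and "x \<in> unit_sphere \<Longrightarrow> 0 < e \<Longrightarrow> 0 < measure P (unit_sphere \<inter> ball x e)"
proof -
  obtain f a b where f: "f \<in> borel_measurable surface_measure" and ab: "0 < a"
    "\<And>x. x \<in> unit_sphere \<Longrightarrow> a \<le> f x \<and> f x \<le> b"
    and P: "P = density surface_measure (\<lambda>x. ennreal (f x))"
    using assms unfolding bounded_density_laws_def by blast
  show 1: "prob_space P" using assms by (simp add: bounded_density_laws_def)
  show sP: "sets P = sets sphere_borel" unfolding P by simp
  show "space P = unit_sphere" unfolding P by simp
  show "A \<in> null_sets P" if "A \<in> null_sets surface_measure"
    using absolutely_continuousI_density[of "\<lambda>x. ennreal (f x)" surface_measure] f that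
    unfolding P absolutely_continuous_def by auto
  show "0 < measure P (unit_sphere \<inter> ball x e)" if x: "x \<in> unit_sphere" "0 < e"
  proof -
    interpret prob_space P by fact
    let ?A = "unit_sphere \<inter> ball x e"
    have A: "?A \<in> sets surface_measure" by (auto simp: sets_sphere_borel)
    have "0 < ennreal a * emeasure surface_measure ?A"
      using ab surface_measure_cap_pos[OF x] by (simp add: ennreal_zero_less_mult_iff)
    also have "\<dots> = (\<integral>\<^sup>+y. ennreal a * indicator ?A y \<partial>surface_measure)"
      using A by (simp add: nn_integral_cmult_indicator)
    also have "\<dots> \<le> (\<integral>\<^sup>+y. ennreal (f y) * indicator ?A y \<partial>surface_measure)"
      using ab by (intro nn_integral_mono) (auto split: split_indicator intro: ennreal_leI)
    also have "\<dots> = emeasure P ?A"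
      unfolding P using f A by (simp add: emeasure_density)
    finally show ?thesis by (simp add: emeasure_eq_measure)
  qed
qed

section \<open>Frequencies in a triangular array\<close>

text \<open>
  Different rows may depend on each other in any way, so the strong law for a single sequence does not
  apply. Hoeffding's inequality gives summable tails row by row, and the Borel-Cantelli lemma
  turns them into almost sure convergence.
\<close>

lemma (in prob_space) rowwise_iid_frequency_limit:
  fixes X :: "nat \<Rightarrow> nat \<Rightarrow> 'a \<Rightarrow> 'b"
  assumes indep: "\<And>n. indep_vars (\<lambda>_. S) (X n) {1..n}"
    and ident: "\<And>n i. i \<in> {1..n} \<Longrightarrow> distr M S (X n i) = P"
    and Q: "Q \<in> sets S"
  shows "AE \<omega> in M. (\<lambda>n. (\<Sum>i=1..n. indicat_real Q (X n i \<omega>)) / n) \<longlonglongrightarrow> measure P Q"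
proof -
  define A where "A n \<omega> = (\<Sum>i=1..n. indicat_real Q (X n i \<omega>)) / n" for n \<omega>
  have mX: "X n i \<in> measurable M S" if "i \<in> {1..n}" for n i
    using indep[of n] that unfolding indep_vars_def by auto
  have mI: "(\<lambda>\<omega>. indicat_real Q (X n i \<omega>)) \<in> borel_measurable M" if "i \<in> {1..n}" for n i
    by (rule measurable_compose[OF mX[OF that] borel_measurable_indicator[OF Q]])
  have mA[measurable]: "A n \<in> borel_measurable M" for n
    unfolding A_def[abs_def] by (intro borel_measurable_divide borel_measurable_sum mI) auto
  have tail: "prob {\<omega> \<in> space M. e \<le> \<bar>A n \<omega> - measure P Q\<bar>} \<le> 2 * exp (- 2 * e\<^sup>2) ^ n"
    if e: "0 < e" for n e
  proof (cases "n = 0")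
    case True
    have "prob {\<omega> \<in> space M. e \<le> \<bar>A n \<omega> - measure P Q\<bar>} \<le> 1" by (rule prob_le_1)
    also have "1 \<le> 2 * exp (- 2 * e\<^sup>2) ^ n" using True by simp
    finally show ?thesis .
  next
    case False
    let ?Y = "\<lambda>\<omega>. indicat_real Q (X n 1 \<omega>)"
    have 1: "1 \<in> {1..n}" using False by auto
    have dI: "distr M borel (\<lambda>\<omega>. indicat_real Q (X n i \<omega>)) = distr P borel (indicat_real Q)"
      if i: "i \<in> {1..n}" for i
    proof -
      have "distr (distr M S (X n i)) borel (indicat_real Q) = distr M borel (indicat_real Q \<circ> X n i)"
        using mX[OF i] Q by (intro distr_distr) auto
      then show ?thesis unfolding ident[OF i] by (simp add: comp_def)
    qed
    interpret H: Hoeffding_ineq_iid M "{1..n}" "\<lambda>i \<omega>. indicat_real Q (X n i \<omega>)" ?Y 0 1 "expectation ?Y"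
    proof unfold_locales
      show "indep_vars (\<lambda>_. borel) (\<lambda>i \<omega>. indicat_real Q (X n i \<omega>)) {1..n}"
        by (rule indep_vars_compose2[OF indep[of n]]) (use Q in auto)
      show "distr M borel (\<lambda>\<omega>. indicat_real Q (X n i \<omega>)) = distr M borel ?Y" if "i \<in> {1..n}" for i
        using dI[OF that] dI[OF 1] by simp
      show "?Y \<in> borel_measurable M" by (rule mI[OF 1])
    qed (auto simp: indicator_def)
    have "expectation ?Y = measure M {\<omega> \<in> space M. X n 1 \<omega> \<in> Q}"
    proof -
      have "expectation ?Y = expectation (indicat_real {\<omega> \<in> space M. X n 1 \<omega> \<in> Q})"
        by (intro Bochner_Integration.integral_cong) (auto split: split_indicator)
      then show ?thesis by (simp add: Int_absorb2 Collect_restrict)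
    qed
    also have "\<dots> = measure (distr M S (X n 1)) Q"
      using mX[OF 1] Q by (simp add: measure_distr vimage_def Int_def conj_commute)
    finally have EY: "expectation ?Y = measure P Q" by (simp only: ident[OF 1])
    have "prob {\<omega> \<in> space M. e \<le> \<bar>(\<Sum>i=1..n. indicat_real Q (X n i \<omega>)) / real (card {1..n}) - expectation ?Y\<bar>}
        \<le> 2 * exp (- 2 * real (card {1..n}) * e\<^sup>2 / (1 - 0)\<^sup>2)"
      by (rule H.Hoeffding_ineq_abs_ge') (use e False in auto)
    then have "prob {\<omega> \<in> space M. e \<le> \<bar>A n \<omega> - measure P Q\<bar>} \<le> 2 * exp (- 2 * real n * e\<^sup>2)"
      unfolding EY A_def by simp
    also have "\<dots> = 2 * exp (- 2 * e\<^sup>2) ^ n"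
      by (simp add: exp_of_nat_mult[symmetric] algebra_simps)
    finally show ?thesis .
  qed
  have "AE \<omega> in M. eventually (\<lambda>n. \<bar>A n \<omega> - measure P Q\<bar> < e) sequentially" if e: "0 < e" for e
  proof -
    let ?B = "\<lambda>n. {\<omega> \<in> space M. e \<le> \<bar>A n \<omega> - measure P Q\<bar>}"
    have "AE \<omega> in M. eventually (\<lambda>n. \<omega> \<in> space M - ?B n) sequentially"
    proof (rule borel_cantelli_AE1)
      show "?B n \<in> sets M" for n by measurable
      show "emeasure M (?B n) < \<infinity>" for n by (simp add: less_top[symmetric])
      have "summable (\<lambda>n. 2 * exp (- 2 * e\<^sup>2) ^ n)"
        using e by (intro summable_mult summable_geometric) auto
      then show "summable (\<lambda>n. measure M (?B n))"
        by (rule summable_comparison_test[rotated]) (use tail[OF e] in auto)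
    qed
    then show ?thesis
      by eventually_elim (auto elim: eventually_mono)
  qed
  then have "AE \<omega> in M. \<forall>m. eventually (\<lambda>n. \<bar>A n \<omega> - measure P Q\<bar> < 1 / real (Suc m)) sequentially"
    by (subst AE_all_countable) auto
  then show ?thesis
  proof eventually_elim
    case (elim \<omega>)
    have "(\<lambda>n. A n \<omega>) \<longlonglongrightarrow> measure P Q"
      unfolding tendsto_iff dist_real_def
    proof (intro allI impI)
      fix e :: real assume "0 < e"
      then obtain m where "1 / real (Suc m) < e" using reals_Archimedean[of e] by (auto simp: inverse_eq_divide)
      then show "eventually (\<lambda>n. \<bar>A n \<omega> - measure P Q\<bar> < e) sequentially"
        using elim[rule_format, of m] by (auto elim: eventually_mono)
    qed
    then show ?case by (simp add: A_def)
  qed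
qed

section \<open>Averages and fine partitions\<close>

definition row_average :: "(nat \<Rightarrow> nat \<Rightarrow> 'a) \<Rightarrow> ('a \<Rightarrow> real) \<Rightarrow> nat \<Rightarrow> real"
  where "row_average X f n = (\<Sum>i=1..n. f (X n i)) / n"

lemma row_average_mono:
  "(\<And>i. i \<in> {1..n} \<Longrightarrow> f (X n i) \<le> g (X n i)) \<Longrightarrow> row_average X f n \<le> row_average X g n"
  unfolding row_average_def by (intro divide_right_mono sum_mono) auto

lemma row_average_const: "1 \<le> n \<Longrightarrow> row_average X (\<lambda>_. c) n = c"
  by (simp add: row_average_def)

lemma row_average_diff: "row_average X (\<lambda>x. f x - g x) n = row_average X f n - row_average X g n"
  by (simp add: row_average_def sum_subtractf diff_divide_distrib)

lemma row_average_sum: "row_average X (\<lambda>x. \<Sum>j\<in>J. f j x) n = (\<Sum>j\<in>J. row_average X (f j) n)"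
  unfolding row_average_def by (subst sum.swap) (simp add: sum_divide_distrib)

lemma row_average_mult_right: "row_average X (\<lambda>x. f x * c) n = row_average X f n * c"
  by (simp add: row_average_def sum_distrib_right)

lemma row_average_abs_le:
  assumes "1 \<le> n" "\<And>i. i \<in> {1..n} \<Longrightarrow> \<bar>f (X n i)\<bar> \<le> K"
  shows "\<bar>row_average X f n\<bar> \<le> K"
proof (rule abs_leI)
  have b: "f (X n i) \<le> K \<and> - K \<le> f (X n i)" if "i \<in> {1..n}" for i
    using assms(2)[OF that] by auto
  show "row_average X f n \<le> K"
    using row_average_mono[of n f X "\<lambda>_. K"] row_average_const[OF assms(1), of X K] b by auto
  show "- row_average X f n \<le> K"
    using row_average_mono[of n "\<lambda>_. - K" X f] row_average_const[OF assms(1), of X "- K"] b by auto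
qed

text \<open>
  Measurable cells and continuous partitions of unity are treated alike. Cells are used for the sample,
  where frequencies of arbitrary Borel sets converge; continuous functions are used for the grid,
  where only weak convergence is given.
\<close>

definition fine_partition ::
    "nat \<Rightarrow> (nat \<Rightarrow> real ^ 'd \<Rightarrow> real) \<Rightarrow> (nat \<Rightarrow> real ^ 'd) \<Rightarrow> real \<Rightarrow> bool"
  where "fine_partition J \<phi> x d \<longleftrightarrow> (\<forall>j<J. x j \<in> unit_sphere) \<and>
    (\<forall>j<J. \<forall>z\<in>unit_sphere. 0 \<le> \<phi> j z) \<and>
    (\<forall>j<J. \<forall>z\<in>unit_sphere. \<phi> j z \<noteq> 0 \<longrightarrow> dist z (x j) < d) \<and>
    (\<forall>z\<in>unit_sphere. (\<Sum>j<J. \<phi> j z) = 1)"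

lemma fine_partition_approx:
  assumes p: "fine_partition J \<phi> x d" and z: "z \<in> unit_sphere"
    and f: "\<And>a b. a \<in> unit_sphere \<Longrightarrow> b \<in> unit_sphere \<Longrightarrow> dist a b < d \<Longrightarrow> \<bar>f a - f b\<bar> \<le> e"
  shows "\<bar>f z - (\<Sum>j<J. \<phi> j z * f (x j))\<bar> \<le> e"
proof -
  have "f z - (\<Sum>j<J. \<phi> j z * f (x j)) = (\<Sum>j<J. \<phi> j z) * f z - (\<Sum>j<J. \<phi> j z * f (x j))"
    using p z by (simp add: fine_partition_def)
  also have "\<dots> = (\<Sum>j<J. \<phi> j z * (f z - f (x j)))"
    by (simp add: sum_distrib_right sum_subtractf right_diff_distrib)
  also have "\<bar>\<dots>\<bar> \<le> (\<Sum>j<J. \<bar>\<phi> j z * (f z - f (x j))\<bar>)" by (rule sum_abs)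
  also have "\<dots> \<le> (\<Sum>j<J. \<phi> j z * e)"
  proof (rule sum_mono)
    fix j assume "j \<in> {..<J}"
    then show "\<bar>\<phi> j z * (f z - f (x j))\<bar> \<le> \<phi> j z * e"
      using p z f[of z "x j"] unfolding fine_partition_def abs_mult
      by (cases "\<phi> j z = 0") (auto intro!: mult_mono)
  qed
  also have "\<dots> = e" using p z by (simp add: sum_distrib_right[symmetric] fine_partition_def)
  finally show ?thesis .
qed

text \<open>
  Equicontinuity replaces \<open>f n\<close> and \<open>g\<close> by their values at the finitely many centres, up to \<open>e\<close> each,
  and there pointwise convergence suffices.
\<close>

lemma row_average_limit_near_integral:
  fixes X :: "nat \<Rightarrow> nat \<Rightarrow> real ^ 'd" and f :: "nat \<Rightarrow> real ^ 'd \<Rightarrow> real"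
  assumes p: "fine_partition J \<phi> x d"
    and F: "F \<noteq> bot" "eventually (\<lambda>n. 1 \<le> n) F"
    and X: "\<And>n i. i \<in> {1..n} \<Longrightarrow> X n i \<in> unit_sphere"
    and mu: "prob_space \<mu>" "space \<mu> = unit_sphere"
    and int: "integrable \<mu> g" "\<And>j. j < J \<Longrightarrow> integrable \<mu> (\<phi> j)"
    and avg: "\<And>j. j < J \<Longrightarrow> (row_average X (\<phi> j) \<longlongrightarrow> (LINT z|\<mu>. \<phi> j z)) F"
    and fg: "\<And>z. z \<in> unit_sphere \<Longrightarrow> ((\<lambda>n. f n z) \<longlongrightarrow> g z) F"
    and f: "\<And>n a b. 1 \<le> n \<Longrightarrow> a \<in> unit_sphere \<Longrightarrow> b \<in> unit_sphere \<Longrightarrow> dist a b < d \<Longrightarrow>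
        \<bar>f n a - f n b\<bar> \<le> e"
    and g: "\<And>a b. a \<in> unit_sphere \<Longrightarrow> b \<in> unit_sphere \<Longrightarrow> dist a b < d \<Longrightarrow> \<bar>g a - g b\<bar> \<le> e"
    and L: "((\<lambda>n. row_average X (f n) n) \<longlongrightarrow> L) F"
  shows "\<bar>L - (LINT z|\<mu>. g z)\<bar> \<le> 2 * e"
proof -
  interpret prob_space \<mu> by fact
  define s where "s = (\<Sum>j<J. (LINT z|\<mu>. \<phi> j z) * g (x j))"
  have "((\<lambda>n. row_average X (f n) n - (\<Sum>j<J. row_average X (\<phi> j) n * f n (x j))) \<longlongrightarrow> L - s) F"
    unfolding s_def using p
    by (intro tendsto_diff tendsto_sum tendsto_mult L avg fg) (auto simp: fine_partition_def)
  moreover have "eventually (\<lambda>n. \<bar>row_average X (f n) n - (\<Sum>j<J. row_average X (\<phi> j) n * f n (x j))\<bar> \<le> e) F"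
    using F(2)
  proof eventually_elim
    case (elim n)
    have "row_average X (f n) n - (\<Sum>j<J. row_average X (\<phi> j) n * f n (x j))
        = row_average X (\<lambda>z. f n z - (\<Sum>j<J. \<phi> j z * f n (x j))) n"
      by (simp add: row_average_diff row_average_sum row_average_mult_right)
    also have "\<bar>\<dots>\<bar> \<le> e"
      using elim by (intro row_average_abs_le fine_partition_approx[OF p X] f) auto
    finally show ?case .
  qed
  ultimately have 1: "\<bar>L - s\<bar> \<le> e"
    by (intro tendsto_upperbound[OF tendsto_rabs _ F(1)])
  have "(LINT z|\<mu>. g z) - s = (LINT z|\<mu>. g z - (\<Sum>j<J. \<phi> j z * g (x j)))"
    unfolding s_def using int by (subst Bochner_Integration.integral_diff) auto
  also have "\<bar>\<dots>\<bar> \<le> (LINT z|\<mu>. e)"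
  proof -
    have "\<bar>LINT z|\<mu>. g z - (\<Sum>j<J. \<phi> j z * g (x j))\<bar> \<le> (LINT z|\<mu>. \<bar>g z - (\<Sum>j<J. \<phi> j z * g (x j))\<bar>)"
      by (rule integral_abs_bound)
    also have "\<dots> \<le> (LINT z|\<mu>. e)"
      using int mu(2)
      by (intro integral_mono integrable_abs Bochner_Integration.integrable_diff
          Bochner_Integration.integrable_sum fine_partition_approx[OF p] g) auto
    finally show ?thesis .
  qed
  finally show ?thesis using 1 by (simp add: prob_space)
qed

lemma sphere_net:
  assumes "0 < d"
  shows "\<exists>(J :: nat) (x :: nat \<Rightarrow> real ^ 'd). (\<forall>j<J. x j \<in> unit_sphere) \<and>
    (\<forall>z \<in> unit_sphere. \<exists>j<J. dist z (x j) < d)"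
proof -
  have "\<exists>T. finite T \<and> T \<subseteq> unit_sphere \<and> (unit_sphere :: (real ^ 'd) set) \<subseteq> (\<Union>t\<in>T. ball t d)"
    by (rule seq_compact_imp_totally_bounded[rule_format, OF compact_imp_seq_compact[OF compact_sphere] assms])
  then obtain T where T: "finite T" "T \<subseteq> unit_sphere" "(unit_sphere :: (real ^ 'd) set) \<subseteq> (\<Union>t\<in>T. ball t d)"
    by blast
  obtain x where x: "bij_betw x {0..<card T} T" using ex_bij_betw_nat_finite[OF T(1)] by blast
  have "x j \<in> unit_sphere" if "j < card T" for j
  proof -
    have "x j \<in> T" using that x by (auto simp: bij_betw_def)
    then show ?thesis using T(2) by blast
  qed
  moreover have "\<exists>j<card T. dist z (x j) < d" if "z \<in> unit_sphere" for z
  proof -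
    have "z \<in> (\<Union>t\<in>T. ball t d)" using that T(3) by blast
    then obtain t where t: "t \<in> T" "dist z t < d" by (auto simp: dist_commute)
    then have "t \<in> x ` {0..<card T}" using x by (simp add: bij_betw_def)
    then obtain j where "j < card T" "x j = t" by auto
    then show ?thesis using t by blast
  qed
  ultimately show ?thesis by blast
qed

lemma sphere_cells:
  assumes d: "0 < d"
  obtains J :: nat and cell :: "real ^ 'd \<Rightarrow> nat" and x :: "nat \<Rightarrow> real ^ 'd"
  where "cell \<in> measurable sphere_borel (count_space UNIV)"
    "\<And>z. z \<in> unit_sphere \<Longrightarrow> cell z < J"
    "fine_partition J (\<lambda>j z. indicat_real {z \<in> unit_sphere. cell z = j} z) x d"
proof -
  obtain J and x :: "nat \<Rightarrow> real ^ 'd" where "\<forall>j<J. x j \<in> unit_sphere"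
    "\<forall>z \<in> unit_sphere. \<exists>j<J. dist z (x j) < d"
    using sphere_net[OF d] by blast
  note x = this(1)[rule_format] this(2)[rule_format]
  define cell where "cell z = (LEAST j. dist z (x j) < d)" for z
  have close: "dist z (x (cell z)) < d" and less: "cell z < J" if z: "z \<in> unit_sphere" for z
  proof -
    obtain j where j: "j < J" "dist z (x j) < d" using x(2)[OF z] by blast
    show "dist z (x (cell z)) < d" unfolding cell_def using j(2) by (rule LeastI)
    have "cell z \<le> j" unfolding cell_def using j(2) by (rule Least_le)
    then show "cell z < J" using j(1) by simp
  qed
  have "cell \<in> measurable borel (count_space UNIV)"
    unfolding cell_def[abs_def] by measurable
  then have 1: "cell \<in> measurable sphere_borel (count_space UNIV)"
    unfolding sphere_borel_def by (rule measurable_restrict_space1)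
  have fp: "fine_partition J (\<lambda>j z. indicat_real {z \<in> unit_sphere. cell z = j} z) x d"
    unfolding fine_partition_def
  proof (intro conjI ballI allI impI)
    fix z :: "real ^ 'd" assume z: "z \<in> unit_sphere"
    have "(\<Sum>j<J. indicat_real {z \<in> unit_sphere. cell z = j} z) = (\<Sum>j<J. if cell z = j then 1 else 0)"
      using z by (intro sum.cong) (auto simp: indicator_def)
    then show "(\<Sum>j<J. indicat_real {z \<in> unit_sphere. cell z = j} z) = 1"
      using less[OF z] by simp
  qed (use x(1) close in \<open>auto simp: indicator_def split: if_splits\<close>)
  show ?thesis
  proof (rule that[of cell J x])
    show "cell z < J" if "z \<in> unit_sphere" for z using that by (rule less)
  qed (rule 1, rule fp)
qed

lemma sphere_partition_of_unity:
  assumes d: "0 < d"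
  obtains J :: nat and \<phi> :: "nat \<Rightarrow> real ^ 'd \<Rightarrow> real" and x :: "nat \<Rightarrow> real ^ 'd"
  where "\<And>j. continuous_on unit_sphere (\<phi> j)" "fine_partition J \<phi> x d"
proof -
  obtain J and x :: "nat \<Rightarrow> real ^ 'd" where "\<forall>j<J. x j \<in> unit_sphere"
    "\<forall>z \<in> unit_sphere. \<exists>j<J. dist z (x j) < d"
    using sphere_net[OF d] by blast
  note x = this(1)[rule_format] this(2)[rule_format]
  define \<psi> where "\<psi> j z = max 0 (d - dist z (x j))" for j z
  define s where "s z = (\<Sum>j<J. \<psi> j z)" for z
  have pos: "0 < s z" if z: "z \<in> unit_sphere" for z
  proof -
    obtain j where j: "j < J" "dist z (x j) < d" using x(2)[OF z] by blast
    then have "0 < \<psi> j z" by (simp add: \<psi>_def)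
    also have "\<dots> \<le> s z" unfolding s_def using j(1) by (intro member_le_sum) (auto simp: \<psi>_def)
    finally show ?thesis .
  qed
  show ?thesis
  proof (rule that[of "\<lambda>j z. \<psi> j z / s z" J x])
    show "continuous_on unit_sphere (\<lambda>z. \<psi> j z / s z)" for j
      using pos unfolding \<psi>_def s_def by (intro continuous_intros) force
    show "fine_partition J (\<lambda>j z. \<psi> j z / s z) x d"
      unfolding fine_partition_def
    proof (intro conjI ballI allI impI)
      fix z :: "real ^ 'd" assume z: "z \<in> unit_sphere"
      show "(\<Sum>j<J. \<psi> j z / s z) = 1"
        using pos[OF z] by (simp add: sum_divide_distrib[symmetric] s_def[symmetric])
      show "0 \<le> \<psi> j z / s z" for j using pos[OF z] by (simp add: \<psi>_def)
      show "dist z (x j) < d" if "\<psi> j z / s z \<noteq> 0" for j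
        using that by (auto simp: \<psi>_def max_def split: if_splits)
    qed (use x(1) in auto)
  qed
qed

section \<open>Maps do at least as well as limits of assignments\<close>

lemma sum_sum_factor:
  fixes c r :: real
  shows "(\<Sum>j\<in>A. \<Sum>k\<in>B. a j * b k * c / r) = (\<Sum>j\<in>A. a j) * (\<Sum>k\<in>B. b k) * (c / r)"
proof -
  have "(\<Sum>k\<in>B. a j * b k * c / r) = a j * ((\<Sum>k\<in>B. b k) * (c / r))" for j
    unfolding sum_distrib_left sum_distrib_right by (intro sum.cong refl) simp
  then show ?thesis by (simp only: sum_distrib_right[symmetric] mult.assoc)
qed

text \<open>
  The fraction \<open>p n j k\<close> of sample points moved from the cell \<open>j\<close> to the \<open>k\<close>-th piece of the target has a
  limit \<open>q j k\<close> along the ultrafilter, and its row and column sums are the masses under \<open>P\<close> and the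
  uniform law. Spreading \<open>q j k\<close> over the \<open>k\<close>-th piece in proportion to \<open>\<phi> k\<close> gives a density for each
  cell, and these densities are realised by a map. Its cost differs from the limit of the assignment
  costs only by oscillations of the cost over cells: one \<open>e\<close> each for replacing \<open>z\<close> by \<open>x j\<close>, \<open>z\<close> by
  \<open>y k\<close>, and the pair \<open>(X n i, Y n i)\<close> by \<open>(x j, y k)\<close>.
\<close>

lemma map_cost_le_limit_assignment_cost:
  fixes P :: "(real ^ 'd) measure" and X Y :: "nat \<Rightarrow> nat \<Rightarrow> real ^ 'd"
  assumes dim: "CARD('d) \<ge> 2" and P: "P \<in> bounded_density_laws"
    and F: "ultra F" "eventually (\<lambda>n. 1 \<le> n) F"
    and X: "\<And>n i. i \<in> {1..n} \<Longrightarrow> X n i \<in> unit_sphere"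
    and Y: "\<And>n i. i \<in> {1..n} \<Longrightarrow> Y n i \<in> unit_sphere"
    and cell: "cell \<in> measurable sphere_borel (count_space UNIV)"
      "\<And>z. z \<in> unit_sphere \<Longrightarrow> cell z < J"
      "fine_partition J (\<lambda>j z. indicat_real {z \<in> unit_sphere. cell z = j} z) x d"
    and \<phi>: "\<And>k. continuous_on unit_sphere (\<phi> k)" "fine_partition K \<phi> y d"
    and avgX: "\<And>j. j < J \<Longrightarrow> (row_average X (indicat_real {z \<in> unit_sphere. cell z = j})
        \<longlongrightarrow> measure P {z \<in> unit_sphere. cell z = j}) F"
    and avgY: "\<And>k. k < K \<Longrightarrow> (row_average Y (\<phi> k) \<longlongrightarrow> (LINT z|uniform_sphere. \<phi> k z)) F"
    and e: "\<And>a a' b b' :: real ^ 'd. \<lbrakk>a \<in> unit_sphere; a' \<in> unit_sphere; b \<in> unit_sphere; b' \<in> unit_sphere;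
      dist a a' < d; dist b b' < d\<rbrakk> \<Longrightarrow> \<bar>cost a b - cost a' b'\<bar> < e"
    and d: "0 < d"
    and C: "((\<lambda>n. (\<Sum>i=1..n. cost (X n i) (Y n i)) / n) \<longlongrightarrow> C) F"
  shows "\<exists>T \<in> transport_maps P uniform_sphere. (LINT z|P. cost z (T z)) \<le> C + 3 * e"
proof -
  define U where "U = (uniform_sphere :: (real ^ 'd) measure)"
  note Pd = bounded_density_lawsD[OF P]
  interpret P: prob_space P by (rule Pd(1))
  interpret U: prob_space U unfolding U_def by (rule prob_space_uniform_sphere)
  have sU: "sets U = sets sphere_borel" "space U = unit_sphere" by (simp_all add: U_def)
  define Q where "Q j = {z \<in> unit_sphere. cell z = j}" for j :: nat
  have Fnb: "F \<noteq> bot" using F(1) by (simp add: ultra_def)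
  have Q: "Q j \<in> sets P" for j
    using measurable_sets[OF cell(1), of "{j}"] Pd(2) by (simp add: Q_def vimage_def Int_def conj_commute)
  have xS: "x j \<in> unit_sphere" "\<And>z. z \<in> Q j \<Longrightarrow> dist z (x j) < d" if "j < J" for j
    using cell(3) that by (auto simp: fine_partition_def Q_def)
  have yS: "y k \<in> unit_sphere" "\<And>z. z \<in> unit_sphere \<Longrightarrow> 0 \<le> \<phi> k z"
    "\<And>z. z \<in> unit_sphere \<Longrightarrow> \<phi> k z \<noteq> 0 \<Longrightarrow> dist z (y k) < d" if "k < K" for k
    using \<phi>(2) that by (auto simp: fine_partition_def)
  have sumQ: "(\<Sum>j<J. indicat_real (Q j) z) = 1" and sum\<phi>: "(\<Sum>k<K. \<phi> k z) = 1"
    if "z \<in> unit_sphere" for z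
    using cell(3) \<phi>(2) that by (auto simp: fine_partition_def Q_def)
  have \<phi>1: "\<phi> k z \<le> 1" if "k < K" "z \<in> unit_sphere" for k z
    using member_le_sum[of k "{..<K}" "\<lambda>k. \<phi> k z"] yS(2) that sum\<phi>[OF that(2)] by auto
  have m\<phi>: "\<phi> k \<in> borel_measurable U" for k
    by (rule borel_measurable_sphereI[OF \<phi>(1) sU(1)])
  have i\<phi>: "integrable U (\<phi> k)" if "k < K" for k
    using yS(2) \<phi>1 that sU by (intro U.integrable_const_bound[where B = 1] AE_I2 m\<phi>) auto

  define p where "p n j k = (\<Sum>i=1..n. indicat_real (Q j) (X n i) * \<phi> k (Y n i)) / n" for n j k
  have p0: "0 \<le> p n j k" if "k < K" for n j k
    unfolding p_def using yS(2)[OF that] Y by (intro divide_nonneg_nonneg sum_nonneg mult_nonneg_nonneg) auto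
  have prow: "(\<Sum>k<K. p n j k) = row_average X (indicat_real (Q j)) n" for n j
  proof -
    have "(\<Sum>k<K. p n j k) = (\<Sum>i=1..n. \<Sum>k<K. indicat_real (Q j) (X n i) * \<phi> k (Y n i)) / n"
      unfolding p_def sum_divide_distrib[symmetric] by (subst sum.swap) simp
    also have "(\<Sum>i=1..n. \<Sum>k<K. indicat_real (Q j) (X n i) * \<phi> k (Y n i)) = (\<Sum>i=1..n. indicat_real (Q j) (X n i))"
      using Y sum\<phi> by (intro sum.cong) (auto simp: sum_distrib_left[symmetric])
    finally show ?thesis by (simp add: row_average_def)
  qed
  have pcol: "(\<Sum>j<J. p n j k) = row_average Y (\<phi> k) n" for n k
  proof -
    have "(\<Sum>j<J. p n j k) = (\<Sum>i=1..n. \<Sum>j<J. indicat_real (Q j) (X n i) * \<phi> k (Y n i)) / n"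
      unfolding p_def sum_divide_distrib[symmetric] by (subst sum.swap) simp
    also have "(\<Sum>i=1..n. \<Sum>j<J. indicat_real (Q j) (X n i) * \<phi> k (Y n i)) = (\<Sum>i=1..n. \<phi> k (Y n i))"
      using X sumQ by (intro sum.cong) (auto simp: sum_distrib_right[symmetric])
    finally show ?thesis by (simp add: row_average_def)
  qed
  have "\<forall>j k. \<exists>l. j < J \<and> k < K \<longrightarrow> ((\<lambda>n. p n j k) \<longlongrightarrow> l) F"
  proof (intro allI)
    fix j k
    show "\<exists>l. j < J \<and> k < K \<longrightarrow> ((\<lambda>n. p n j k) \<longlongrightarrow> l) F"
    proof (cases "j < J \<and> k < K")
      case True
      have "eventually (\<lambda>n. \<bar>p n j k\<bar> \<le> 1) F"
        using F(2)
      proof eventually_elim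
        case (elim n)
        have "p n j k \<le> (\<Sum>k<K. p n j k)" using True p0 by (intro member_le_sum) auto
        also have "\<dots> \<le> 1"
          unfolding prow using row_average_abs_le[OF elim, of "indicat_real (Q j)" X 1] by (auto simp: indicator_def)
        finally show ?case using p0[of k n j] True by auto
      qed
      then show ?thesis using ultra_bounded_limit[OF F(1)] by metis
    qed auto
  qed
  then obtain q where q: "\<And>j k. j < J \<Longrightarrow> k < K \<Longrightarrow> ((\<lambda>n. p n j k) \<longlongrightarrow> q j k) F"
    by metis
  have q0: "0 \<le> q j k" if "j < J" "k < K" for j k
    using tendsto_lowerbound[OF q[OF that] always_eventually Fnb] p0[OF that(2)] by blast
  have qrow: "(\<Sum>k<K. q j k) = measure P (Q j)" if j: "j < J" for j
  proof (rule tendsto_unique[OF Fnb])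
    show "((\<lambda>n. \<Sum>k<K. p n j k) \<longlongrightarrow> (\<Sum>k<K. q j k)) F" using q[OF j] by (intro tendsto_sum) auto
    show "((\<lambda>n. \<Sum>k<K. p n j k) \<longlongrightarrow> measure P (Q j)) F"
      unfolding prow using avgX[OF j] by (simp add: Q_def)
  qed
  define m where "m k = (LINT z|U. \<phi> k z)" for k
  have qcol: "(\<Sum>j<J. q j k) = m k" if k: "k < K" for k
  proof (rule tendsto_unique[OF Fnb])
    show "((\<lambda>n. \<Sum>j<J. p n j k) \<longlongrightarrow> (\<Sum>j<J. q j k)) F" using q[OF _ k] by (intro tendsto_sum) auto
    show "((\<lambda>n. \<Sum>j<J. p n j k) \<longlongrightarrow> m k) F"
      unfolding pcol using avgY[OF k] by (simp add: m_def U_def)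
  qed
  have q_zero: "q j k = 0" if "j < J" "k < K" "m k = 0" for j k
    using sum_nonneg_eq_0_iff[of "{..<J}" "\<lambda>j. q j k"] q0 qcol that by auto

  \<comment> \<open>If \<open>m k = 0\<close> then \<open>q j k = 0\<close> too, and the convention \<open>0 / 0 = 0\<close> is the right value.\<close>
  define w where "w j k = q j k / m k" for j k
  have w0: "0 \<le> w j k" if "j < J" "k < K" for j k
    using q0[OF that] yS(2)[OF that(2)] sU by (auto simp: w_def m_def intro!: divide_nonneg_nonneg Bochner_Integration.integral_nonneg)
  have wm: "w j k * m k = q j k" if "j < J" "k < K" for j k
    using q_zero[OF that] by (auto simp: w_def)
  define h where "h j z = (if j < J then \<Sum>k<K. w j k * \<phi> k z else 0)" for j z
  have mh: "h j \<in> borel_measurable U" for j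
    unfolding h_def[abs_def] using m\<phi> by (cases "j < J") auto
  have h0: "0 \<le> h j z" if "z \<in> space U" for j z
    unfolding h_def using w0 yS(2) that sU by (auto intro!: sum_nonneg mult_nonneg_nonneg)
  have ih: "integrable U (h j)" for j
    unfolding h_def[abs_def] using i\<phi> by (cases "j < J") auto
  have Ih: "(LINT z|U. h j z) = measure P (Q j)" if j: "j < J" for j
  proof -
    have "(LINT z|U. h j z) = (\<Sum>k<K. w j k * m k)"
      using j i\<phi> unfolding h_def m_def by (simp add: Bochner_Integration.integral_sum)
    also have "\<dots> = measure P (Q j)" using wm[OF j] qrow[OF j] by simp
    finally show ?thesis .
  qed
  have tot: "AE z in U. (\<Sum>j<J. h j z) = 1"
  proof -
    have "AE z in U. \<forall>k\<in>{..<K}. m k = 0 \<longrightarrow> \<phi> k z = 0"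
    proof (rule AE_finite_allI)
      fix k assume "k \<in> {..<K}"
      then have k: "k < K" by simp
      show "AE z in U. m k = 0 \<longrightarrow> \<phi> k z = 0"
      proof -
        have "AE z in U. 0 \<le> \<phi> k z" using yS(2)[OF k] sU by (intro AE_I2) auto
        then show ?thesis
          using integral_nonneg_eq_0_iff_AE[OF i\<phi>[OF k]] unfolding m_def
          by (cases "(LINT z|U. \<phi> k z) = 0") auto
      qed
    qed simp
    then show ?thesis
      using AE_space
    proof eventually_elim
      case (elim z)
      have "(\<Sum>j<J. h j z) = (\<Sum>k<K. \<Sum>j<J. w j k * \<phi> k z)"
        unfolding h_def by (subst sum.swap) simp
      also have "\<dots> = (\<Sum>k<K. \<phi> k z)"
      proof (rule sum.cong[OF refl])
        fix k assume k: "k \<in> {..<K}"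
        have "(\<Sum>j<J. w j k * \<phi> k z) = (\<Sum>j<J. q j k) / m k * \<phi> k z"
          by (simp add: w_def sum_distrib_right sum_divide_distrib)
        also have "\<dots> = \<phi> k z" using qcol elim(1) k by (cases "m k = 0") auto
        finally show "(\<Sum>j<J. w j k * \<phi> k z) = \<phi> k z" .
      qed
      also have "\<dots> = 1" using elim(2) sU sum\<phi> by simp
      finally show ?case .
    qed
  qed
  obtain i1 i2 :: 'd where i12: "i1 \<noteq> i2"
    using two_coordinates[OF dim] by blast
  have mratio: "(\<lambda>z :: real ^ 'd. z $ i1 / z $ i2) \<in> borel_measurable P"
  proof -
    have [measurable]: "(\<lambda>z::real^'d. z $ i) \<in> borel_measurable borel" for i
      by (intro borel_measurable_continuous_onI continuous_intros)
    show ?thesis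
      unfolding measurable_cong_sets[OF Pd(2) refl] sphere_borel_def
      by (rule measurable_restrict_space1) measurable
  qed
  have "\<exists>T \<in> transport_maps P U. \<forall>j<J.
      distr (density P (indicator {z \<in> space P. cell z = j})) sphere_borel T
        = density U (\<lambda>y. ennreal (h j y))"
  proof (rule transport_with_cell_densities[OF Pd(1,2) U.prob_space_axioms sU(1) mratio _ _ _ mh h0 _ tot])
    show "measure P {z \<in> space P. z $ i1 / z $ i2 = t} = 0" for t
      using Pd(4)[OF surface_measure_ratio_level[OF i12, of t]] by (simp add: Pd(3) measure_def null_setsD1)
    show "cell \<in> measurable P (count_space UNIV)"
      using cell(1) by (simp add: measurable_cong_sets[OF Pd(2) refl])
    show "cell z < J" if "z \<in> space P" for z using cell(2) that Pd(3) by simp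
    show "(\<integral>\<^sup>+y. ennreal (h j y) \<partial>U) = emeasure P {z \<in> space P. cell z = j}" if "j < J" for j
      using nn_integral_eq_integral[OF ih, of j] h0 Ih[OF that]
      by (simp add: AE_I2 P.emeasure_eq_measure Pd(3) Q_def)
  qed
  then obtain T where T0: "T \<in> transport_maps P U" "\<forall>j<J.
      distr (density P (indicator {z \<in> space P. cell z = j})) sphere_borel T
        = density U (\<lambda>y. ennreal (h j y))" by blast
  note T = T0(1) T0(2)[rule_format]
  have mT: "T \<in> measurable P sphere_borel"
    using T(1) by (simp add: transport_maps_def measurable_cong_sets[OF Pd(2) refl])
  have TS: "T z \<in> unit_sphere" if "z \<in> unit_sphere" for z
    using measurable_space[OF mT] that Pd(3) by simp
  have cc: "continuous_on unit_sphere (\<lambda>z. cost a z)" if "a \<in> unit_sphere" for a :: "real ^ 'd"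
    using that by (intro continuous_on_cost continuous_intros) auto
  have mc: "(\<lambda>z. cost (x j) (T z)) \<in> borel_measurable P" if "j < J" for j
    using measurable_compose[OF mT borel_measurable_sphereI[OF cc[OF xS(1)[OF that]] refl]] .
  have e0: "0 < e" using e[of "y 0" "y 0" "y 0" "y 0"]
    by (metis abs_ge_zero d dist_self e le_less_trans vector_choose_size mem_sphere_0 zero_le_one)
  have mcT: "(\<lambda>z. cost z (T z)) \<in> borel_measurable P"
  proof -
    have mid: "(\<lambda>z. z) \<in> borel_measurable P"
      by (rule borel_measurable_sphereI[OF continuous_on_id Pd(2)])
    have [measurable]: "T \<in> borel_measurable P"
      using mT unfolding sphere_borel_def by (rule measurable_restrict_space2_iff[THEN iffD1, THEN conjunct1])
    note mid[measurable]
    have "continuous_on UNIV (\<lambda>s :: real. arccos (max (- 1) (min 1 s)))"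
      by (intro continuous_on_arccos continuous_intros) auto
    then have [measurable]: "(\<lambda>s :: real. arccos (max (- 1) (min 1 s))) \<in> borel_measurable borel"
      by (rule borel_measurable_continuous_onI)
    have "(\<lambda>z. 1 / 2 * (arccos (max (- 1) (min 1 (z \<bullet> T z))))\<^sup>2) \<in> borel_measurable P"
      by measurable
    moreover have "1 / 2 * (arccos (max (- 1) (min 1 (z \<bullet> T z))))\<^sup>2 = cost z (T z)" if "z \<in> space P" for z
      using inner_sphere_bounds[of z "T z"] TS[of z] that
      unfolding cost_def geodesic_dist_def Pd(3) by simp
    ultimately show ?thesis by (subst (asm) measurable_cong)
  qed
  have cabs: "\<bar>cost a b\<bar> \<le> pi\<^sup>2 / 2" if "a \<in> unit_sphere" "b \<in> unit_sphere" for a b :: "real ^ 'd"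
    using cost_bounds[OF that] by simp
  have icT: "integrable P (\<lambda>z. cost z (T z))"
  proof (rule P.integrable_const_bound[where B = "pi\<^sup>2 / 2", OF AE_I2 mcT])
    show "norm (cost z (T z)) \<le> pi\<^sup>2 / 2" if "z \<in> space P" for z
      unfolding real_norm_def using that Pd(3) by (intro cabs TS) simp_all
  qed
  have icx: "integrable P (\<lambda>z. indicat_real (Q j) z * cost (x j) (T z))" if j: "j < J" for j
  proof (rule P.integrable_const_bound[where B = "pi\<^sup>2 / 2", OF AE_I2])
    show "norm (indicat_real (Q j) z * cost (x j) (T z)) \<le> pi\<^sup>2 / 2" if "z \<in> space P" for z
      using cabs[OF xS(1)[OF j] TS[of z]] that Pd(3) by (auto simp: indicator_def)
    show "(\<lambda>z. indicat_real (Q j) z * cost (x j) (T z)) \<in> borel_measurable P"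
      using Q mc[OF j] by (intro borel_measurable_times) auto
  qed
  have cellcost: "(LINT z|P. indicat_real (Q j) z * cost (x j) (T z)) \<le> (\<Sum>k<K. q j k * (cost (x j) (y k) + e))"
    if j: "j < J" for j
  proof -
    let ?c = "\<lambda>z. cost (x j) z"
    have mcs: "?c \<in> borel_measurable sphere_borel" by (rule borel_measurable_sphereI[OF cc[OF xS(1)[OF j]] refl])
    have mcU: "?c \<in> borel_measurable U" by (rule borel_measurable_sphereI[OF cc[OF xS(1)[OF j]] sU(1)])
    have Qj: "{z \<in> space P. cell z = j} = Q j" by (simp add: Q_def Pd(3))
    have "(LINT z|P. indicat_real (Q j) z * cost (x j) (T z))
        = (LINT z|density P (\<lambda>z. ennreal (indicat_real (Q j) z)). ?c (T z))"
      using mc[OF j] Q by (subst integral_density) auto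
    also have "density P (\<lambda>z. ennreal (indicat_real (Q j) z)) = density P (indicator (Q j))"
      by (simp add: ennreal_indicator)
    also have "(LINT z|density P (indicator (Q j)). ?c (T z))
        = (LINT z|distr (density P (indicator (Q j))) sphere_borel T. ?c z)"
      using mT by (intro integral_distr[symmetric] mcs) simp
    also have "\<dots> = (LINT z|density U (\<lambda>z. ennreal (h j z)). ?c z)"
      using T(2)[OF j] by (simp only: Qj)
    also have "\<dots> = (LINT z|U. h j z * ?c z)"
      using mcU mh h0 by (subst integral_density) (auto intro!: AE_I2)
    also have "\<dots> = (LINT z|U. (\<Sum>k<K. w j k * (\<phi> k z * ?c z)))"
      using j by (simp add: h_def sum_distrib_right mult.assoc)
    also have "\<dots> = (\<Sum>k<K. w j k * (LINT z|U. \<phi> k z * ?c z))"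
    proof (subst Bochner_Integration.integral_sum)
      fix k assume "k \<in> {..<K}"
      then have k: "k < K" by simp
      have "\<bar>\<phi> k z * ?c z\<bar> \<le> 1 * (pi\<^sup>2 / 2)" if "z \<in> unit_sphere" for z
        unfolding abs_mult using \<phi>1[OF k that] yS(2)[OF k that] cost_bounds[OF xS(1)[OF j] that]
        by (intro mult_mono) auto
      then have "integrable U (\<lambda>z. \<phi> k z * ?c z)"
        using sU by (intro U.integrable_const_bound[where B = "1 * (pi\<^sup>2 / 2)"] AE_I2 borel_measurable_times m\<phi> mcU) auto
      then show "integrable U (\<lambda>z. w j k * (\<phi> k z * ?c z))" by simp
    qed simp
    also have "\<dots> \<le> (\<Sum>k<K. w j k * (m k * (?c (y k) + e)))"
    proof (intro sum_mono mult_left_mono w0[OF j])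
      fix k assume "k \<in> {..<K}"
      then have k: "k < K" by simp
      have "(LINT z|U. \<phi> k z * ?c z) \<le> (LINT z|U. \<phi> k z * (?c (y k) + e))"
      proof (rule Bochner_Integration.integral_mono')
        show "integrable U (\<lambda>z. \<phi> k z * (?c (y k) + e))" using i\<phi>[OF k] by simp
        show "\<phi> k z * ?c z \<le> \<phi> k z * (?c (y k) + e)" if "z \<in> space U" for z
        proof (cases "\<phi> k z = 0")
          case False
          have z: "z \<in> unit_sphere" using that sU by simp
          have "\<bar>?c z - ?c (y k)\<bar> < e"
            using e[OF xS(1)[OF j] xS(1)[OF j] z yS(1)[OF k] _ yS(3)[OF k z False]] d by simp
          then show ?thesis using yS(2)[OF k z] by (intro mult_left_mono) auto
        qed simp
        show "0 \<le> \<phi> k z * (?c (y k) + e)" if "z \<in> space U" for z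
          using that sU yS(1,2)[OF k] e0 cost_bounds(1)[OF xS(1)[OF j] yS(1)[OF k]] by auto
      qed
      then show "(LINT z|U. \<phi> k z * ?c z) \<le> m k * (?c (y k) + e)" using i\<phi>[OF k] by (simp add: m_def)
    qed simp
    also have "\<dots> = (\<Sum>k<K. q j k * (?c (y k) + e))"
      using wm[OF j] by (intro sum.cong) (auto simp: mult.assoc[symmetric])
    finally show ?thesis .
  qed
  have "(LINT z|P. cost z (T z)) \<le> (LINT z|P. (\<Sum>j<J. indicat_real (Q j) z * cost (x j) (T z)) + e)"
  proof (rule integral_mono[OF icT])
    show "integrable P (\<lambda>z. (\<Sum>j<J. indicat_real (Q j) z * cost (x j) (T z)) + e)"
      using icx by (intro Bochner_Integration.integrable_add Bochner_Integration.integrable_sum) auto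
    fix z assume "z \<in> space P"
    then have z: "z \<in> unit_sphere" by (simp add: Pd(3))
    have j: "cell z < J" "z \<in> Q (cell z)" using cell(2)[OF z] z by (auto simp: Q_def)
    have "(\<Sum>j<J. indicat_real (Q j) z * cost (x j) (T z)) = (\<Sum>j<J. if j = cell z then cost (x j) (T z) else 0)"
      using z by (intro sum.cong) (auto simp: Q_def indicator_def)
    also have "\<dots> = cost (x (cell z)) (T z)" using j(1) by simp
    finally show "cost z (T z) \<le> (\<Sum>j<J. indicat_real (Q j) z * cost (x j) (T z)) + e"
      using e[OF z xS(1)[OF j(1)] TS[OF z] TS[OF z] xS(2)[OF j]] d by simp
  qed
  also have "\<dots> = (\<Sum>j<J. LINT z|P. indicat_real (Q j) z * cost (x j) (T z)) + e"
  proof (subst Bochner_Integration.integral_add)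
    show "integrable P (\<lambda>z. \<Sum>j<J. indicat_real (Q j) z * cost (x j) (T z))"
      using icx by (intro Bochner_Integration.integrable_sum) auto
    have "(LINT z|P. (\<Sum>j<J. indicat_real (Q j) z * cost (x j) (T z)))
        = (\<Sum>j<J. LINT z|P. indicat_real (Q j) z * cost (x j) (T z))"
      using icx by (intro Bochner_Integration.integral_sum) simp
    then show "(LINT z|P. (\<Sum>j<J. indicat_real (Q j) z * cost (x j) (T z))) + (LINT z|P. e)
        = (\<Sum>j<J. LINT z|P. indicat_real (Q j) z * cost (x j) (T z)) + e"
      using P.prob_space by (simp only: lebesgue_integral_const) simp
  qed simp
  also have "\<dots> \<le> (\<Sum>j<J. \<Sum>k<K. q j k * (cost (x j) (y k) + e)) + e"
    using cellcost by (intro add_right_mono sum_mono) auto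
  also have "(\<Sum>j<J. \<Sum>k<K. q j k * (cost (x j) (y k) + e)) \<le> C + 2 * e"
  proof (rule tendsto_le[OF Fnb tendsto_add[OF C tendsto_const]])
    show "((\<lambda>n. \<Sum>j<J. \<Sum>k<K. p n j k * (cost (x j) (y k) + e)) \<longlongrightarrow>
        (\<Sum>j<J. \<Sum>k<K. q j k * (cost (x j) (y k) + e))) F"
      using q by (intro tendsto_sum tendsto_mult tendsto_const) auto
    show "\<forall>\<^sub>F n in F. (\<Sum>j<J. \<Sum>k<K. p n j k * (cost (x j) (y k) + e))
        \<le> (\<Sum>i=1..n. cost (X n i) (Y n i)) / n + 2 * e"
      using F(2)
    proof eventually_elim
      case (elim n)
      have "(\<Sum>j<J. \<Sum>k<K. p n j k * (cost (x j) (y k) + e))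
          = (\<Sum>j<J. \<Sum>k<K. \<Sum>i=1..n. indicat_real (Q j) (X n i) * \<phi> k (Y n i) * (cost (x j) (y k) + e) / n)"
        unfolding p_def sum_divide_distrib sum_distrib_right by simp
      also have "\<dots> = (\<Sum>i=1..n. \<Sum>j<J. \<Sum>k<K. indicat_real (Q j) (X n i) * \<phi> k (Y n i) * (cost (x j) (y k) + e) / n)"
        by (subst (2) sum.swap, subst sum.swap) simp
      also have "\<dots> \<le> (\<Sum>i=1..n. \<Sum>j<J. \<Sum>k<K. indicat_real (Q j) (X n i) * \<phi> k (Y n i) * (cost (X n i) (Y n i) + 2 * e) / n)"
      proof (intro sum_mono divide_right_mono)
        fix i j k assume ijk: "i \<in> {1..n}" "j \<in> {..<J}" "k \<in> {..<K}"
        show "indicat_real (Q j) (X n i) * \<phi> k (Y n i) * (cost (x j) (y k) + e)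
            \<le> indicat_real (Q j) (X n i) * \<phi> k (Y n i) * (cost (X n i) (Y n i) + 2 * e)"
        proof (cases "X n i \<in> Q j \<and> \<phi> k (Y n i) \<noteq> 0")
          case True
          have "\<bar>cost (X n i) (Y n i) - cost (x j) (y k)\<bar> < e"
            using True ijk X Y xS yS by (intro e) auto
          then show ?thesis using ijk yS(2) Y by (intro mult_left_mono mult_nonneg_nonneg) auto
        qed auto
      qed simp
      also have "\<dots> = (\<Sum>i=1..n. (\<Sum>j<J. indicat_real (Q j) (X n i)) * (\<Sum>k<K. \<phi> k (Y n i)) * ((cost (X n i) (Y n i) + 2 * e) / n))"
        by (intro sum.cong refl sum_sum_factor)
      also have "\<dots> = (\<Sum>i=1..n. (cost (X n i) (Y n i) + 2 * e) / n)"
        using sumQ sum\<phi> X Y by (intro sum.cong) auto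
      also have "\<dots> = (\<Sum>i=1..n. cost (X n i) (Y n i)) / n + 2 * e"
        using elim by (simp add: sum_divide_distrib[symmetric] sum.distrib add_divide_distrib)
      finally show ?case .
    qed
  qed
  finally show ?thesis using T(1) unfolding U_def by (intro bexI[of _ T]) auto
qed

section \<open>Limits of optimal assignments\<close>

lemma cost_equicontinuous_uniform:
  fixes u :: "real ^ 'd \<Rightarrow> real"
  assumes u: "cost_equicontinuous u"
    and d: "\<And>x x' y y' :: real ^ 'd. \<lbrakk>x \<in> unit_sphere; x' \<in> unit_sphere; y \<in> unit_sphere; y' \<in> unit_sphere;
      dist x x' < d; dist y y' < d\<rbrakk> \<Longrightarrow> \<bar>cost x y - cost x' y'\<bar> < e"
    and ab: "a \<in> unit_sphere" "b \<in> unit_sphere" "dist a b < d"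
  shows "\<bar>u a - u b\<bar> \<le> e"
proof -
  have "0 < d" using ab(3) zero_le_dist[of a b] by linarith
  then have "\<forall>y\<in>unit_sphere. \<bar>cost a y - cost b y\<bar> \<le> e" using d[OF ab(1,2)] ab(3) by (auto intro!: less_imp_le)
  then show ?thesis using u ab(1,2) unfolding cost_equicontinuous_def by blast
qed

lemma cost_equicontinuous_limit:
  fixes u :: "nat \<Rightarrow> real ^ 'd \<Rightarrow> real"
  assumes F: "F \<noteq> bot" "eventually (\<lambda>n. cost_equicontinuous (u n)) F"
    and lim: "\<And>z. z \<in> unit_sphere \<Longrightarrow> ((\<lambda>n. u n z) \<longlongrightarrow> g z) F"
  shows "cost_equicontinuous g"
  unfolding cost_equicontinuous_def
proof (intro ballI allI impI)
  fix a b :: "real ^ 'd" and e assume ab: "a \<in> unit_sphere" "b \<in> unit_sphere"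
    and e: "\<forall>y\<in>unit_sphere. \<bar>cost a y - cost b y\<bar> \<le> e"
  have "((\<lambda>n. \<bar>u n a - u n b\<bar>) \<longlongrightarrow> \<bar>g a - g b\<bar>) F"
    by (intro tendsto_intros lim ab)
  moreover have "eventually (\<lambda>n. \<bar>u n a - u n b\<bar> \<le> e) F"
    using F(2) by eventually_elim (use ab e in \<open>unfold cost_equicontinuous_def, blast\<close>)
  ultimately show "\<bar>g a - g b\<bar> \<le> e" using F(1) by (rule tendsto_upperbound)
qed

lemma cost_equicontinuous_continuous:
  fixes u :: "real ^ 'd \<Rightarrow> real"
  assumes "cost_equicontinuous u"
  shows "continuous_on unit_sphere u"
  unfolding continuous_on_iff
proof (intro ballI allI impI)
  fix a :: "real ^ 'd" and e :: real assume a: "a \<in> unit_sphere" and e: "0 < e"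
  obtain d where d: "0 < d" "\<And>x x' y y' :: real ^ 'd. \<lbrakk>x \<in> unit_sphere; x' \<in> unit_sphere; y \<in> unit_sphere;
      y' \<in> unit_sphere; dist x x' < d; dist y y' < d\<rbrakk> \<Longrightarrow> \<bar>cost x y - cost x' y'\<bar> < e / 2"
    using cost_uniformly_continuous[of "e / 2"] e by (metis half_gt_zero)
  have "dist (u b) (u a) < e" if "b \<in> unit_sphere" "dist b a < d" for b
    using cost_equicontinuous_uniform[OF assms d(2) that(1) a that(2)] e by (simp add: dist_real_def)
  then show "\<exists>d>0. \<forall>b\<in>unit_sphere. dist b a < d \<longrightarrow> dist (u b) (u a) < e" using d(1) by blast
qed

lemma cost_equicontinuous_tendsto:
  fixes a :: "nat \<Rightarrow> real ^ 'd"
  assumes eq: "eventually (\<lambda>n. cost_equicontinuous (u n) \<and> a n \<in> unit_sphere) F"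
    and lim: "((\<lambda>n. u n b) \<longlongrightarrow> l) F" and a: "(a \<longlongrightarrow> b) F" and b: "b \<in> unit_sphere"
  shows "((\<lambda>n. u n (a n)) \<longlongrightarrow> l) F"
proof -
  have "((\<lambda>n. u n (a n) - u n b) \<longlongrightarrow> 0) F"
    unfolding tendsto_iff
  proof (intro allI impI)
    fix e :: real assume e: "0 < e"
    obtain d where d: "0 < d" "\<And>x x' y y' :: real ^ 'd. \<lbrakk>x \<in> unit_sphere; x' \<in> unit_sphere; y \<in> unit_sphere;
        y' \<in> unit_sphere; dist x x' < d; dist y y' < d\<rbrakk> \<Longrightarrow> \<bar>cost x y - cost x' y'\<bar> < e / 2"
      using cost_uniformly_continuous[of "e / 2"] e by (metis half_gt_zero)
    have "eventually (\<lambda>n. dist (a n) b < d) F" using a d(1) by (rule tendstoD)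
    with eq show "eventually (\<lambda>n. dist (u n (a n) - u n b) 0 < e) F"
    proof eventually_elim
      case (elim n)
      then have "\<bar>u n (a n) - u n b\<bar> \<le> e / 2"
        by (intro cost_equicontinuous_uniform[OF _ d(2)] b) auto
      then show ?case using e by (simp add: dist_real_def)
    qed
  qed
  from tendsto_add[OF this lim] show ?thesis by simp
qed

lemma integral_discrete_uniform:
  fixes g :: "nat \<Rightarrow> real ^ 'd"
  assumes "g ` {1..n} \<subseteq> unit_sphere" "inj_on g {1..n}" "continuous_on unit_sphere f"
  shows "(LINT x|discrete_uniform (g ` {1..n}). f x) = (\<Sum>i=1..n. f (g i)) / n"
proof -
  have "(LINT x|discrete_uniform (g ` {1..n}). f x) = (LINT x|uniform_count_measure (g ` {1..n}). f x)"
    unfolding discrete_uniform_def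
  proof (rule integral_distr)
    show "(\<lambda>x. x) \<in> measurable (uniform_count_measure (g ` {1..n})) sphere_borel"
      using assms(1) by (auto simp: measurable_def space_uniform_count_measure sets_uniform_count_measure)
    show "f \<in> borel_measurable sphere_borel" by (rule borel_measurable_sphereI[OF assms(3) refl])
  qed
  also have "\<dots> = sum f (g ` {1..n}) / card (g ` {1..n})"
    by (rule integral_uniform_count_measure) simp
  also have "\<dots> = (\<Sum>i=1..n. f (g i)) / n"
    using assms(2) by (simp add: sum.reindex card_image)
  finally show ?thesis .
qed

text \<open>
  A positive value would persist on a cap, and caps have positive probability.
\<close>

lemma continuous_nonneg_integral_zero:
  fixes f :: "real ^ 'd \<Rightarrow> real"
  assumes P: "P \<in> bounded_density_laws" and f: "continuous_on unit_sphere f"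
    and f0: "\<And>z. z \<in> unit_sphere \<Longrightarrow> 0 \<le> f z" and int: "integrable P f" "(LINT z|P. f z) \<le> 0"
    and a: "a \<in> unit_sphere"
  shows "f a = 0"
proof (rule ccontr)
  note Pd = bounded_density_lawsD[OF P]
  interpret prob_space P by (rule Pd(1))
  assume "f a \<noteq> 0"
  then have fa: "0 < f a" using f0[OF a] by simp
  then obtain d where d: "0 < d" "\<And>z. z \<in> unit_sphere \<Longrightarrow> dist z a < d \<Longrightarrow> dist (f z) (f a) < f a / 2"
    using f a unfolding continuous_on_iff by (metis half_gt_zero)
  let ?A = "unit_sphere \<inter> ball a d"
  have A: "?A \<in> sets P" unfolding Pd(2) by (auto simp: sets_sphere_borel)
  have "0 < f a / 2 * measure P ?A" using fa Pd(5)[OF a d(1)] by simp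
  also have "\<dots> = (LINT z|P. f a / 2 * indicat_real ?A z)" using A by simp
  also have "\<dots> \<le> (LINT z|P. f z)"
  proof (rule integral_mono[OF _ int(1)])
    show "integrable P (\<lambda>z. f a / 2 * indicat_real ?A z)" using A by (simp add: emeasure_eq_measure)
    show "f a / 2 * indicat_real ?A z \<le> f z" if "z \<in> space P" for z
    proof (cases "z \<in> ball a d")
      case True
      then have "dist (f z) (f a) < f a / 2" using d(2)[of z] that Pd(3) by (simp add: dist_commute)
      then have "f a / 2 \<le> f z" unfolding dist_real_def by linarith
      then show ?thesis using that Pd(3) True by simp
    qed (use f0 that Pd(3) in auto)
  qed
  finally show False using int(2) by simp
qed

text \<open>
  As \<open>Fn\<close> is a bijection onto \<open>n\<close> distinct grid points, the sample points are distinct too, and \<open>Fn\<close>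
  becomes a permutation of the indices.
\<close>

lemma empirical_directional_df_permutation:
  assumes emp: "empirical_directional_df n g z Fn" and g: "inj_on g {1..n}"
  obtains t where "t permutes {1..n}" "\<And>i. i \<in> {1..n} \<Longrightarrow> Fn (z i) = g (t i)"
proof -
  let ?I = "{1..n}"
  have bij: "bij_betw Fn (z ` ?I) (g ` ?I)"
    using emp by (simp add: empirical_directional_df_def)
  have "card (z ` ?I) = card ?I"
    using bij_betw_same_card[OF bij] card_image[OF g] by simp
  then have "inj_on z ?I" by (intro eq_card_imp_inj_on) auto
  then have "bij_betw z ?I (z ` ?I)" by (simp add: bij_betw_imageI)
  then have "bij_betw (the_inv_into ?I g \<circ> (Fn \<circ> z)) ?I ?I"
    using bij bij_betw_the_inv_into[OF inj_on_imp_bij_betw[OF g]] by (intro bij_betw_trans)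
  moreover define t where "t i = (if i \<in> ?I then (the_inv_into ?I g \<circ> (Fn \<circ> z)) i else i)" for i
  moreover have "bij_betw t ?I ?I \<longleftrightarrow> bij_betw (the_inv_into ?I g \<circ> (Fn \<circ> z)) ?I ?I"
    by (rule bij_betw_cong) (simp add: t_def)
  ultimately have "bij_betw t ?I ?I" by simp
  then have t: "t permutes ?I" by (rule bij_imp_permutes) (auto simp: t_def)
  have gt: "Fn (z i) = g (t i)" if "i \<in> ?I" for i
  proof -
    have "Fn (z i) \<in> g ` ?I" using bij that by (auto simp: bij_betw_def)
    then show ?thesis using f_the_inv_into_f[OF g, of "Fn (z i)"] that by (simp add: t_def)
  qed
  show ?thesis by (rule that[OF t gt])
qed

lemma empirical_directional_df_optimal:
  assumes emp: "empirical_directional_df n g z Fn" and g: "inj_on g {1..n}" and p: "p permutes {1..n}"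
  shows "(\<Sum>i=1..n. cost (z i) (Fn (z i))) \<le> (\<Sum>i=1..n. cost (z i) (Fn (z (p i))))"
proof -
  let ?I = "{1..n}"
  obtain t where t: "t permutes ?I" "\<And>i. i \<in> ?I \<Longrightarrow> Fn (z i) = g (t i)"
    using empirical_directional_df_permutation[OF emp g] by metis
  have tp: "t \<circ> p permutes ?I" by (rule permutes_compose[OF p t(1)])
  have "(\<Sum>i=1..n. cost (z i) (Fn (z i)))
      = (MIN T \<in> {T. T permutes ?I}. \<Sum>i=1..n. cost (z i) (g (T i)))"
    using emp by (simp add: empirical_directional_df_def)
  also have "\<dots> \<le> (\<Sum>i=1..n. cost (z i) (g ((t \<circ> p) i)))"
  proof (rule Min_le)
    show "finite ((\<lambda>T. \<Sum>i=1..n. cost (z i) (g (T i))) ` {T. T permutes ?I})"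
      by (intro finite_imageI finite_permutations) simp
  qed (use tp in blast)
  also have "\<dots> = (\<Sum>i=1..n. cost (z i) (Fn (z (p i))))"
    using t(2) permutes_in_image[OF p] by (intro sum.cong) auto
  finally show ?thesis .
qed

text \<open>
  Passing to the limit in the potentials gives \<open>u' + v' \<le> cost\<close> with equality at \<open>(z0, y0)\<close>, and
  \<open>Lu + Lv\<close> is both the limit of the average assignment costs and the dual value
  \<open>\<integral>u' dP + \<integral>v' dU\<close>. The map \<open>S\<close> costs at most this value, so that equality \<open>u' z + v' (S z) = cost z (S z)\<close>
  holds almost everywhere, hence everywhere by continuity. Two pairs in the contact set of \<open>(u', v')\<close>
  are always monotone: this applies to the graph of \<open>S\<close> together with \<open>(z0, y0)\<close>.
\<close>

lemma assignment_limits_at_map: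
  fixes P :: "(real ^ 'd) measure" and X Y :: "nat \<Rightarrow> nat \<Rightarrow> real ^ 'd"
  assumes dim: "CARD('d) \<ge> 2" and P: "P \<in> bounded_density_laws" and dF: "directional_df P S"
    and F: "ultra F" "eventually (\<lambda>n. 1 \<le> n) F"
    and X: "\<And>n i. i \<in> {1..n} \<Longrightarrow> X n i \<in> unit_sphere"
    and Y: "\<And>n i. i \<in> {1..n} \<Longrightarrow> Y n i \<in> unit_sphere"
    and opt: "\<And>n p. p permutes {1..n} \<Longrightarrow>
      (\<Sum>i=1..n. cost (X n i) (Y n i)) \<le> (\<Sum>i=1..n. cost (X n i) (Y n (p i)))"
    and cells: "\<And>m. cell m \<in> measurable sphere_borel (count_space UNIV)"
      "\<And>m z. z \<in> unit_sphere \<Longrightarrow> cell m z < J m"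
      "\<And>m. fine_partition (J m) (\<lambda>j z. indicat_real {z \<in> unit_sphere. cell m z = j} z) (x m) (1 / Suc m)"
    and avgX: "\<And>m j. (row_average X (indicat_real {z \<in> unit_sphere. cell m z = j})
        \<longlongrightarrow> measure P {z \<in> unit_sphere. cell m z = j}) F"
    and avgY: "\<And>f. continuous_on unit_sphere f \<Longrightarrow> (row_average Y f \<longlongrightarrow> (LINT z|uniform_sphere. f z)) F"
    and k: "eventually (\<lambda>n. k n \<in> {1..n}) F"
    and limX: "((\<lambda>n. X n (k n)) \<longlongrightarrow> z0) F" and limY: "((\<lambda>n. Y n (k n)) \<longlongrightarrow> y0) F"
    and z0: "z0 \<in> unit_sphere" and y0: "y0 \<in> unit_sphere"
  shows "y0 = S z0"
proof -
  define U where "U = (uniform_sphere :: (real ^ 'd) measure)"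
  note Pd = bounded_density_lawsD[OF P]
  interpret P: prob_space P by (rule Pd(1))
  interpret U: prob_space U unfolding U_def by (rule prob_space_uniform_sphere)
  have sU: "sets U = sets sphere_borel" "space U = unit_sphere" by (simp_all add: U_def)
  have Fnb: "F \<noteq> bot" using F(1) by (simp add: ultra_def)
  have S: "S \<in> measurable sphere_borel sphere_borel" "distr P sphere_borel S = U"
    and Sopt: "\<And>T. T \<in> transport_maps P U \<Longrightarrow> (LINT z|P. cost z (S z)) \<le> (LINT z|P. cost z (T z))"
    and Sc: "continuous_on unit_sphere S"
    using dF unfolding directional_df_def optimal_transport_map_def transport_maps_def U_def by auto
  have SS: "S z \<in> unit_sphere" if "z \<in> unit_sphere" for z
    using measurable_space[OF S(1)] that by simp
  have icont: "integrable M f" if "prob_space M" "sets M = sets sphere_borel" "continuous_on unit_sphere f"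
    for M and f :: "real ^ 'd \<Rightarrow> real"
  proof -
    interpret M: prob_space M by fact
    have "bounded (f ` unit_sphere)"
      by (intro compact_imp_bounded compact_continuous_image that compact_sphere)
    then obtain B where "\<forall>z\<in>unit_sphere. norm (f z) \<le> B" unfolding bounded_iff by auto
    then show ?thesis
      using sets_eq_imp_space_eq[OF that(2)] borel_measurable_sphereI[OF that(3,2)]
      by (intro M.integrable_const_bound[where B = B] AE_I2) auto
  qed

  define good where "good n u v \<longleftrightarrow> cost_equicontinuous u \<and> cost_equicontinuous v \<and>
    (\<forall>a\<in>unit_sphere. \<bar>u a\<bar> \<le> pi\<^sup>2 / 2 \<and> \<bar>v a\<bar> \<le> pi\<^sup>2 / 2) \<and>
    (\<forall>a\<in>unit_sphere. \<forall>b\<in>unit_sphere. u a + v b \<le> cost a b) \<and>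
    (\<forall>i\<in>{1..n}. u (X n i) + v (Y n i) = cost (X n i) (Y n i))" for n u v
  have "\<exists>u v. 1 \<le> n \<longrightarrow> good n u v" for n
  proof (cases "1 \<le> n")
    case True
    obtain u v where "cost_equicontinuous u" "cost_equicontinuous v"
      "\<And>x. x \<in> unit_sphere \<Longrightarrow> \<bar>u x\<bar> \<le> pi\<^sup>2 / 2" "\<And>x. x \<in> unit_sphere \<Longrightarrow> \<bar>v x\<bar> \<le> pi\<^sup>2 / 2"
      "\<And>a b. a \<in> unit_sphere \<Longrightarrow> b \<in> unit_sphere \<Longrightarrow> u a + v b \<le> cost a b"
      "\<And>i. i \<in> {1..n} \<Longrightarrow> u (X n i) + v (Y n i) = cost (X n i) (Y n i)"
      using cost_potentials_on_sphere[OF True X Y opt] by metis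
    then have "good n u v" unfolding good_def by blast
    then show ?thesis by blast
  qed simp
  then obtain u v where uv: "\<And>n. 1 \<le> n \<Longrightarrow> good n (u n) (v n)" by metis
  have ev: "eventually (\<lambda>n. good n (u n) (v n)) F" using F(2) by eventually_elim (rule uv)
  have evu: "eventually (\<lambda>n. cost_equicontinuous (u n)) F" and evv: "eventually (\<lambda>n. cost_equicontinuous (v n)) F"
    using ev by (auto elim!: eventually_mono simp: good_def)

  have "\<exists>l. z \<in> unit_sphere \<longrightarrow> ((\<lambda>n. u n z) \<longlongrightarrow> l) F" for z
  proof (cases "z \<in> unit_sphere")
    case True
    have "eventually (\<lambda>n. \<bar>u n z\<bar> \<le> pi\<^sup>2 / 2) F"
      using ev by eventually_elim (use True in \<open>simp only: good_def\<close>)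
    then show ?thesis using ultra_bounded_limit[OF F(1)] by metis
  qed simp
  then obtain u' where u': "\<And>z. z \<in> unit_sphere \<Longrightarrow> ((\<lambda>n. u n z) \<longlongrightarrow> u' z) F" by metis
  have "\<exists>l. z \<in> unit_sphere \<longrightarrow> ((\<lambda>n. v n z) \<longlongrightarrow> l) F" for z
  proof (cases "z \<in> unit_sphere")
    case True
    have "eventually (\<lambda>n. \<bar>v n z\<bar> \<le> pi\<^sup>2 / 2) F"
      using ev by eventually_elim (use True in \<open>simp only: good_def\<close>)
    then show ?thesis using ultra_bounded_limit[OF F(1)] by metis
  qed simp
  then obtain v' where v': "\<And>z. z \<in> unit_sphere \<Longrightarrow> ((\<lambda>n. v n z) \<longlongrightarrow> v' z) F" by metis
  have equ': "cost_equicontinuous u'" by (rule cost_equicontinuous_limit[OF Fnb evu u'])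
  have eqv': "cost_equicontinuous v'" by (rule cost_equicontinuous_limit[OF Fnb evv v'])
  note cu' = cost_equicontinuous_continuous[OF equ'] and cv' = cost_equicontinuous_continuous[OF eqv']
  have le: "u' a + v' b \<le> cost a b" if "a \<in> unit_sphere" "b \<in> unit_sphere" for a b
  proof (rule tendsto_upperbound[OF tendsto_add[OF u'[OF that(1)] v'[OF that(2)]] _ Fnb])
    show "eventually (\<lambda>n. u n a + v n b \<le> cost a b) F"
      using ev by eventually_elim (use that in \<open>simp only: good_def\<close>)
  qed

  have contact0: "u' z0 + v' y0 = cost z0 y0"
  proof (rule tendsto_unique[OF Fnb])
    have "eventually (\<lambda>n. cost_equicontinuous (u n) \<and> X n (k n) \<in> unit_sphere) F"
      using evu k by eventually_elim (use X in blast)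
    moreover have "eventually (\<lambda>n. cost_equicontinuous (v n) \<and> Y n (k n) \<in> unit_sphere) F"
      using evv k by eventually_elim (use Y in blast)
    ultimately show "((\<lambda>n. u n (X n (k n)) + v n (Y n (k n))) \<longlongrightarrow> u' z0 + v' y0) F"
      by (intro tendsto_add cost_equicontinuous_tendsto[where u = u and b = z0, OF _ u'[OF z0] limX z0]
          cost_equicontinuous_tendsto[where u = v and b = y0, OF _ v'[OF y0] limY y0])
    have c: "((\<lambda>n. cost (X n (k n)) (Y n (k n))) \<longlongrightarrow> cost z0 y0) F"
    proof -
      have c1: "continuous_on (unit_sphere \<times> unit_sphere) (\<lambda>p. cost (fst p) (snd p :: real ^ 'd))"
        by (intro continuous_on_cost continuous_intros) auto
      have c2: "((\<lambda>n. (X n (k n), Y n (k n))) \<longlongrightarrow> (z0, y0)) F" by (intro tendsto_Pair limX limY)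
      have c3: "eventually (\<lambda>n. (X n (k n), Y n (k n)) \<in> unit_sphere \<times> unit_sphere) F"
        using k by eventually_elim (use X Y in blast)
      have c4: "(z0, y0) \<in> unit_sphere \<times> unit_sphere" using z0 y0 by blast
      show ?thesis
        using continuous_on_tendsto_compose[OF c1 c2 c4 c3] by (simp only: fst_conv snd_conv)
    qed
    show "((\<lambda>n. u n (X n (k n)) + v n (Y n (k n))) \<longlongrightarrow> cost z0 y0) F"
      using c by (rule Lim_transform_eventually)
        (use ev k in \<open>eventually_elim, simp only: good_def\<close>)
  qed

  obtain Lu where Lu: "((\<lambda>n. row_average X (u n) n) \<longlongrightarrow> Lu) F"
  proof -
    have "eventually (\<lambda>n. \<bar>row_average X (u n) n\<bar> \<le> pi\<^sup>2 / 2) F"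
      using ev F(2) by eventually_elim (intro row_average_abs_le, use X in \<open>auto simp only: good_def\<close>)
    then show ?thesis using that ultra_bounded_limit[OF F(1)] by metis
  qed
  obtain Lv where Lv: "((\<lambda>n. row_average Y (v n) n) \<longlongrightarrow> Lv) F"
  proof -
    have "eventually (\<lambda>n. \<bar>row_average Y (v n) n\<bar> \<le> pi\<^sup>2 / 2) F"
      using ev F(2) by eventually_elim (intro row_average_abs_le, use Y in \<open>auto simp only: good_def\<close>)
    then show ?thesis using that ultra_bounded_limit[OF F(1)] by metis
  qed
  have C: "((\<lambda>n. (\<Sum>i=1..n. cost (X n i) (Y n i)) / n) \<longlongrightarrow> Lu + Lv) F"
  proof (rule Lim_transform_eventually[OF tendsto_add[OF Lu Lv]])
    show "eventually (\<lambda>n. row_average X (u n) n + row_average Y (v n) n = (\<Sum>i=1..n. cost (X n i) (Y n i)) / n) F"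
      using ev
    proof eventually_elim
      case (elim n)
      have "row_average X (u n) n + row_average Y (v n) n = (\<Sum>i=1..n. u n (X n i) + v n (Y n i)) / n"
        by (simp add: row_average_def sum.distrib add_divide_distrib)
      also have "(\<Sum>i=1..n. u n (X n i) + v n (Y n i)) = (\<Sum>i=1..n. cost (X n i) (Y n i))"
        using elim by (intro sum.cong) (simp_all only: good_def)
      finally show ?case .
    qed
  qed
  have small: "\<bar>Lu - (LINT z|P. u' z)\<bar> \<le> 2 * e \<and> \<bar>Lv - (LINT z|U. v' z)\<bar> \<le> 2 * e \<and>
      (LINT z|P. cost z (S z)) \<le> Lu + Lv + 3 * e" if e: "0 < e" for e
  proof -
    obtain d where d: "0 < d" "\<And>x x' y y' :: real ^ 'd. \<lbrakk>x \<in> unit_sphere; x' \<in> unit_sphere; y \<in> unit_sphere;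
        y' \<in> unit_sphere; dist x x' < d; dist y y' < d\<rbrakk> \<Longrightarrow> \<bar>cost x y - cost x' y'\<bar> < e"
      using cost_uniformly_continuous[OF e] by metis
    obtain m where "inverse (real (Suc m)) < d" using reals_Archimedean[OF d(1)] by blast
    then have m: "1 / real (Suc m) < d" by (simp add: inverse_eq_divide)
    have m0: "0 < 1 / real (Suc m)" by simp
    have d': "\<bar>cost x y - cost x' y'\<bar> < e" if "x \<in> unit_sphere" "x' \<in> unit_sphere" "y \<in> unit_sphere"
        "y' \<in> unit_sphere" "dist x x' < 1 / real (Suc m)" "dist y y' < 1 / real (Suc m)" for x x' y y' :: "real ^ 'd"
      using d(2)[OF that(1-4)] that(5,6) m by linarith
    obtain K y and \<phi> :: "nat \<Rightarrow> real ^ 'd \<Rightarrow> real" where \<phi>: "\<And>j. continuous_on unit_sphere (\<phi> j)" "fine_partition K \<phi> y (1 / real (Suc m))"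
      using sphere_partition_of_unity[OF m0] by metis
    have Q: "{z \<in> unit_sphere. cell m z = j} \<in> sets P" for j
      using measurable_sets[OF cells(1)[of m], of "{j}"] Pd(2) by (simp add: vimage_def Int_def conj_commute)
    have 1: "\<bar>Lu - (LINT z|P. u' z)\<bar> \<le> 2 * e"
    proof (rule row_average_limit_near_integral[OF cells(3)[of m] Fnb F(2) X Pd(1,3)
          icont[OF Pd(1,2) cu'] _ _ u'])
      show "integrable P (\<lambda>z. indicat_real {z \<in> unit_sphere. cell m z = j} z)" for j
        using Q by (simp add: P.emeasure_eq_measure)
      show "(row_average X (\<lambda>z. indicat_real {z \<in> unit_sphere. cell m z = j} z) \<longlongrightarrow>
          (LINT z|P. indicat_real {z \<in> unit_sphere. cell m z = j} z)) F" for j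
        using avgX[of m j] Q by simp
      show "\<bar>u n a - u n b\<bar> \<le> e" if "1 \<le> n" "a \<in> unit_sphere" "b \<in> unit_sphere" "dist a b < 1 / real (Suc m)" for n a b
        by (rule cost_equicontinuous_uniform[OF _ d' that(2-4)]) (use uv[OF that(1)] in \<open>simp_all only: good_def\<close>)
      show "\<bar>u' a - u' b\<bar> \<le> e" if "a \<in> unit_sphere" "b \<in> unit_sphere" "dist a b < 1 / real (Suc m)" for a b
        by (rule cost_equicontinuous_uniform[OF equ' d' that])
    qed (assumption, assumption, rule Lu)
    have 2: "\<bar>Lv - (LINT z|U. v' z)\<bar> \<le> 2 * e"
    proof (rule row_average_limit_near_integral[OF \<phi>(2) Fnb F(2) Y U.prob_space_axioms sU(2)
          icont[OF U.prob_space_axioms sU(1) cv'] icont[OF U.prob_space_axioms sU(1) \<phi>(1)] _ v'])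
      show "(row_average Y (\<phi> j) \<longlongrightarrow> (LINT z|U. \<phi> j z)) F" for j
        unfolding U_def by (rule avgY[OF \<phi>(1)])
      show "\<bar>v n a - v n b\<bar> \<le> e" if "1 \<le> n" "a \<in> unit_sphere" "b \<in> unit_sphere" "dist a b < 1 / real (Suc m)" for n a b
        by (rule cost_equicontinuous_uniform[OF _ d' that(2-4)]) (use uv[OF that(1)] in \<open>simp_all only: good_def\<close>)
      show "\<bar>v' a - v' b\<bar> \<le> e" if "a \<in> unit_sphere" "b \<in> unit_sphere" "dist a b < 1 / real (Suc m)" for a b
        by (rule cost_equicontinuous_uniform[OF eqv' d' that])
    qed (assumption, assumption, rule Lv)
    have "\<exists>T \<in> transport_maps P uniform_sphere. (LINT z|P. cost z (T z)) \<le> Lu + Lv + 3 * e"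
      by (rule map_cost_le_limit_assignment_cost[OF dim P F X Y cells(1)[of m] cells(2)[of _ m] cells(3)[of m] \<phi> avgX avgY[OF \<phi>(1)] d' m0 C])
    then have "(LINT z|P. cost z (S z)) \<le> Lu + Lv + 3 * e" using Sopt unfolding U_def by fastforce
    with 1 2 show ?thesis by blast
  qed
  have cS: "continuous_on unit_sphere (\<lambda>z. cost z (S z))"
    using SS by (intro continuous_on_cost continuous_on_id Sc) auto
  have cvS: "continuous_on unit_sphere (\<lambda>z. v' (S z))"
    using SS by (intro continuous_on_compose2[OF cv' Sc]) auto
  define \<psi> where "\<psi> z = cost z (S z) - (u' z + v' (S z))" for z
  have c\<psi>: "continuous_on unit_sphere \<psi>"
    unfolding \<psi>_def[abs_def] by (intro continuous_on_diff continuous_on_add cS cu' cvS)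
  have LvS: "(LINT z|U. v' z) = (LINT z|P. v' (S z))"
    unfolding S(2)[symmetric]
    using S(1) borel_measurable_sphereI[OF cv' refl]
    by (intro integral_distr) (auto simp: measurable_cong_sets[OF Pd(2) refl])
  have "(LINT z|P. \<psi> z) = (LINT z|P. cost z (S z)) - ((LINT z|P. u' z) + (LINT z|P. v' (S z)))"
    unfolding \<psi>_def using icont[OF Pd(1,2)] cS cu' cvS
    by (simp add: Bochner_Integration.integral_diff Bochner_Integration.integral_add)
  moreover have "(LINT z|P. cost z (S z)) - ((LINT z|P. u' z) + (LINT z|U. v' z)) \<le> 0"
  proof (rule field_le_epsilon)
    fix e :: real assume "0 < e"
    then show "(LINT z|P. cost z (S z)) - ((LINT z|P. u' z) + (LINT z|U. v' z)) \<le> 0 + e"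
      \<comment> \<open>7 = 2 + 2 + 3, the three errors bounded by \<open>small\<close>\<close>
      using small[of "e / 7"] by linarith
  qed
  ultimately have i\<psi>: "(LINT z|P. \<psi> z) \<le> 0" using LvS by simp
  have "\<psi> z = 0" if "z \<in> unit_sphere" for z
    using le[OF _ SS]
    by (intro continuous_nonneg_integral_zero[OF P c\<psi> _ icont[OF Pd(1,2) c\<psi>] i\<psi> that]) (simp add: \<psi>_def)
  then have contact: "u' z + v' (S z) = cost z (S z)" if "z \<in> unit_sphere" for z
    using that by (simp add: \<psi>_def)
  \<comment> \<open>If \<open>S\<close> reached the antipode of \<open>z0\<close>, it would be constant, but the uniform law has no atoms.\<close>
  have na: "S z0 \<noteq> - z0"
  proof
    assume a: "S z0 = - z0"
    have "S z = - z0" if z: "z \<in> unit_sphere" for z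
    proof (cases "z = z0")
      case False
      have "cost z (S z) + cost z0 (- z0) \<le> cost z (- z0) + cost z0 (S z)"
        using contact[OF z] contact[OF z0] le[OF z SS[OF z0]] le[OF z0 SS[OF z]] unfolding a by linarith
      then show ?thesis by (rule monotone_antipode_constant[OF z0 z SS[OF z] False])
    qed (use a in simp)
    then have "{z \<in> space P. S z \<in> {- z0}} = space P" using Pd(3) by auto
    moreover have "{- z0} \<in> sets sphere_borel" using z0 by (simp add: sets_sphere_borel)
    ultimately have "emeasure U {- z0} = 1"
      unfolding S(2)[symmetric] using S(1) P.emeasure_space_1
      by (simp add: emeasure_distr measurable_cong_sets[OF Pd(2) refl] vimage_def Int_def conj_commute)
    moreover have "emeasure U {- z0} = 0"
    proof -
      obtain i j :: 'd where ij: "i \<noteq> j"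
        using two_coordinates[OF dim] by blast
      let ?N = "{x \<in> unit_sphere. x $ i / x $ j = (- z0) $ i / (- z0) $ j}"
      have N: "?N \<in> null_sets U"
        unfolding U_def by (rule surface_null_imp_uniform_null[OF surface_measure_ratio_level[OF ij]])
      have "emeasure U {- z0} \<le> emeasure U ?N"
        using z0 by (intro emeasure_mono null_setsD2[OF N]) simp
      then show ?thesis using null_setsD1[OF N] by simp
    qed
    ultimately show False by simp
  qed
  show ?thesis
  proof (rule monotone_partner_unique[OF dim Sc SS z0 y0 _ na])
    fix z :: "real ^ 'd" assume z: "z \<in> unit_sphere"
    show "cost z (S z) + cost z0 y0 \<le> cost z y0 + cost z0 (S z)"
      using contact[OF z] contact0 le[OF z y0] le[OF z0 SS[OF z]] by linarith
  qed
qed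

section \<open>The Glivenko-Cantelli theorem\<close>

lemma bounded_max_tendsto_zeroI:
  fixes a :: "nat \<Rightarrow> nat \<Rightarrow> real"
  assumes nonneg: "\<And>n i. 0 \<le> a n i"
    and bad: "\<And>e. 0 < e \<Longrightarrow> \<not> (\<exists>\<^sub>F n in sequentially. \<exists>i\<in>{1..n}. e \<le> a n i)"
  shows "(\<lambda>n. MAX i\<in>{1..n}. a n i) \<longlonglongrightarrow> 0"
  unfolding tendsto_iff
proof (intro allI impI)
  fix e :: real assume e: "0 < e"
  have "\<forall>\<^sub>F n in sequentially. \<forall>i\<in>{1..n}. a n i < e"
    using bad[OF e] by (simp add: frequently_def not_le)
  then show "\<forall>\<^sub>F n in sequentially. dist (MAX i\<in>{1..n}. a n i) 0 < e"
    using eventually_ge_at_top[of 1]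
  proof eventually_elim
    case (elim n)
    then have ne: "a n ` {1..n} \<noteq> {}" by auto
    have "(MAX i\<in>{1..n}. a n i) < e" using elim ne by (subst Max_less_iff) auto
    moreover have "0 \<le> (MAX i\<in>{1..n}. a n i)"
      using nonneg[of n 1] elim(2) by (subst Max_ge_iff) (auto intro!: bexI[of _ 1])
    ultimately show ?case by (simp add: dist_real_def)
  qed
qed

text \<open>
  If some sample point stays \<open>e\<close>-far from its image for infinitely many \<open>n\<close>, an ultrafilter refines the
  filter of these \<open>n\<close>, and compactness provides the limit pair for which
  \<open>assignment_limits_at_map\<close> yields a contradiction.
\<close>

lemma glivenko_cantelli_deterministic:
  fixes P :: "(real ^ 'd) measure" and X :: "nat \<Rightarrow> nat \<Rightarrow> real ^ 'd"
  assumes dim: "CARD('d) \<ge> 2" and P: "P \<in> bounded_density_laws" and dF: "directional_df P S"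
    and X: "\<And>n i. i \<in> {1..n} \<Longrightarrow> X n i \<in> unit_sphere"
    and grid: "\<And>n. g n ` {1..n} \<subseteq> unit_sphere" and inj: "\<And>n. inj_on (g n) {1..n}"
    and conv: "weakly_converges_sphere (\<lambda>n. discrete_uniform (g n ` {1..n})) uniform_sphere"
    and emp: "\<And>n. empirical_directional_df n (g n) (X n) (Sn n)"
    and cells: "\<And>m. cell m \<in> measurable sphere_borel (count_space UNIV)"
      "\<And>m z. z \<in> unit_sphere \<Longrightarrow> cell m z < J m"
      "\<And>m. fine_partition (J m) (\<lambda>j z. indicat_real {z \<in> unit_sphere. cell m z = j} z) (x m) (1 / Suc m)"
    and avgX: "\<And>m j. row_average X (indicat_real {z \<in> unit_sphere. cell m z = j})
        \<longlonglongrightarrow> measure P {z \<in> unit_sphere. cell m z = j}"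
  shows "(\<lambda>n. MAX i\<in>{1..n}. norm (Sn n (X n i) - S (X n i))) \<longlonglongrightarrow> 0"
proof (rule bounded_max_tendsto_zeroI)
  fix e :: real assume e: "0 < e"
  define Y where "Y n i = Sn n (X n i)" for n i
  have Yg: "\<exists>t. t permutes {1..n} \<and> (\<forall>i\<in>{1..n}. Y n i = g n (t i))" for n
    using empirical_directional_df_permutation[OF emp inj] unfolding Y_def by metis
  have Y: "Y n i \<in> unit_sphere" if i: "i \<in> {1..n}" for n i
  proof -
    obtain t where t: "t permutes {1..n}" "\<forall>i\<in>{1..n}. Y n i = g n (t i)" using Yg by blast
    then show ?thesis using grid[of n] i permutes_in_image[OF t(1), of i] by blast
  qed
  have avgY: "row_average Y f \<longlonglongrightarrow> (LINT z|uniform_sphere. f z)" if f: "continuous_on unit_sphere f" for f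
  proof -
    have "row_average Y f n = (LINT z|discrete_uniform (g n ` {1..n}). f z)" for n
    proof -
      obtain t where t: "t permutes {1..n}" "\<forall>i\<in>{1..n}. Y n i = g n (t i)" using Yg by blast
      have "(\<Sum>i=1..n. f (Y n i)) = (\<Sum>i=1..n. f (g n (t i)))" using t(2) by (intro sum.cong) auto
      also have "\<dots> = (\<Sum>i=1..n. f (g n i))"
        using sum.permute[OF t(1), of "\<lambda>i. f (g n i)"] by (simp add: comp_def)
      finally show ?thesis
        unfolding row_average_def integral_discrete_uniform[OF grid inj f] by (simp only:)
    qed
    moreover have "bounded (f ` unit_sphere)"
      by (intro compact_imp_bounded compact_continuous_image f compact_sphere)
    ultimately show ?thesis
      using conv f unfolding weakly_converges_sphere_def by presburger
  qed
  show "\<not> (\<exists>\<^sub>F n in sequentially. \<exists>i\<in>{1..n}. e \<le> norm (Sn n (X n i) - S (X n i)))"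
  proof
    assume bad: "\<exists>\<^sub>F n in sequentially. \<exists>i\<in>{1..n}. e \<le> norm (Sn n (X n i) - S (X n i))"
    define B where "B = {n. \<exists>i\<in>{1..n}. e \<le> norm (Y n i - S (X n i))}"
    have "inf sequentially (principal B) \<noteq> bot"
      using bad by (simp add: trivial_limit_def eventually_inf_principal frequently_def B_def Y_def)
    then obtain F where F: "F \<le> inf sequentially (principal B)" "ultra F" by (rule ultra_refinement)
    have Fs: "F \<le> sequentially" using F(1) by simp
    have FB: "eventually (\<lambda>n. n \<in> B) F" using F(1) by (simp add: le_principal)
    have Fnb: "F \<noteq> bot" using F(2) by (simp add: ultra_def)
    have F1: "eventually (\<lambda>n. 1 \<le> n) F"
      using filter_leD[OF Fs eventually_ge_at_top[of 1]] .
    have "\<exists>i. n \<in> B \<longrightarrow> i \<in> {1..n} \<and> e \<le> norm (Y n i - S (X n i))" for n unfolding B_def by blast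
    then obtain k where k: "\<And>n. n \<in> B \<Longrightarrow> k n \<in> {1..n} \<and> e \<le> norm (Y n (k n) - S (X n (k n)))" by metis
    have k1: "eventually (\<lambda>n. k n \<in> {1..n}) F"
      and k2: "eventually (\<lambda>n. e \<le> norm (Y n (k n) - S (X n (k n)))) F"
      using FB by (eventually_elim, use k in blast)+
    have XS: "eventually (\<lambda>n. X n (k n) \<in> unit_sphere) F" using k1 by eventually_elim (rule X)
    have YS: "eventually (\<lambda>n. Y n (k n) \<in> unit_sphere) F" using k1 by eventually_elim (rule Y)
    obtain z0 where z0: "z0 \<in> unit_sphere" "((\<lambda>n. X n (k n)) \<longlongrightarrow> z0) F"
      by (rule ultra_compact_limit[OF F(2) compact_sphere XS])
    obtain y0 where y0: "y0 \<in> unit_sphere" "((\<lambda>n. Y n (k n)) \<longlongrightarrow> y0) F"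
      by (rule ultra_compact_limit[OF F(2) compact_sphere YS])
    have opt: "(\<Sum>i=1..n. cost (X n i) (Y n i)) \<le> (\<Sum>i=1..n. cost (X n i) (Y n (p i)))"
      if "p permutes {1..n}" for n p
      unfolding Y_def by (rule empirical_directional_df_optimal[OF emp inj that])
    have "y0 = S z0"
    proof (rule assignment_limits_at_map[OF dim P dF F(2) F1 X Y opt cells _ _ k1 z0(2) y0(2) z0(1) y0(1)])
      show "(row_average X (indicat_real {z \<in> unit_sphere. cell m z = j})
          \<longlongrightarrow> measure P {z \<in> unit_sphere. cell m z = j}) F" for m j
        by (rule tendsto_mono[OF Fs avgX])
      show "(row_average Y f \<longlongrightarrow> (LINT z|uniform_sphere. f z)) F" if "continuous_on unit_sphere f" for f
        by (rule tendsto_mono[OF Fs avgY[OF that]])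
    qed
    have Sc: "continuous_on unit_sphere S" using dF by (simp add: directional_df_def)
    have "((\<lambda>n. norm (Y n (k n) - S (X n (k n)))) \<longlongrightarrow> norm (y0 - S z0)) F"
      by (intro tendsto_norm tendsto_diff y0(2) continuous_on_tendsto_compose[OF Sc z0(2) z0(1) XS])
    then have "e \<le> norm (y0 - S z0)" by (rule tendsto_lowerbound[OF _ k2 Fnb])
    then show False using e \<open>y0 = S z0\<close> by simp
  qed
qed simp

theorem proposition5:
  fixes M :: "'w measure"
    and P :: "(real ^ 'd) measure"
    and Z :: "nat \<Rightarrow> nat \<Rightarrow> 'w \<Rightarrow> real ^ 'd"
    and g :: "nat \<Rightarrow> nat \<Rightarrow> real ^ 'd"
    and F :: "real ^ 'd \<Rightarrow> real ^ 'd"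
    and Fn :: "nat \<Rightarrow> 'w \<Rightarrow> real ^ 'd \<Rightarrow> real ^ 'd"
  assumes dim: "CARD('d) \<ge> 2"
    and M: "prob_space M"
    and P: "P \<in> bounded_density_laws"
    and indep: "\<And>n. prob_space.indep_vars M (\<lambda>_. sphere_borel) (Z n) {1..n}"
    and ident: "\<And>n i. i \<in> {1..n} \<Longrightarrow> distr M sphere_borel (Z n i) = P"
    and F: "directional_df P F"
    and grid: "\<And>n. g n ` {1..n} \<subseteq> unit_sphere"
    and grid_distinct: "\<And>n. inj_on (g n) {1..n}"
    and grid_conv: "weakly_converges_sphere (\<lambda>n. discrete_uniform (g n ` {1..n})) uniform_sphere"
    and Fn: "\<And>n. AE \<omega> in M. empirical_directional_df n (g n) (\<lambda>i. Z n i \<omega>) (Fn n \<omega>)"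
  shows "AE \<omega> in M.
    (\<lambda>n. MAX i \<in> {1..n}. norm (Fn n \<omega> (Z n i \<omega>) - F (Z n i \<omega>))) \<longlonglongrightarrow> 0"
proof -
  interpret prob_space M by (rule M)
  define good where "good m J c x \<longleftrightarrow> c \<in> measurable sphere_borel (count_space UNIV) \<and>
      (\<forall>z \<in> unit_sphere. c z < J) \<and>
      fine_partition J (\<lambda>j z. indicat_real {z \<in> unit_sphere. c z = j} z) x (1 / Suc m)"
    for m J :: nat and c :: "real ^ 'd \<Rightarrow> nat" and x
  have "\<exists>J c x. good m J c x" for m
  proof -
    have "0 < 1 / real (Suc m)" by simp
    then show ?thesis unfolding good_def by (rule sphere_cells) blast
  qed
  then obtain J cell x where "\<And>m. good m (J m) (cell m) (x m)" by metis
  then have cells: "\<And>m. cell m \<in> measurable sphere_borel (count_space UNIV)"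
      "\<And>m z. z \<in> unit_sphere \<Longrightarrow> cell m z < J m"
      "\<And>m. fine_partition (J m) (\<lambda>j z. indicat_real {z \<in> unit_sphere. cell m z = j} z) (x m) (1 / Suc m)"
    unfolding good_def by blast+
  have Q: "{z \<in> unit_sphere. cell m z = j} \<in> sets sphere_borel" for m j
    using measurable_sets[OF cells(1)[of m], of "{j}"] by (simp add: vimage_def Int_def conj_commute)
  have "AE \<omega> in M. \<forall>m j. (\<lambda>n. (\<Sum>i=1..n. indicat_real {z \<in> unit_sphere. cell m z = j} (Z n i \<omega>)) / n)
      \<longlonglongrightarrow> measure P {z \<in> unit_sphere. cell m z = j}"
    unfolding AE_all_countable using rowwise_iid_frequency_limit[OF indep ident Q] by blast
  moreover have "AE \<omega> in M. \<forall>n. empirical_directional_df n (g n) (\<lambda>i. Z n i \<omega>) (Fn n \<omega>)"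
    unfolding AE_all_countable using Fn by blast
  ultimately show ?thesis
    using AE_space
  proof eventually_elim
    case (elim \<omega>)
    have Z: "Z n i \<omega> \<in> unit_sphere" if "i \<in> {1..n}" for n i
    proof -
      have "Z n i \<in> measurable M sphere_borel" using indep[of n] that unfolding indep_vars_def by auto
      then show ?thesis using measurable_space[of "Z n i" M sphere_borel \<omega>] elim(3) by simp
    qed
    show ?case
    proof (rule glivenko_cantelli_deterministic[where X = "\<lambda>n i. Z n i \<omega>", OF dim P F Z grid grid_distinct grid_conv _ cells])
      show "row_average (\<lambda>n i. Z n i \<omega>) (indicat_real {z \<in> unit_sphere. cell m z = j})
          \<longlonglongrightarrow> measure P {z \<in> unit_sphere. cell m z = j}" for m j
        using elim(1) by (simp add: row_average_def[abs_def])
      show "empirical_directional_df n (g n) (\<lambda>i. Z n i \<omega>) (Fn n \<omega>)" for n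
        using elim(2) by (rule spec)
    qed assumption
  qed
qed

end
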